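(* Let $U\subset\mathbb R^3$ be open and connected, $\varepsilon>0$, $\delta=\tfrac23\varepsilon^{3/2}$, and let $$\psi:(-\varepsilon,\varepsilon)\times U\to(-\delta,\delta)\times U,\qquad \psi(t,x)=(\tilde t,x),\quad \tilde t=\tfrac23\,\eta\,(\eta t)^{3/2},\quad \eta=\mathrm{sign}(t).$$ Let $V$ be an analytic function (the potential). (1) Let $$\tilde g=-\eta\,d\tilde t^2+\tilde g_{ij}(\tilde t,x)\,dx^idx^j\qquad(\eta=\mathrm{sign}(\tilde t))$$ with $(\tilde g_{ij})$ positive definite, and let $\tilde\phi$ be a scalar field, such that the functions $\tilde g_{ij}$ and $\tilde\phi$ depend analytically on $(\eta\tilde t^2,x^1,x^2,x^3)$ and such that $(\tilde g,\tilde\phi)$ solves the Einstein--scalar field equations with potential $V$ for $\tilde t\ne0$. Then $(g,\phi)=(\psi^*\tilde g,\tilde\phi\circ\psi)$ has the form $$g=-t\,dt^2+g_{ij}(t,x)\,dx^idx^j,$$ where $g_{ij}$ and $\phi$ depend analytically on $(t^3,x^1,x^2,x^3)$. In particular $g$ extends to an analytic transverse, type changing metric with transverse radical. Moreover $(g,\phi)$ solves the Einstein--scalar field equations with potential $V$ for $t\neq0$, and its energy momentum tensor is bounded near $\{t=0\}$. (2) Conversely, let $g=-t\,dt^2+g_{ij}(t,x)\,dx^idx^j$ with $g_{ij}$ and $\phi$ real analytic on $(-\varepsilon,\varepsilon)\times U$ and $(g_{ij})$ positive definite. Suppose that $(g,\phi)$ solves the Einstein--scalar field equations with potential $V$ for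 $t\ne0$ and that its energy momentum tensor is bounded near $\{t=0\}$. Then $(g,\phi)=(\psi^*\tilde g,\tilde\phi\circ\psi)$ for a pair $(\tilde g,\tilde\phi)$ as in (1).
   Context: The Einstein--scalar field equations with potential $V$ for a pair $(g,\phi)$ (at points where $g$ is non-degenerate) are $\mathrm{Ric}-\tfrac12 s\,g=\kappa T$ with a fixed constant $\kappa>0$ and $$T_{ab}=\partial_a\phi\,\partial_b\phi-\tfrac12\bigl(g(\mathrm{grad}\,\phi,\mathrm{grad}\,\phi)+V(\phi)\bigr)g_{ab}.$$ Here $\mathrm{Ric}$ is the Ricci tensor and $s$ the scalar curvature of $g$. The energy momentum tensor is "bounded near $\{t=0\}$" if its components in the coordinates $(t,x^1,x^2,x^3)$ are bounded on $W\setminus\{t=0\}$ for some neighbourhood $W$ of each point of $\{t=0\}$. A function $f(\tilde t,x)$ "depends analytically on $(\eta\tilde t^2,x)$" if $f(\tilde t,x)=F(\eta\tilde t^2,x)$ with $F$ real analytic and $\eta=\mathrm{sign}(\tilde t)$. A function $f(t,x)$ "depends analytically on $(t^3,x)$" if $f(t,x)=F(t^3,x)$ with $F$ real analytic. A symmetric $C^k$ $(0,2)$-tensor field $g$ on a 4-manifold is a *transverse, type changing* metric if at every point where it is degenerate $d(\det(g_{ab}))\neq0$, and where non-degenerate it is either Riemannian or Lorentzian. It has *transverse radical* if at every point $x$ of the degeneracy hypersurface $\mathcal D$ the space $\mathrm{Rad}_x=\{v : g(v,\cdot)=0\}$ is transverse to $T_x\mathcal D$. *)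

theory Defs
  imports "HOL-Analysis.Analysis"
begin

section \<open>Real analytic functions of several variables\<close>

text \<open>Around every point of the set, the function is the sum of an (absolutely) convergent
  power series. Multi-indices are the extensional functions from the standard basis to the naturals.\<close>

definition real_analytic_on :: "('a::euclidean_space \<Rightarrow> real) \<Rightarrow> 'a set \<Rightarrow> bool" where
  "real_analytic_on f S \<longleftrightarrow>
     (\<forall>p\<in>S. \<exists>r>0. \<exists>c :: ('a \<Rightarrow> nat) \<Rightarrow> real. \<forall>q\<in>ball p r.
        ((\<lambda>\<alpha>. c \<alpha> * (\<Prod>b\<in>Basis. ((q - p) \<bullet> b) ^ \<alpha> b)) has_sum f q)
          (Basis \<rightarrow>\<^sub>E (UNIV :: nat set)))"

definition depends_analytically_via ::
    "('a::euclidean_space \<Rightarrow> 'b::euclidean_space) \<Rightarrow> 'a set \<Rightarrow> ('a \<Rightarrow> real) \<Rightarrow> bool" where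
  "depends_analytically_via \<Phi> S f \<longleftrightarrow>
     (\<exists>F. real_analytic_on F (\<Phi> ` S) \<and> (\<forall>p\<in>S. f p = F (\<Phi> p)))"


section \<open>Tensor calculus in one coordinate chart\<close>

text \<open>A (0,2)-tensor field is given by the matrices of its components.\<close>

type_synonym 'n tensor2 = "real^'n \<Rightarrow> real^'n^'n"

definition partial_deriv :: "'n \<Rightarrow> (real^'n \<Rightarrow> real) \<Rightarrow> real^'n \<Rightarrow> real" where
  "partial_deriv a f p = deriv (\<lambda>s. f (p + s *\<^sub>R axis a 1)) 0"

definition christoffel :: "'n::finite tensor2 \<Rightarrow> 'n \<Rightarrow> 'n \<Rightarrow> 'n \<Rightarrow> real^'n \<Rightarrow> real" where
  "christoffel g c a b p =
     (1/2) * (\<Sum>d\<in>UNIV. matrix_inv (g p) $ c $ d *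
        (partial_deriv a (\<lambda>q. g q $ d $ b) p + partial_deriv b (\<lambda>q. g q $ d $ a) p
          - partial_deriv d (\<lambda>q. g q $ a $ b) p))"

text \<open>Sign convention: the Ricci tensor of a round sphere is positive.\<close>

definition ricci :: "'n::finite tensor2 \<Rightarrow> 'n tensor2" where
  "ricci g p = (\<chi> a b.
     (\<Sum>c\<in>UNIV. partial_deriv c (christoffel g c a b) p - partial_deriv b (christoffel g c a c) p)
     + (\<Sum>c\<in>UNIV. \<Sum>d\<in>UNIV. christoffel g c c d p * christoffel g d a b p
          - christoffel g c b d p * christoffel g d a c p))"

definition scalar_curvature :: "'n::finite tensor2 \<Rightarrow> real^'n \<Rightarrow> real" where
  "scalar_curvature g p = (\<Sum>a\<in>UNIV. \<Sum>b\<in>UNIV. matrix_inv (g p) $ a $ b * ricci g p $ a $ b)"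

definition grad :: "'n::finite tensor2 \<Rightarrow> (real^'n \<Rightarrow> real) \<Rightarrow> real^'n \<Rightarrow> real^'n" where
  "grad g \<phi> p = matrix_inv (g p) *v (\<chi> b. partial_deriv b \<phi> p)"

definition energy_momentum ::
    "(real \<Rightarrow> real) \<Rightarrow> 'n::finite tensor2 \<Rightarrow> (real^'n \<Rightarrow> real) \<Rightarrow> 'n tensor2" where
  "energy_momentum V g \<phi> p = (\<chi> a b.
     partial_deriv a \<phi> p * partial_deriv b \<phi> p
     - (1/2) * (grad g \<phi> p \<bullet> (g p *v grad g \<phi> p) + V (\<phi> p)) * g p $ a $ b)"

definition solves_einstein_scalar ::
    "real \<Rightarrow> (real \<Rightarrow> real) \<Rightarrow> (real^'n) set \<Rightarrow> 'n::finite tensor2 \<Rightarrow> (real^'n \<Rightarrow> real) \<Rightarrow> bool" where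
  "solves_einstein_scalar \<kappa> V S g \<phi> \<longleftrightarrow>
     (\<forall>p\<in>S. ricci g p - (scalar_curvature g p / 2) *\<^sub>R g p = \<kappa> *\<^sub>R energy_momentum V g \<phi> p)"

definition pullback :: "(real^'n \<Rightarrow> real^'m) \<Rightarrow> 'm::finite tensor2 \<Rightarrow> 'n::finite tensor2" where
  "pullback \<psi> g p = (\<chi> a b. \<Sum>c\<in>UNIV. \<Sum>d\<in>UNIV.
     g (\<psi> p) $ c $ d * partial_deriv a (\<lambda>q. \<psi> q $ c) p * partial_deriv b (\<lambda>q. \<psi> q $ d) p)"


section \<open>Signature and transverse type changing metrics\<close>

definition positive_definite :: "real^'n^'n \<Rightarrow> bool" where
  "positive_definite A \<longleftrightarrow> transpose A = A \<and> (\<forall>v. v \<noteq> 0 \<longrightarrow> v \<bullet> (A *v v) > 0)"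

definition metric_index :: "real^'n^'n \<Rightarrow> nat" where
  "metric_index A = Max {dim W |W. subspace W \<and> (\<forall>v\<in>W. v \<noteq> 0 \<longrightarrow> v \<bullet> (A *v v) < 0)}"

definition lorentzian :: "real^'n^'n \<Rightarrow> bool" where
  "lorentzian A \<longleftrightarrow> transpose A = A \<and> det A \<noteq> 0 \<and> metric_index A = 1"

definition degeneracy_set :: "(real^'n) set \<Rightarrow> 'n::finite tensor2 \<Rightarrow> (real^'n) set" where
  "degeneracy_set S g = {p\<in>S. det (g p) = 0}"

definition radical :: "real^'n^'n \<Rightarrow> (real^'n) set" where
  "radical A = {v. \<forall>w. v \<bullet> (A *v w) = 0}"

text \<open>Tangent vectors of a subset: velocities of curves in the subset.\<close>

definition tangent_vectors :: "'a::real_normed_vector set \<Rightarrow> 'a \<Rightarrow> 'a set" where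
  "tangent_vectors D p = {v. \<exists>\<gamma> :: real \<Rightarrow> 'a. \<gamma> 0 = p \<and> (\<forall>\<^sub>F s in nhds 0. \<gamma> s \<in> D)
     \<and> (\<gamma> has_vector_derivative v) (at 0)}"

definition analytic_transverse_type_changing :: "(real^'n) set \<Rightarrow> 'n::finite tensor2 \<Rightarrow> bool" where
  "analytic_transverse_type_changing S g \<longleftrightarrow>
     (\<forall>a b. real_analytic_on (\<lambda>p. g p $ a $ b) S) \<and>
     (\<forall>p\<in>S. transpose (g p) = g p) \<and>
     (\<forall>p\<in>degeneracy_set S g. \<exists>L. ((\<lambda>q. det (g q)) has_derivative L) (at p) \<and> L \<noteq> (\<lambda>_. 0)) \<and>
     (\<forall>p\<in>S - degeneracy_set S g. positive_definite (g p) \<or> lorentzian (g p))"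

definition transverse_radical :: "(real^'n) set \<Rightarrow> 'n::finite tensor2 \<Rightarrow> bool" where
  "transverse_radical S g \<longleftrightarrow>
     (\<forall>p\<in>degeneracy_set S g.
        {v + w |v w. v \<in> radical (g p) \<and> w \<in> tangent_vectors (degeneracy_set S g) p} = UNIV)"


section \<open>The coordinates \<open>(t, x)\<close>\<close>

text \<open>The index \<open>None\<close> is the time index and \<open>Some i\<close> are the spatial indices.\<close>

type_synonym spacetime = "real^(3 option)"

definition time :: "spacetime \<Rightarrow> real" where
  "time p = p $ None"

definition space_part :: "spacetime \<Rightarrow> real^3" where
  "space_part p = (\<chi> i. p $ Some i)"

definition event :: "real \<Rightarrow> real^3 \<Rightarrow> spacetime" where
  "event t x = (\<chi> a. case a of None \<Rightarrow> t | Some i \<Rightarrow> x $ i)"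

text \<open>The product of the interval from \<open>-r\<close> to \<open>r\<close> with \<open>U\<close>.\<close>

definition slab :: "real \<Rightarrow> (real^3) set \<Rightarrow> spacetime set" where
  "slab r U = {event t x |t x. - r < t \<and> t < r \<and> x \<in> U}"

text \<open>The bilinear form \<open>n dt\<^sup>2 + h\<^sub>i\<^sub>j dx\<^sup>i dx\<^sup>j\<close>.\<close>

definition split_form :: "real \<Rightarrow> real^3^3 \<Rightarrow> real^(3 option)^(3 option)" where
  "split_form n h = (\<chi> a b. case (a, b) of
      (None, None) \<Rightarrow> n
    | (Some i, Some j) \<Rightarrow> h $ i $ j
    | _ \<Rightarrow> 0)"

definition psi :: "spacetime \<Rightarrow> spacetime" where
  "psi p = event (2/3 * sgn (time p) * (sgn (time p) * time p) powr (3/2)) (space_part p)"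

definition signed_square_time :: "spacetime \<Rightarrow> spacetime" where
  "signed_square_time p = event (sgn (time p) * (time p)\<^sup>2) (space_part p)"

definition cube_time :: "spacetime \<Rightarrow> spacetime" where
  "cube_time p = event ((time p) ^ 3) (space_part p)"

definition bounded_near_time_zero :: "spacetime set \<Rightarrow> (3 option) tensor2 \<Rightarrow> bool" where
  "bounded_near_time_zero S T \<longleftrightarrow>
     (\<forall>p\<in>S. time p = 0 \<longrightarrow> (\<exists>W B. open W \<and> p \<in> W \<and> W \<subseteq> S \<and>
        (\<forall>q\<in>W. time q \<noteq> 0 \<longrightarrow> (\<forall>a b. \<bar>T q $ a $ b\<bar> \<le> B))))"

text \<open>Solutions \<open>-\<eta> dt\<^sup>2 + h\<^sub>i\<^sub>j dx\<^sup>i dx\<^sup>j\<close> with \<open>\<eta> = sign t\<close> that depend analytically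
  on \<open>(\<eta> t\<^sup>2, x)\<close>. The sign at \<open>t = 0\<close> is immaterial: here it is \<open>sgn 0 = 0\<close>, and the pullback along
  \<open>psi\<close> does not depend on it, because the time derivative of \<open>psi\<close> vanishes there.\<close>

definition signed_square_solution ::
    "real \<Rightarrow> (real \<Rightarrow> real) \<Rightarrow> real \<Rightarrow> (real^3) set \<Rightarrow> (3 option) tensor2 \<Rightarrow> (spacetime \<Rightarrow> real) \<Rightarrow> bool" where
  "signed_square_solution \<kappa> V r U g \<phi> \<longleftrightarrow>
     (\<exists>h :: spacetime \<Rightarrow> real^3^3.
        (\<forall>p\<in>slab r U. g p = split_form (- sgn (time p)) (h p) \<and> positive_definite (h p)) \<and>
        (\<forall>i j. depends_analytically_via signed_square_time (slab r U) (\<lambda>p. h p $ i $ j))) \<and>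
     depends_analytically_via signed_square_time (slab r U) \<phi> \<and>
     solves_einstein_scalar \<kappa> V {p\<in>slab r U. time p \<noteq> 0} g \<phi>"

end

(*
In the coordinates (t, x) a metric -t dt^2 + h has, besides the constraints, the evolution equation
2 t L' - L = Q for L = h^-1 h' / 2, and the scalar field satisfies a wave equation of the same Fuchsian
form 2 t y' - y = Q for y = phi'. The indices 2 j - 1 never vanish, so the Taylor coefficients in t are
determined recursively. Give t degree 1 modulo 3: the right-hand sides then respect the grading in which h
and phi have degree 0, so only powers of t^3 occur, and psi turns t^3 into 9/4 sign(s) s^2 for the proper
time s.

The wave equation is obtained from Einstein's equations only after multiplication by phi', through the time
derivative of the Hamiltonian constraint (the contracted Bianchi identity). This suffices: at each point
(0, x), either the Taylor series of phi' in t vanishes or that of the wave operator does.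

The pullback by psi is a change of the time coordinate, under which both sides of Einstein's equations for
a metric n dt^2 + h scale by the same Jacobian factors.
*)

theory Submission
  imports Defs
begin

section \<open>Power series in one distinguished variable\<close>

text \<open>Analyticity is needed only at the two ends: in the hypotheses, and for the conclusion
  that a series in t with exponents divisible by 3 is a series in t^3, jointly with x. At time 0
  this is not a substitution, since the cube root has no power series there; it is a reindexing of
  an absolutely summable multi-index family. In between, curvature and the recursion are treated for
  smooth functions, which avoids closing analytic functions under products and inverses.

  The recursion has to gain orders: L enters its own equation with one order less than required. It
  does so only in the product t trL L, and the factor t restores the order; all other terms contain
  only h, \<phi> and their spatial derivatives.

  Which of the two flat cases holds for \<phi>' depends on x, and the set of x where the wave
  operator is flat need not be open, so vanishing there cannot be differentiated along x. Hence the
  right-hand side is graded over the whole open slice first and restricted to that set only for the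
  last step, which involves time derivatives alone.\<close>

text \<open>A multivariate power series is split as a power series in one variable, with coefficients
  that are themselves sums over the remaining multi-indices.\<close>

lemma power_family_coeff_summable:
  fixes D :: "nat \<Rightarrow> 'i \<Rightarrow> real"
  assumes "0 < R" and "\<And>s. \<bar>s\<bar> < R \<Longrightarrow> (\<lambda>(n, i). D n i * s ^ n) summable_on UNIV \<times> M"
  shows "D n summable_on M"
proof -
  have "(\<lambda>(n, i). D n i * (R/2) ^ n) summable_on UNIV \<times> M"
    using assms by auto
  then have "(\<lambda>i. D n i * (R/2) ^ n) summable_on M"
    using summable_on_SigmaD1[of "\<lambda>n i. D n i * (R/2) ^ n" UNIV "\<lambda>_. M" n] by auto
  moreover have "(R/2) ^ n \<noteq> 0"
    using assms by auto
  ultimately show ?thesis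
    by (simp add: summable_on_cmult_left')
qed

lemma power_family_sums:
  fixes D :: "nat \<Rightarrow> 'i \<Rightarrow> real"
  assumes "0 < R" and "\<And>s. \<bar>s\<bar> < R \<Longrightarrow> (\<lambda>(n, i). D n i * s ^ n) summable_on UNIV \<times> M"
    and "\<bar>s\<bar> < R"
  shows "((\<lambda>n. infsum (D n) M * s ^ n) has_sum (\<Sum>\<^sub>\<infinity>(n, i)\<in>UNIV \<times> M. D n i * s ^ n)) UNIV"
proof -
  have "((\<lambda>i. case (n, i) of (n, i) \<Rightarrow> D n i * s ^ n) has_sum infsum (D n) M * s ^ n) M" for n
    using power_family_coeff_summable[OF assms(1,2)] by (auto intro!: has_sum_cmult_left)
  then show ?thesis
    using assms(2)[OF assms(3)] by (intro has_sum_SigmaD[where f="\<lambda>(n, i). D n i * s ^ n"]) auto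
qed

lemma summable_on_abs_iff: "f summable_on A \<longleftrightarrow> (\<lambda>x. \<bar>f x :: real\<bar>) summable_on A"
  using summable_on_iff_abs_summable_on_real by force

lemma power_family_abs:
  fixes D :: "nat \<Rightarrow> 'i \<Rightarrow> real"
  assumes "\<And>s. \<bar>s\<bar> < R \<Longrightarrow> (\<lambda>(n, i). D n i * s ^ n) summable_on UNIV \<times> M" "\<bar>s\<bar> < R"
  shows "(\<lambda>(n, i). \<bar>D n i\<bar> * s ^ n) summable_on UNIV \<times> M"
  using assms(1)[OF assms(2)]
  by (subst summable_on_abs_iff, subst (asm) summable_on_abs_iff)
    (simp add: case_prod_unfold abs_mult)

text \<open>Summing absolute values over \<open>i\<close> reduces the claim to the one-variable
  series with coefficients \<open>E n\<close>, which converges for |s| < R. There termwise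
  differentiation is known, and nonnegative terms can be redistributed over \<open>i\<close>
  afterwards.\<close>

lemma power_family_diffs_summable:
  fixes D :: "nat \<Rightarrow> 'i \<Rightarrow> real"
  assumes "0 < R" and D: "\<And>s. \<bar>s\<bar> < R \<Longrightarrow> (\<lambda>(n, i). D n i * s ^ n) summable_on UNIV \<times> M"
    and "\<bar>s\<bar> < R"
  shows "(\<lambda>(n, i). real (Suc n) * D (Suc n) i * s ^ n) summable_on UNIV \<times> M"
proof -
  define E where "E n = (\<Sum>\<^sub>\<infinity>i\<in>M. \<bar>D n i\<bar>)" for n
  have absD: "(\<lambda>(n, i). \<bar>D n i\<bar> * s ^ n) summable_on UNIV \<times> M" if "\<bar>s\<bar> < R" for s
    using power_family_abs[OF D that] by blast
  note E_sum = power_family_coeff_summable[OF \<open>0 < R\<close> absD, simplified]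
  have E: "summable (\<lambda>n. E n * s ^ n)" if "\<bar>s\<bar> < R" for s
    using power_family_sums[OF \<open>0 < R\<close> absD that] unfolding E_def
    by (blast dest: has_sum_imp_sums sums_summable)
  have "summable (\<lambda>n. diffs E n * \<bar>s\<bar> ^ n)"
    using E assms(3) by (intro termdiff_converges[where K=R]) auto
  moreover have "0 \<le> E n" for n
    unfolding E_def by (rule infsum_nonneg) auto
  ultimately have "(\<lambda>n. real (Suc n) * E (Suc n) * \<bar>s\<bar> ^ n) summable_on UNIV"
    by (subst summable_on_UNIV_nonneg_real_iff) (auto simp: diffs_def)
  moreover have "((\<lambda>i. case (n, i) of (n, i) \<Rightarrow> real (Suc n) * \<bar>D (Suc n) i\<bar> * \<bar>s\<bar> ^ n) has_sum
      real (Suc n) * E (Suc n) * \<bar>s\<bar> ^ n) M" for n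
    unfolding E_def using E_sum
    by (auto intro!: has_sum_cmult_left has_sum_cmult_right simp del: of_nat_Suc)
  ultimately have "(\<lambda>(n, i). real (Suc n) * \<bar>D (Suc n) i\<bar> * \<bar>s\<bar> ^ n) summable_on UNIV \<times> M"
    by (intro summable_on_SigmaI[where g="\<lambda>n. real (Suc n) * E (Suc n) * \<bar>s\<bar> ^ n"]) auto
  then show ?thesis
    by (subst summable_on_abs_iff) (simp add: case_prod_unfold abs_mult power_abs)
qed

lemma power_family_has_derivative:
  fixes D :: "nat \<Rightarrow> 'i \<Rightarrow> real"
  assumes "0 < R" and D: "\<And>s. \<bar>s\<bar> < R \<Longrightarrow> (\<lambda>(n, i). D n i * s ^ n) summable_on UNIV \<times> M"
    and "\<bar>s\<bar> < R"
  shows "((\<lambda>s. \<Sum>\<^sub>\<infinity>(n, i)\<in>UNIV \<times> M. D n i * s ^ n) has_real_derivative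
      (\<Sum>\<^sub>\<infinity>(n, i)\<in>UNIV \<times> M. real (Suc n) * D (Suc n) i * s ^ n)) (at s)"
proof -
  define a where "a n = infsum (D n) M" for n
  have a: "(\<lambda>n. a n * s ^ n) sums (\<Sum>\<^sub>\<infinity>(n, i)\<in>UNIV \<times> M. D n i * s ^ n)" if "\<bar>s\<bar> < R" for s
    unfolding a_def using power_family_sums[OF assms(1) D that] by (rule has_sum_imp_sums)
  have "(\<lambda>n. infsum (\<lambda>i. real (Suc n) * D (Suc n) i) M * s ^ n)
      sums (\<Sum>\<^sub>\<infinity>(n, i)\<in>UNIV \<times> M. real (Suc n) * D (Suc n) i * s ^ n)"
    by (rule has_sum_imp_sums, rule power_family_sums[OF assms(1) _ assms(3)])
      (rule power_family_diffs_summable[OF assms(1) D])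
  then have "(\<Sum>n. diffs a n * s ^ n)
      = (\<Sum>\<^sub>\<infinity>(n, i)\<in>UNIV \<times> M. real (Suc n) * D (Suc n) i * s ^ n)"
    by (simp add: a_def diffs_def infsum_cmult_right' sums_iff del: of_nat_Suc)
  moreover have "((\<lambda>s. \<Sum>\<^sub>\<infinity>(n, i)\<in>UNIV \<times> M. D n i * s ^ n) has_real_derivative
      (\<Sum>n. diffs a n * s ^ n)) (at s)"
  proof (rule DERIV_cong_ev[OF refl _ refl, THEN iffD1])
    have "((\<lambda>s. \<Sum>n. a n * s ^ n) has_real_derivative (\<Sum>n. diffs a n * s ^ n)) (at s)"
      by (rule termdiffs_strong'[where K=R]) (use a assms(3) sums_summable in force)+
    then show "((\<lambda>s. \<Sum>n. a n * s ^ n) has_real_derivative (\<Sum>n. diffs a n * s ^ n)) (at s)" .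
    have "\<forall>\<^sub>F s in nhds s. s \<in> {-R<..<R}"
      using assms(3) by (intro eventually_nhds_in_open) auto
    then show "\<forall>\<^sub>F s in nhds s. (\<Sum>n. a n * s ^ n) = (\<Sum>\<^sub>\<infinity>(n, i)\<in>UNIV \<times> M. D n i * s ^ n)"
      by eventually_elim (use a in \<open>auto simp: sums_iff\<close>)
  qed
  ultimately show ?thesis by simp
qed

text \<open>\<open>e n k\<close> is the coefficient of \<sigma>^k in w^n. The absolute values of
  these series sum to at most W^n and the original family converges at \<open>W\<close>, so the
  triple family over n, i, k is absolutely summable and the order of summation may be
  exchanged.\<close>

lemma power_family_substitute:
  fixes D :: "nat \<Rightarrow> 'i \<Rightarrow> real" and e :: "nat \<Rightarrow> nat \<Rightarrow> real"
  assumes f: "((\<lambda>(n, i). D n i * w ^ n) has_sum f) (UNIV \<times> M)"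
    and W: "(\<lambda>(n, i). D n i * W ^ n) summable_on UNIV \<times> M" "0 \<le> W"
    and e: "\<And>n. (\<lambda>k. e n k * \<sigma> ^ k) sums (w ^ n)"
    and e': "\<And>n. summable (\<lambda>k. \<bar>e n k\<bar> * \<bar>\<sigma>\<bar> ^ k)" "\<And>n. (\<Sum>k. \<bar>e n k\<bar> * \<bar>\<sigma>\<bar> ^ k) \<le> W ^ n"
  shows "((\<lambda>(k, i). (\<Sum>\<^sub>\<infinity>n. D n i * e n k) * \<sigma> ^ k) has_sum f) (UNIV \<times> M)"
proof -
  define T where "T = (\<lambda>((n, i), k). D n i * (e n k * \<sigma> ^ k))"
  define q where "q n = (\<Sum>k. \<bar>e n k\<bar> * \<bar>\<sigma>\<bar> ^ k)" for n
  have q: "((\<lambda>k. \<bar>e n k\<bar> * \<bar>\<sigma>\<bar> ^ k) has_sum q n) UNIV" and q0: "0 \<le> q n" for n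
    unfolding q_def using e'(1)[of n]
    by (auto intro!: norm_summable_imp_has_sum summable_sums suminf_nonneg)
  have "(\<lambda>x. \<bar>case x of (n, i) \<Rightarrow> D n i * W ^ n\<bar>) summable_on UNIV \<times> M"
    using W(1) summable_on_abs_iff by blast
  then have "(\<lambda>(n, i). \<bar>D n i\<bar> * q n) summable_on UNIV \<times> M"
    by (rule summable_on_comparison_test)
      (use e'(2) q0 W(2) in \<open>auto simp: abs_mult q_def intro!: mult_left_mono\<close>)
  moreover have "((\<lambda>k. case (ni, k) of ((n, i), k) \<Rightarrow> \<bar>D n i\<bar> * (\<bar>e n k\<bar> * \<bar>\<sigma>\<bar> ^ k))
      has_sum (case ni of (n, i) \<Rightarrow> \<bar>D n i\<bar> * q n)) UNIV" for ni
    using q by (auto split: prod.split intro!: has_sum_cmult_right)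
  ultimately have "(\<lambda>((n, i), k). \<bar>D n i\<bar> * (\<bar>e n k\<bar> * \<bar>\<sigma>\<bar> ^ k)) summable_on (UNIV \<times> M) \<times> UNIV"
    by (intro summable_on_SigmaI[where g="\<lambda>(n, i). \<bar>D n i\<bar> * q n"]) auto
  then have T: "T summable_on (UNIV \<times> M) \<times> UNIV"
    by (subst summable_on_abs_iff) (simp add: T_def case_prod_unfold abs_mult power_abs)
  have "((\<lambda>k. e n k * \<sigma> ^ k) has_sum w ^ n) UNIV" for n
    by (rule norm_summable_imp_has_sum) (use e e'(1) in \<open>auto simp: abs_mult power_abs\<close>)
  then have "((\<lambda>k. T (ni, k)) has_sum (case ni of (n, i) \<Rightarrow> D n i * w ^ n)) UNIV" for ni
    by (auto simp: T_def split: prod.split intro!: has_sum_cmult_right)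
  then have "(T has_sum f) ((UNIV \<times> M) \<times> UNIV)"
    using f T by (intro has_sum_SigmaI[where g="\<lambda>(n, i). D n i * w ^ n"]) auto
  also have "?this \<longleftrightarrow> ((\<lambda>((k, i), n). T ((n, i), k)) has_sum f) ((UNIV \<times> M) \<times> UNIV)"
    by (rule has_sum_reindex_bij_witness[where i="\<lambda>((k, i), n). ((n, i), k)" and j="\<lambda>((n, i), k). ((k, i), n)"]) auto
  finally have T': "((\<lambda>((k, i), n). T ((n, i), k)) has_sum f) ((UNIV \<times> M) \<times> UNIV)" .
  have "((\<lambda>n. T ((n, i), k)) has_sum (\<Sum>\<^sub>\<infinity>n. D n i * e n k) * \<sigma> ^ k) UNIV" if "i \<in> M" for i k
  proof -
    have "(\<lambda>n. T ((n, i), k)) summable_on UNIV"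
      using summable_on_SigmaD1[of "\<lambda>(k, i) n. T ((n, i), k)" "UNIV \<times> M" "\<lambda>_. UNIV" "(k, i)"] that
        has_sum_imp_summable[OF T'] by (auto simp: case_prod_unfold)
    then have "((\<lambda>n. T ((n, i), k)) has_sum (\<Sum>\<^sub>\<infinity>n. T ((n, i), k))) UNIV"
      by simp
    then show ?thesis
      by (simp add: T_def infsum_cmult_left' flip: mult.assoc)
  qed
  then show ?thesis
    by (intro has_sum_SigmaD[OF T']) auto
qed

text \<open>Only the sums over \<open>i\<close> are known to vanish, not the single
  \<open>D n i\<close>. Summing over \<open>i\<close> first shows that exponents not divisible by 3
  contribute nothing, so the double family can be restricted to the others and reindexed.\<close>

lemma power_family_cubic:
  fixes D :: "nat \<Rightarrow> 'i \<Rightarrow> real"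
  assumes R: "0 < R" and D: "\<And>s. \<bar>s\<bar> < R \<Longrightarrow> (\<lambda>(n, i). D n i * s ^ n) summable_on UNIV \<times> M"
    and s: "\<bar>s\<bar> < R" and 3: "\<And>n. n mod 3 \<noteq> 0 \<Longrightarrow> infsum (D n) M = 0"
  shows "((\<lambda>(n, i). D (3 * n) i * (s ^ 3) ^ n) has_sum (\<Sum>\<^sub>\<infinity>(n, i)\<in>UNIV \<times> M. D n i * s ^ n)) (UNIV \<times> M)"
proof -
  define N where "N = {n :: nat. n mod 3 = 0}"
  have "((\<lambda>n. infsum (D n) M * s ^ n) has_sum (\<Sum>\<^sub>\<infinity>(n, i)\<in>UNIV \<times> M. D n i * s ^ n)) UNIV"
    by (rule power_family_sums[OF R D s])
  also have "?this \<longleftrightarrow> ((\<lambda>n. infsum (D n) M * s ^ n) has_sum (\<Sum>\<^sub>\<infinity>(n, i)\<in>UNIV \<times> M. D n i * s ^ n)) N"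
    by (rule has_sum_cong_neutral) (auto simp: N_def 3)
  finally have *: "((\<lambda>n. infsum (D n) M * s ^ n) has_sum (\<Sum>\<^sub>\<infinity>(n, i)\<in>UNIV \<times> M. D n i * s ^ n)) N" .
  have "((\<lambda>(n, i). D n i * s ^ n) has_sum (\<Sum>\<^sub>\<infinity>(n, i)\<in>UNIV \<times> M. D n i * s ^ n)) (N \<times> M)"
  proof (rule has_sum_SigmaI[OF _ *])
    show "((\<lambda>i. case (n, i) of (n, i) \<Rightarrow> D n i * s ^ n) has_sum infsum (D n) M * s ^ n) M" for n
      using power_family_coeff_summable[OF R D] by (auto intro!: has_sum_cmult_left)
    show "(\<lambda>(n, i). D n i * s ^ n) summable_on N \<times> M"
      by (rule summable_on_subset[OF D[OF s]]) auto
  qed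
  also have "?this \<longleftrightarrow> ?thesis"
    by (rule has_sum_reindex_bij_witness[where i="\<lambda>(n, i). (3 * n, i)" and j="\<lambda>(n, i). (n div 3, i)"])
      (auto simp: N_def power_mult[symmetric] mult.commute)
  finally show ?thesis .
qed


section \<open>Real analytic functions\<close>

definition other_monomial :: "'a::euclidean_space \<Rightarrow> ('a \<Rightarrow> nat) \<Rightarrow> 'a \<Rightarrow> real" where
  "other_monomial b \<beta> v = (\<Prod>b'\<in>Basis - {b}. (v \<bullet> b') ^ \<beta> b')"

abbreviation other_indices :: "'a::euclidean_space \<Rightarrow> ('a \<Rightarrow> nat) set" where
  "other_indices b \<equiv> (Basis - {b}) \<rightarrow>\<^sub>E (UNIV :: nat set)"

text \<open>The exponent along \<open>b\<close> is split off, so that on each line parallel to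
  \<open>b\<close> the expansion is a power series in one variable: the other monomials are constant
  there.\<close>

definition power_series_at ::
    "'a::euclidean_space \<Rightarrow> ('a \<Rightarrow> real) \<Rightarrow> 'a \<Rightarrow> real \<Rightarrow> (nat \<Rightarrow> ('a \<Rightarrow> nat) \<Rightarrow> real) \<Rightarrow> bool" where
  "power_series_at b f p r C \<longleftrightarrow> 0 < r \<and> (\<forall>v\<in>ball 0 r.
     ((\<lambda>(n, \<beta>). C n \<beta> * other_monomial b \<beta> v * (v \<bullet> b) ^ n) has_sum f (p + v)) (UNIV \<times> other_indices b))"

lemma has_sum_split_multi_index:
  fixes v :: "'a::euclidean_space"
  assumes "b \<in> Basis"
  shows "((\<lambda>\<alpha>. c \<alpha> * (\<Prod>b'\<in>Basis. (v \<bullet> b') ^ \<alpha> b')) has_sum s) (Basis \<rightarrow>\<^sub>E (UNIV :: nat set)) \<longleftrightarrow>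
    ((\<lambda>(n, \<beta>). c (\<beta>(b := n)) * other_monomial b \<beta> v * (v \<bullet> b) ^ n) has_sum s) (UNIV \<times> other_indices b)"
\<comment> \<open>Multi-indices are extensional, so the value \<open>undefined\<close> at
  \<open>b\<close> amounts to restriction to the remaining basis vectors.\<close>
proof (rule has_sum_reindex_bij_witness[where i="\<lambda>(n, \<beta>). \<beta>(b := n)" and j="\<lambda>\<alpha>. (\<alpha> b, \<alpha>(b := undefined))"])
  show "(case (\<alpha> b, \<alpha>(b := undefined)) of (n, \<beta>) \<Rightarrow> c (\<beta>(b := n)) * other_monomial b \<beta> v * (v \<bullet> b) ^ n)
      = c \<alpha> * (\<Prod>b'\<in>Basis. (v \<bullet> b') ^ \<alpha> b')" for \<alpha>
    using prod.remove[OF finite_Basis assms, of "\<lambda>b'. (v \<bullet> b') ^ \<alpha> b'"]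
    by (simp add: other_monomial_def mult.commute mult.left_commute)
qed (use assms in \<open>auto simp: PiE_def extensional_def fun_eq_iff\<close>)

lemma real_analytic_on_iff_power_series_at:
  assumes b: "b \<in> Basis"
  shows "real_analytic_on f S \<longleftrightarrow> (\<forall>p\<in>S. \<exists>r C. power_series_at b f p r C)"
proof -
  have "(\<exists>r>0. \<exists>c. \<forall>q\<in>ball p r. ((\<lambda>\<alpha>. c \<alpha> * (\<Prod>b\<in>Basis. ((q - p) \<bullet> b) ^ \<alpha> b)) has_sum f q)
          (Basis \<rightarrow>\<^sub>E (UNIV :: nat set))) \<longleftrightarrow> (\<exists>r C. power_series_at b f p r C)" (is "?A \<longleftrightarrow> ?B") for p
  proof
    assume ?A
    then obtain r c where "r > 0" and c: "\<And>q. q \<in> ball p r \<Longrightarrow>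
        ((\<lambda>\<alpha>. c \<alpha> * (\<Prod>b\<in>Basis. ((q - p) \<bullet> b) ^ \<alpha> b)) has_sum f q) (Basis \<rightarrow>\<^sub>E (UNIV :: nat set))"
      by blast
    have "power_series_at b f p r (\<lambda>n \<beta>. c (\<beta>(b := n)))"
      unfolding power_series_at_def
    proof (intro conjI ballI \<open>r > 0\<close>)
      fix v :: 'a assume "v \<in> ball 0 r"
      with c[of "p + v"] show "((\<lambda>(n, \<beta>). c (\<beta>(b := n)) * other_monomial b \<beta> v * (v \<bullet> b) ^ n)
          has_sum f (p + v)) (UNIV \<times> other_indices b)"
        by (simp add: dist_norm has_sum_split_multi_index[OF b])
    qed
    then show ?B by blast
  next
    assume ?B
    then obtain r C where "r > 0" and C: "\<And>v. v \<in> ball 0 r \<Longrightarrow>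
        ((\<lambda>(n, \<beta>). C n \<beta> * other_monomial b \<beta> v * (v \<bullet> b) ^ n) has_sum f (p + v)) (UNIV \<times> other_indices b)"
      unfolding power_series_at_def by blast
    define c where "c \<alpha> = C (\<alpha> b) (\<alpha>(b := undefined))" for \<alpha>
    have "((\<lambda>\<alpha>. c \<alpha> * (\<Prod>b\<in>Basis. ((q - p) \<bullet> b) ^ \<alpha> b)) has_sum f q) (Basis \<rightarrow>\<^sub>E (UNIV :: nat set))"
      if "q \<in> ball p r" for q
    proof -
      have "c (\<beta>(b := n)) = C n \<beta>" if "\<beta> \<in> other_indices b" for n \<beta>
      proof -
        have "\<beta>(b := undefined) = \<beta>"
          using that by (auto simp: PiE_def extensional_def fun_eq_iff)
        then show ?thesis by (simp add: c_def)
      qed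
      then have "(case x of (n, \<beta>) \<Rightarrow> c (\<beta>(b := n)) * other_monomial b \<beta> (q - p) * ((q - p) \<bullet> b) ^ n) =
         (case x of (n, \<beta>) \<Rightarrow> C n \<beta> * other_monomial b \<beta> (q - p) * ((q - p) \<bullet> b) ^ n)"
         if "x \<in> UNIV \<times> other_indices b" for x
        using that by auto
      then show ?thesis
        using C[of "q - p"] that
        by (subst has_sum_split_multi_index[OF b], subst has_sum_cong)
          (auto simp: dist_norm norm_minus_commute)
    qed
    with \<open>r > 0\<close> show ?A by blast
  qed
  then show ?thesis
    unfolding real_analytic_on_def by blast
qed

lemma other_monomial_add_scaleR [simp]:
  assumes "b \<in> Basis"
  shows "other_monomial b \<beta> (v + s *\<^sub>R b) = other_monomial b \<beta> v"
  unfolding other_monomial_def using assms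
  by (intro prod.cong) (auto simp: inner_add_left inner_Basis)

lemma power_series_at_line:
  assumes "power_series_at b f p r C" and b: "b \<in> Basis" and "norm (v + s *\<^sub>R b) < r"
  shows "((\<lambda>(n, \<beta>). C n \<beta> * other_monomial b \<beta> v * (v \<bullet> b + s) ^ n) has_sum f (p + v + s *\<^sub>R b))
    (UNIV \<times> other_indices b)"
  using assms unfolding power_series_at_def
  by (auto simp: inner_add_left add.assoc dest!: bspec[where x="v + s *\<^sub>R b"])

text \<open>With \<open>w\<close> the part of \<open>v\<close> orthogonal to \<open>b\<close>,
  Pythagoras shows that the line through \<open>v\<close> along \<open>b\<close> meets the ball in a
  chord of half-length sqrt (r^2 - |w|^2), which is the \<open>R\<close>. The one-variable results
  need such an interval symmetric about 0.\<close>

lemma norm_line_le: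
  fixes v :: "'a::euclidean_space"
  assumes b: "b \<in> Basis" and "norm v < r"
  obtains R where "\<bar>v \<bullet> b\<bar> < R" "\<And>s. \<bar>s\<bar> < R \<Longrightarrow> norm (v + (s - v \<bullet> b) *\<^sub>R b) < r"
proof
  define w where "w = v - (v \<bullet> b) *\<^sub>R b"
  have orth: "w \<bullet> b = 0"
    using b by (simp add: w_def inner_diff_left)
  have n: "(norm (w + s *\<^sub>R b))\<^sup>2 = (norm w)\<^sup>2 + s\<^sup>2" for s
    unfolding power2_norm_eq_inner using orth b
    by (simp add: inner_add_left inner_add_right inner_commute[of b w] power2_eq_square)
  have r: "0 < r" using assms(2) norm_ge_zero[of v] by linarith
  have v: "v = w + (v \<bullet> b) *\<^sub>R b" by (simp add: w_def)
  have "(norm v)\<^sup>2 < r\<^sup>2" using assms(2) by (simp add: power_strict_mono)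
  then have lt: "(norm w)\<^sup>2 + (v \<bullet> b)\<^sup>2 < r\<^sup>2" using n[of "v \<bullet> b"] v by simp
  then have lt': "(v \<bullet> b)\<^sup>2 < r\<^sup>2 - (norm w)\<^sup>2" by simp
  then show "\<bar>v \<bullet> b\<bar> < sqrt (r\<^sup>2 - (norm w)\<^sup>2)"
    using real_sqrt_less_iff[of "(v \<bullet> b)\<^sup>2" "r\<^sup>2 - (norm w)\<^sup>2"] by simp
  show "norm (v + (s - v \<bullet> b) *\<^sub>R b) < r" if "\<bar>s\<bar> < sqrt (r\<^sup>2 - (norm w)\<^sup>2)" for s
  proof -
    have "0 \<le> r\<^sup>2 - (norm w)\<^sup>2" using lt' zero_le_power2[of "v \<bullet> b"] by linarith
    then have "s\<^sup>2 < r\<^sup>2 - (norm w)\<^sup>2"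
      using power_strict_mono[OF that, of 2] by simp
    then have "(norm (w + s *\<^sub>R b))\<^sup>2 < r\<^sup>2" using n by simp
    then have "norm (w + s *\<^sub>R b) < r" using r by (meson less_imp_le power_less_imp_less_base)
    moreover have "v + (s - v \<bullet> b) *\<^sub>R b = w + s *\<^sub>R b"
      by (simp add: w_def scaleR_diff_left)
    ultimately show ?thesis by simp
  qed
qed

text \<open>On the chord through \<open>v\<close> along \<open>b\<close> the function is a
  one-variable power family with coefficients \<open>D n \<beta>\<close>. The whole chord is
  covered, so the radius \<open>r\<close> does not shrink and the derivative can be
  iterated.\<close>

lemma power_series_at_derivative:
  fixes f :: "'a::euclidean_space \<Rightarrow> real"
  assumes f: "power_series_at b f p r C" and b: "b \<in> Basis"
  shows "\<And>v. v \<in> ball 0 r \<Longrightarrow> (\<lambda>s. f (p + v + s *\<^sub>R b)) differentiable (at 0)"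
    and "power_series_at b (\<lambda>q. deriv (\<lambda>s. f (q + s *\<^sub>R b)) 0) p r (\<lambda>n \<beta>. real (Suc n) * C (Suc n) \<beta>)"
proof -
  have *: "((\<lambda>s. f (p + v + s *\<^sub>R b)) has_real_derivative
        (\<Sum>\<^sub>\<infinity>(n, \<beta>)\<in>UNIV \<times> other_indices b. real (Suc n) * (C (Suc n) \<beta> * other_monomial b \<beta> v) * (v \<bullet> b) ^ n)) (at 0)"
      (is "(_ has_real_derivative ?D) _")
    and **: "(\<lambda>(n, \<beta>). real (Suc n) * (C (Suc n) \<beta> * other_monomial b \<beta> v) * (v \<bullet> b) ^ n) summable_on UNIV \<times> other_indices b"
    if v: "v \<in> ball 0 r" for v
  proof -
    obtain R where R: "\<bar>v \<bullet> b\<bar> < R" "\<And>s. \<bar>s\<bar> < R \<Longrightarrow> norm (v + (s - v \<bullet> b) *\<^sub>R b) < r"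
      using norm_line_le[OF b, of v r] v by auto
    define D where "D n \<beta> = C n \<beta> * other_monomial b \<beta> v" for n \<beta>
    have D: "((\<lambda>(n, \<beta>). D n \<beta> * s ^ n) has_sum f (p + v + (s - v \<bullet> b) *\<^sub>R b)) (UNIV \<times> other_indices b)"
      if "\<bar>s\<bar> < R" for s
      using power_series_at_line[OF f b R(2)[OF that]] unfolding D_def by simp
    then have D': "(\<lambda>(n, \<beta>). D n \<beta> * s ^ n) summable_on UNIV \<times> other_indices b" if "\<bar>s\<bar> < R" for s
      using that has_sum_imp_summable by blast
    have "R > 0" using R(1) by linarith
    from power_family_has_derivative[OF this D' R(1)]
    have "((\<lambda>s. \<Sum>\<^sub>\<infinity>(n, \<beta>)\<in>UNIV \<times> other_indices b. D n \<beta> * s ^ n) has_real_derivative ?D) (at (v \<bullet> b))"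
      by (simp add: D_def)
    moreover have "\<forall>\<^sub>F s in nhds (v \<bullet> b). (\<Sum>\<^sub>\<infinity>(n, \<beta>)\<in>UNIV \<times> other_indices b. D n \<beta> * s ^ n)
        = f (p + v + (s - v \<bullet> b) *\<^sub>R b)"
    proof -
      have "\<forall>\<^sub>F s in nhds (v \<bullet> b). s \<in> {-R<..<R}"
        using R(1) by (intro eventually_nhds_in_open) auto
      then show ?thesis
        by eventually_elim (use D in \<open>auto simp: infsumI\<close>)
    qed
    ultimately have "((\<lambda>s. f (p + v + (s - v \<bullet> b) *\<^sub>R b)) has_real_derivative ?D) (at (v \<bullet> b))"
      by (subst (asm) DERIV_cong_ev[OF refl _ refl]) auto
    then have "((\<lambda>s. f (p + v + ((s + v \<bullet> b) - v \<bullet> b) *\<^sub>R b)) has_real_derivative ?D) (at 0)"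
      using DERIV_shift[of "\<lambda>s. f (p + v + (s - v \<bullet> b) *\<^sub>R b)" ?D 0 "v \<bullet> b"] by simp
    then show "((\<lambda>s. f (p + v + s *\<^sub>R b)) has_real_derivative ?D) (at 0)" by simp
    show "(\<lambda>(n, \<beta>). real (Suc n) * (C (Suc n) \<beta> * other_monomial b \<beta> v) * (v \<bullet> b) ^ n) summable_on UNIV \<times> other_indices b"
      using power_family_diffs_summable[OF \<open>R > 0\<close> D' R(1)] unfolding D_def .
  qed
  show "(\<lambda>s. f (p + v + s *\<^sub>R b)) differentiable (at 0)" if "v \<in> ball 0 r" for v
    using *[OF that] real_differentiable_def by blast
  show "power_series_at b (\<lambda>q. deriv (\<lambda>s. f (q + s *\<^sub>R b)) 0) p r (\<lambda>n \<beta>. real (Suc n) * C (Suc n) \<beta>)"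
    unfolding power_series_at_def
  proof (intro conjI ballI)
    show "0 < r" using f by (simp add: power_series_at_def)
    fix v :: 'a assume v: "v \<in> ball 0 r"
    show "((\<lambda>(n, \<beta>). real (Suc n) * C (Suc n) \<beta> * other_monomial b \<beta> v * (v \<bullet> b) ^ n) has_sum
        deriv (\<lambda>s. f (p + v + s *\<^sub>R b)) 0) (UNIV \<times> other_indices b)"
      using **[OF v] by (simp add: DERIV_imp_deriv[OF *[OF v]] mult.assoc)
  qed
qed

lemma real_analytic_on_line_differentiable:
  assumes "real_analytic_on f S" "b \<in> Basis" "p \<in> S"
  shows "(\<lambda>s. f (p + s *\<^sub>R b)) differentiable (at 0)"
proof -
  obtain r C where "power_series_at b f p r C"
    using assms real_analytic_on_iff_power_series_at by blast
  then show ?thesis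
    using power_series_at_derivative(1)[of b f p r C 0] assms by (auto simp: power_series_at_def)
qed

lemma real_analytic_on_deriv:
  assumes "real_analytic_on f S" "b \<in> Basis"
  shows "real_analytic_on (\<lambda>q. deriv (\<lambda>s. f (q + s *\<^sub>R b)) 0) S"
  unfolding real_analytic_on_iff_power_series_at[OF assms(2)]
proof
  fix p assume "p \<in> S"
  then obtain r C where "power_series_at b f p r C"
    using assms real_analytic_on_iff_power_series_at by blast
  then show "\<exists>r C. power_series_at b (\<lambda>q. deriv (\<lambda>s. f (q + s *\<^sub>R b)) 0) p r C"
    using power_series_at_derivative(2) assms(2) by blast
qed

text \<open>Weierstrass M-test on a cube around \<open>p\<close>: the corner of the cube bounds
  every monomial in absolute value, and the series converges absolutely at the corner.\<close>

lemma real_analytic_on_isCont: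
  fixes f :: "'a::euclidean_space \<Rightarrow> real"
  assumes f: "real_analytic_on f S" and p: "p \<in> S"
  shows "isCont f p"
proof -
  obtain r c where r: "r > 0" and c: "\<And>q. q \<in> ball p r \<Longrightarrow>
        ((\<lambda>\<alpha>. c \<alpha> * (\<Prod>b\<in>Basis. ((q - p) \<bullet> b) ^ \<alpha> b)) has_sum f q) (Basis \<rightarrow>\<^sub>E (UNIV :: nat set))"
    using f p unfolding real_analytic_on_def by blast
  \<comment> \<open>Points of the closed cube of half-width \<rho> have l1-distance at most r/2 from
    \<open>p\<close>, so even the corner lies in the ball.\<close>
  define \<rho> where "\<rho> = r / (2 * DIM('a))"
  have \<rho>: "\<rho> > 0" using r by (simp add: \<rho>_def)
  define Y where "Y = {q. \<forall>b\<in>Basis. \<bar>(q - p) \<bullet> b\<bar> < \<rho>}"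
  have Ysub: "q \<in> ball p r" if "\<And>b. b \<in> Basis \<Longrightarrow> \<bar>(q - p) \<bullet> b\<bar> \<le> \<rho>" for q
  proof -
    have "norm (q - p) \<le> (\<Sum>b\<in>Basis. \<bar>(q - p) \<bullet> b\<bar>)" by (rule norm_le_l1)
    also have "\<dots> \<le> (\<Sum>b\<in>(Basis::'a set). \<rho>)" by (rule sum_mono) (rule that)
    also have "\<dots> < r" using r by (simp add: \<rho>_def)
    finally show ?thesis by (simp add: dist_norm norm_minus_commute)
  qed
  have "((\<lambda>\<alpha>. c \<alpha> * (\<Prod>b\<in>Basis. (((p + (\<Sum>b\<in>Basis. \<rho> *\<^sub>R b)) - p) \<bullet> b) ^ \<alpha> b))
      has_sum f (p + (\<Sum>b\<in>Basis. \<rho> *\<^sub>R b))) (Basis \<rightarrow>\<^sub>E (UNIV :: nat set))"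
    using \<rho> by (intro c Ysub) (auto simp: inner_sum_left_Basis)
  then have "(\<lambda>\<alpha>. c \<alpha> * (\<Prod>b\<in>Basis. \<rho> ^ \<alpha> b)) summable_on (Basis \<rightarrow>\<^sub>E (UNIV :: nat set))"
    by (auto simp: inner_sum_left_Basis dest!: has_sum_imp_summable cong: prod.cong)
  then have M: "(\<lambda>\<alpha>. \<bar>c \<alpha> * (\<Prod>b\<in>Basis. \<rho> ^ \<alpha> b)\<bar>) summable_on (Basis \<rightarrow>\<^sub>E (UNIV :: nat set))"
    using summable_on_iff_abs_summable_on_real by force
  have "uniform_limit Y (\<lambda>X q. \<Sum>\<alpha>\<in>X. c \<alpha> * (\<Prod>b\<in>Basis. ((q - p) \<bullet> b) ^ \<alpha> b)) f
      (finite_subsets_at_top (Basis \<rightarrow>\<^sub>E (UNIV :: nat set)))"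
  proof (rule Weierstrass_m_test_general'[OF _ _ M])
    show "norm (c \<alpha> * (\<Prod>b\<in>Basis. ((q - p) \<bullet> b) ^ \<alpha> b)) \<le> \<bar>c \<alpha> * (\<Prod>b\<in>Basis. \<rho> ^ \<alpha> b)\<bar>"
      if "q \<in> Y" for \<alpha> q
      unfolding real_norm_def abs_mult abs_prod power_abs using that \<rho>
      by (intro mult_left_mono prod_mono) (auto simp: Y_def less_imp_le intro!: power_mono)
    show "((\<lambda>\<alpha>. c \<alpha> * (\<Prod>b\<in>Basis. ((q - p) \<bullet> b) ^ \<alpha> b)) has_sum f q) (Basis \<rightarrow>\<^sub>E (UNIV :: nat set))"
      if "q \<in> Y" for q
      using that by (intro c Ysub) (auto simp: Y_def intro: less_imp_le)
  qed
  then have "continuous_on Y f"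
    by (rule uniform_limit_theorem[rotated]) (auto intro!: always_eventually continuous_intros)
  moreover have "open Y"
  proof -
    have "Y = (\<Inter>b\<in>Basis. {q. \<bar>(q - p) \<bullet> b\<bar> < \<rho>})" by (auto simp: Y_def)
    then show ?thesis
      by (auto intro!: open_INT open_Collect_less continuous_intros)
  qed
  moreover have "p \<in> Y" using \<rho> by (simp add: Y_def)
  ultimately show ?thesis
    using continuous_on_eq_continuous_at by blast
qed

section \<open>Substituting a one-variable power series into the distinguished variable\<close>

definition has_power_series :: "(real \<Rightarrow> real) \<Rightarrow> real \<Rightarrow> bool" where
  "has_power_series u s \<longleftrightarrow> (\<exists>\<rho>>0. \<exists>a. \<forall>\<sigma>. \<bar>\<sigma>\<bar> < \<rho> \<longrightarrow> (\<lambda>k. a k * \<sigma> ^ k) sums u (s + \<sigma>))"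

text \<open>The coefficients of a power are polynomials with nonnegative coefficients in those of
  the base, so a majorant of the base passes to its powers.\<close>

lemma fps_power_abs_le:
  fixes G F :: "real fps"
  assumes "\<And>k. \<bar>fps_nth G k\<bar> \<le> fps_nth F k"
  shows "\<bar>fps_nth (G ^ n) k\<bar> \<le> fps_nth (F ^ n) k"
proof (induction n arbitrary: k)
  case (Suc n)
  have "\<bar>fps_nth (G ^ Suc n) k\<bar> \<le> (\<Sum>i=0..k. \<bar>fps_nth G i\<bar> * \<bar>fps_nth (G ^ n) (k - i)\<bar>)"
    unfolding power_Suc fps_mult_nth abs_mult[symmetric] by (rule sum_abs)
  also have "\<dots> \<le> (\<Sum>i=0..k. fps_nth F i * fps_nth (F ^ n) (k - i))"
    using assms Suc order_trans[OF abs_ge_zero assms] by (intro sum_mono mult_mono) auto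
  finally show ?case by (simp add: fps_mult_nth)
qed auto

text \<open>Provides the data for \<open>power_family_substitute\<close>. The majorant
  \<open>F\<close> has the absolute values of the coefficients of \<open>w\<close>; it is continuous
  with value 0 at 0, so its value \<open>W\<close> at |\<sigma>| is below \<open>R\<close> for small
  \<sigma>, and F^n majorizes w^n.\<close>

lemma power_series_powers:
  fixes a :: "nat \<Rightarrow> real"
  assumes "0 < \<rho>" "0 < R" and a: "\<And>\<sigma>. \<bar>\<sigma>\<bar> < \<rho> \<Longrightarrow> (\<lambda>k. a k * \<sigma> ^ k) sums w \<sigma>" and w0: "w 0 = 0"
  obtains e \<tau> where "0 < \<tau>" "\<tau> \<le> \<rho>"
    "\<And>n \<sigma>. \<bar>\<sigma>\<bar> < \<tau> \<Longrightarrow> (\<lambda>k. e n k * \<sigma> ^ k) sums (w \<sigma> ^ n)"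
    "\<And>n \<sigma>. \<bar>\<sigma>\<bar> < \<tau> \<Longrightarrow> summable (\<lambda>k. \<bar>e n k\<bar> * \<bar>\<sigma>\<bar> ^ k)"
    "\<And>\<sigma>. \<bar>\<sigma>\<bar> < \<tau> \<Longrightarrow> \<exists>W. 0 \<le> W \<and> W < R \<and> \<bar>w \<sigma>\<bar> < R \<and> (\<forall>n. (\<Sum>k. \<bar>e n k\<bar> * \<bar>\<sigma>\<bar> ^ k) \<le> W ^ n)"
proof -
  define G where "G = Abs_fps a"
  define F where "F = Abs_fps (\<lambda>k. \<bar>a k\<bar>)"
  have a0: "a 0 = 0" using a[of 0] w0 assms(1) by simp
  have G: "ereal \<rho> \<le> fps_conv_radius G"
    unfolding fps_conv_radius_def G_def
    by (rule conv_radius_geI_ex') (use sums_summable[OF a] in auto)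
  have F: "fps_conv_radius F = fps_conv_radius G"
    unfolding F_def G_def using fps_conv_radius_norm[of "Abs_fps a"] by simp
  have conv: "ereal (norm \<sigma>) < fps_conv_radius G" "ereal (norm \<sigma>) < fps_conv_radius F" if "\<bar>\<sigma>\<bar> < \<rho>" for \<sigma> :: real
    using that G F by (auto intro: less_le_trans[of _ "ereal \<rho>"])
  have conv': "ereal (norm \<sigma>) < fps_conv_radius (G ^ n)" "ereal (norm \<sigma>) < fps_conv_radius (F ^ n)"
    if "\<bar>\<sigma>\<bar> < \<rho>" for \<sigma> :: real and n
    using conv[OF that] fps_conv_radius_power[of G n] fps_conv_radius_power[of F n] by (auto intro: less_le_trans)
  have Gw: "eval_fps G \<sigma> = w \<sigma>" if "\<bar>\<sigma>\<bar> < \<rho>" for \<sigma>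
    using a[OF that] by (simp add: eval_fps_def G_def sums_iff)
  define e where "e n k = fps_nth (G ^ n) k" for n k
  have e_le: "\<bar>e n k\<bar> \<le> fps_nth (F ^ n) k" for n k
    unfolding e_def by (rule fps_power_abs_le) (simp add: F_def G_def)
  have "isCont (eval_fps F) 0"
    using conv[of 0] assms(1) continuous_on_eval_fps[of F]
    by (subst (asm) continuous_on_eq_continuous_at) (auto simp: open_eball)
  then have "eval_fps F \<midarrow>0\<rightarrow> 0"
    by (simp add: isCont_def eval_fps_at_0 F_def a0)
  then obtain \<tau>0 where \<tau>0: "\<tau>0 > 0" "\<And>\<sigma>. \<sigma> \<noteq> 0 \<Longrightarrow> \<bar>\<sigma>\<bar> < \<tau>0 \<Longrightarrow> \<bar>eval_fps F \<sigma>\<bar> < R"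
    using \<open>0 < R\<close> unfolding LIM_def by (auto simp: dist_real_def)
  have F0: "eval_fps F 0 = 0" by (simp add: eval_fps_at_0 F_def a0)
  define \<tau> where "\<tau> = min \<rho> \<tau>0"
  have *: "0 < \<tau>" "\<tau> \<le> \<rho>" using \<tau>0 assms by (auto simp: \<tau>_def)
  show thesis
  proof (rule that[OF *])
    fix n \<sigma> assume \<sigma>: "\<bar>\<sigma>\<bar> < \<tau>"
    then have \<sigma>': "\<bar>\<sigma>\<bar> < \<rho>" "\<bar>\<bar>\<sigma>\<bar>\<bar> < \<rho>" using * by auto
    show "(\<lambda>k. e n k * \<sigma> ^ k) sums (w \<sigma> ^ n)"
      using sums_eval_fps[OF conv'(1)[OF \<sigma>'(1)], of n] eval_fps_power[OF conv(1)[OF \<sigma>'(1)], of n]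
      by (simp add: e_def Gw[OF \<sigma>'(1)])
    have "summable (\<lambda>k. fps_nth (F ^ n) k * \<bar>\<sigma>\<bar> ^ k)"
      using sums_eval_fps[OF conv'(2)[OF \<sigma>'(2)], of n] by (rule sums_summable)
    then show "summable (\<lambda>k. \<bar>e n k\<bar> * \<bar>\<sigma>\<bar> ^ k)"
      by (rule summable_comparison_test[rotated]) (use e_le in \<open>auto simp: abs_mult intro!: mult_right_mono\<close>)
  next
    fix \<sigma> assume \<sigma>: "\<bar>\<sigma>\<bar> < \<tau>"
    then have \<sigma>': "\<bar>\<sigma>\<bar> < \<rho>" "\<bar>\<bar>\<sigma>\<bar>\<bar> < \<rho>" "\<bar>\<bar>\<sigma>\<bar>\<bar> < \<tau>0" using * by (auto simp: \<tau>_def)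
    define W where "W = eval_fps F \<bar>\<sigma>\<bar>"
    have "W < R"
      using \<tau>0(2)[of "\<bar>\<sigma>\<bar>"] \<sigma>' F0 \<open>0 < R\<close> unfolding W_def by (cases "\<sigma> = 0") auto
    have Wn: "(\<lambda>k. fps_nth (F ^ n) k * \<bar>\<sigma>\<bar> ^ k) sums (W ^ n)" for n
      using sums_eval_fps[OF conv'(2)[OF \<sigma>'(2)], of n] eval_fps_power[OF conv(2)[OF \<sigma>'(2)], of n]
      by (simp add: W_def)
    have sm: "summable (\<lambda>k. \<bar>e n k\<bar> * \<bar>\<sigma>\<bar> ^ k)" for n
      using Wn[of n, THEN sums_summable]
      by (rule summable_comparison_test[rotated]) (use e_le in \<open>auto simp: abs_mult intro!: mult_right_mono\<close>)
    have le: "(\<Sum>k. \<bar>e n k\<bar> * \<bar>\<sigma>\<bar> ^ k) \<le> W ^ n" for n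
      by (rule sums_le[OF _ summable_sums[OF sm] Wn]) (use e_le in \<open>auto intro!: mult_right_mono\<close>)
    have W1: "(\<lambda>k. \<bar>a k\<bar> * \<bar>\<sigma>\<bar> ^ k) sums W"
      using Wn[of 1] by (simp add: F_def)
    have "\<bar>w \<sigma>\<bar> \<le> W"
    proof -
      have "\<bar>\<Sum>k. a k * \<sigma> ^ k\<bar> \<le> (\<Sum>k. \<bar>a k * \<sigma> ^ k\<bar>)"
        using W1 by (intro summable_rabs) (auto simp: abs_mult power_abs sums_iff)
      then show ?thesis using W1 a[OF \<sigma>'(1)] by (simp add: sums_iff abs_mult power_abs)
    qed
    then show "\<exists>W. 0 \<le> W \<and> W < R \<and> \<bar>w \<sigma>\<bar> < R \<and> (\<forall>n. (\<Sum>k. \<bar>e n k\<bar> * \<bar>\<sigma>\<bar> ^ k) \<le> W ^ n)"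
      using \<open>W < R\<close> le by (intro exI[of _ W]) auto
  qed
qed

lemma norm_remove_component_le:
  fixes v :: "'a::euclidean_space"
  assumes "b \<in> Basis"
  shows "norm (v - (v \<bullet> b) *\<^sub>R b) \<le> norm v"
proof -
  have "(norm (v - (v \<bullet> b) *\<^sub>R b))\<^sup>2 \<le> (norm v)\<^sup>2"
    unfolding power2_norm_eq_inner using assms
    by (simp add: inner_diff_left inner_diff_right inner_commute[of b v])
  then show ?thesis by (rule power2_le_imp_le) simp
qed

lemma other_monomial_diff_scaleR [simp]:
  "b \<in> Basis \<Longrightarrow> other_monomial b \<beta> (v - s *\<^sub>R b) = other_monomial b \<beta> v"
  using other_monomial_add_scaleR[of b \<beta> v "- s"] by simp

text \<open>Frees the coordinate along \<open>b\<close> from the rest of \<open>v\<close>. Halving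
  \<open>r\<close> keeps the combined vector in the ball by the triangle inequality.\<close>

lemma power_series_at_slice:
  assumes f: "power_series_at b f p r C" and b: "b \<in> Basis" and v: "norm v < r / 2" and s: "\<bar>s\<bar> < r / 2"
  shows "((\<lambda>(n, \<beta>). (C n \<beta> * other_monomial b \<beta> v) * s ^ n) has_sum f (p + (v - (v \<bullet> b) *\<^sub>R b) + s *\<^sub>R b))
    (UNIV \<times> other_indices b)"
proof -
  have "norm ((v - (v \<bullet> b) *\<^sub>R b) + s *\<^sub>R b) \<le> norm (v - (v \<bullet> b) *\<^sub>R b) + \<bar>s\<bar>"
    using b norm_triangle_ineq[of "v - (v \<bullet> b) *\<^sub>R b" "s *\<^sub>R b"] by simp
  also have "\<dots> < r" using norm_remove_component_le[OF b, of v] v s by linarith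
  finally show ?thesis
    using power_series_at_line[OF f b, of "v - (v \<bullet> b) *\<^sub>R b" s] b by (simp add: inner_diff_left)
qed

text \<open>The new centre is \<open>p\<close> moved along \<open>b\<close> until its coordinate is
  \<open>s0\<close>, which \<open>u\<close> maps back to the coordinate of \<open>p\<close>.\<close>

lemma power_series_at_substitute:
  fixes f :: "'a::euclidean_space \<Rightarrow> real"
  assumes f: "power_series_at b f p r C" and b: "b \<in> Basis" and u: "has_power_series u s0" "u s0 = p \<bullet> b"
  shows "\<exists>r' C'. power_series_at b (\<lambda>q. f (q + (u (q \<bullet> b) - q \<bullet> b) *\<^sub>R b)) (p + (s0 - p \<bullet> b) *\<^sub>R b) r' C'"
proof -
  have r: "0 < r" using f by (simp add: power_series_at_def)
  obtain \<rho> a where "\<rho> > 0" and a: "\<And>\<sigma>. \<bar>\<sigma>\<bar> < \<rho> \<Longrightarrow> (\<lambda>k. a k * \<sigma> ^ k) sums u (s0 + \<sigma>)"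
    using u(1) unfolding has_power_series_def by blast
  \<comment> \<open>Only the increment of \<open>u\<close> matters: it is a series without constant
    term, so its majorant becomes small near 0.\<close>
  define w where "w \<sigma> = u (s0 + \<sigma>) - u s0" for \<sigma>
  have w_sums: "(\<lambda>k. (if k = 0 then 0 else a k) * \<sigma> ^ k) sums w \<sigma>" if "\<bar>\<sigma>\<bar> < \<rho>" for \<sigma>
  proof -
    have "a 0 = u s0" using a[of 0] \<open>\<rho> > 0\<close> by simp
    moreover have "(\<lambda>k. (if k = 0 then 0 else a k) * \<sigma> ^ k) = (\<lambda>k. a k * \<sigma> ^ k - (if k = 0 then a k else 0))"
      by auto
    ultimately show ?thesis
      using sums_diff[OF a[OF that] sums_single[of 0 a]] by (simp add: w_def)
  qed
  have r2: "0 < r / 2" and w0: "w 0 = 0" using r by (auto simp: w_def)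
  obtain e \<tau> where
    \<tau>: "0 < \<tau>" and "\<tau> \<le> \<rho>" and
    e1: "\<And>n \<sigma>. \<bar>\<sigma>\<bar> < \<tau> \<Longrightarrow> (\<lambda>k. e n k * \<sigma> ^ k) sums (w \<sigma> ^ n)" and
    e2: "\<And>n \<sigma>. \<bar>\<sigma>\<bar> < \<tau> \<Longrightarrow> summable (\<lambda>k. \<bar>e n k\<bar> * \<bar>\<sigma>\<bar> ^ k)" and
    e3: "\<And>\<sigma>. \<bar>\<sigma>\<bar> < \<tau> \<Longrightarrow> \<exists>W. 0 \<le> W \<and> W < r/2 \<and> \<bar>w \<sigma>\<bar> < r/2 \<and> (\<forall>n. (\<Sum>k. \<bar>e n k\<bar> * \<bar>\<sigma>\<bar> ^ k) \<le> W ^ n)"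
    by (rule power_series_powers[OF \<open>\<rho> > 0\<close> r2 w_sums w0]) (assumption, (rule that; assumption))
  define r' where "r' = min (r / 2) \<tau>"
  define C' where "C' k \<beta> = (\<Sum>\<^sub>\<infinity>n. C n \<beta> * e n k)" for k \<beta>
  have "power_series_at b (\<lambda>q. f (q + (u (q \<bullet> b) - q \<bullet> b) *\<^sub>R b)) (p + (s0 - p \<bullet> b) *\<^sub>R b) r' C'"
    unfolding power_series_at_def
  proof (intro conjI ballI)
    show "0 < r'" using r \<tau> by (simp add: r'_def)
    fix v :: 'a assume "v \<in> ball 0 r'"
    then have v: "norm v < r / 2" "norm v < \<tau>" by (auto simp: r'_def)
    define \<sigma> where "\<sigma> = v \<bullet> b"
    have \<sigma>: "\<bar>\<sigma>\<bar> < \<tau>" using Basis_le_norm[OF b, of v] v(2) by (simp add: \<sigma>_def)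
    obtain W where W: "0 \<le> W" "W < r/2" "\<bar>w \<sigma>\<bar> < r/2" "\<And>n. (\<Sum>k. \<bar>e n k\<bar> * \<bar>\<sigma>\<bar> ^ k) \<le> W ^ n"
      using e3[OF \<sigma>] by blast
    have "((\<lambda>(k, i). (\<Sum>\<^sub>\<infinity>n. (C n i * other_monomial b i v) * e n k) * \<sigma> ^ k) has_sum
        f (p + (v - (v \<bullet> b) *\<^sub>R b) + w \<sigma> *\<^sub>R b)) (UNIV \<times> other_indices b)"
    proof (rule power_family_substitute)
      show "((\<lambda>(n, i). C n i * other_monomial b i v * w \<sigma> ^ n) has_sum
          f (p + (v - (v \<bullet> b) *\<^sub>R b) + w \<sigma> *\<^sub>R b)) (UNIV \<times> other_indices b)"
        by (rule power_series_at_slice[OF f b v(1) W(3)])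
      show "(\<lambda>(n, i). C n i * other_monomial b i v * W ^ n) summable_on UNIV \<times> other_indices b"
        using power_series_at_slice[OF f b v(1), of W] W by (auto dest: has_sum_imp_summable)
    qed (use e1 e2 \<sigma> W in auto)
    moreover have "(\<Sum>\<^sub>\<infinity>n. (C n i * other_monomial b i v) * e n k) = C' k i * other_monomial b i v" for i k
      unfolding C'_def by (subst infsum_cmult_left'[symmetric]) (simp add: mult_ac)
    moreover have "p + (v - (v \<bullet> b) *\<^sub>R b) + w \<sigma> *\<^sub>R b = p + (s0 - p \<bullet> b) *\<^sub>R b + v +
        (u ((p + (s0 - p \<bullet> b) *\<^sub>R b + v) \<bullet> b) - (p + (s0 - p \<bullet> b) *\<^sub>R b + v) \<bullet> b) *\<^sub>R b"
      using b by (simp add: w_def \<sigma>_def u(2) inner_add_left algebra_simps)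
    ultimately show "((\<lambda>(n, \<beta>). C' n \<beta> * other_monomial b \<beta> v * (v \<bullet> b) ^ n) has_sum
        f (p + (s0 - p \<bullet> b) *\<^sub>R b + v +
          (u ((p + (s0 - p \<bullet> b) *\<^sub>R b + v) \<bullet> b) - (p + (s0 - p \<bullet> b) *\<^sub>R b + v) \<bullet> b) *\<^sub>R b)) (UNIV \<times> other_indices b)"
      by (simp only: \<sigma>_def)
  qed
  then show ?thesis by blast
qed

lemma real_analytic_on_substitute:
  fixes f :: "'a::euclidean_space \<Rightarrow> real"
  assumes f: "real_analytic_on f S'" and b: "b \<in> Basis"
    and u: "\<And>q. q \<in> S \<Longrightarrow> has_power_series u (q \<bullet> b)"
    and S: "\<And>q. q \<in> S \<Longrightarrow> q + (u (q \<bullet> b) - q \<bullet> b) *\<^sub>R b \<in> S'"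
  shows "real_analytic_on (\<lambda>q. f (q + (u (q \<bullet> b) - q \<bullet> b) *\<^sub>R b)) S"
  unfolding real_analytic_on_iff_power_series_at[OF b]
proof
  fix q assume q: "q \<in> S"
  define p where "p = q + (u (q \<bullet> b) - q \<bullet> b) *\<^sub>R b"
  have pb: "p \<bullet> b = u (q \<bullet> b)" using b by (simp add: p_def inner_add_left)
  obtain r C where "power_series_at b f p r C"
    using f S[OF q] real_analytic_on_iff_power_series_at[OF b] unfolding p_def by blast
  from power_series_at_substitute[OF this b u[OF q] pb[symmetric]]
  have "\<exists>r C. power_series_at b (\<lambda>q. f (q + (u (q \<bullet> b) - q \<bullet> b) *\<^sub>R b)) (p + (q \<bullet> b - p \<bullet> b) *\<^sub>R b) r C" .
  moreover have "p + (q \<bullet> b - p \<bullet> b) *\<^sub>R b = q"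
    unfolding pb by (simp add: p_def algebra_simps)
  ultimately show "\<exists>r C. power_series_at b (\<lambda>q. f (q + (u (q \<bullet> b) - q \<bullet> b) *\<^sub>R b)) q r C"
    by simp
qed

lemma power_series_at_iterated_derivative:
  fixes f :: "'a::euclidean_space \<Rightarrow> real"
  assumes f: "power_series_at b f p r C" and b: "b \<in> Basis"
  shows "power_series_at b (((\<lambda>f q. deriv (\<lambda>s. f (q + s *\<^sub>R b)) 0) ^^ j) f) p r
    (\<lambda>n \<beta>. fact (n + j) / fact n * C (n + j) \<beta>)"
proof (induction j)
  case 0
  then show ?case using f by simp
next
  case (Suc j)
  have "(\<lambda>n \<beta>. real (Suc n) * (fact (Suc n + j) / fact (Suc n) * C (Suc n + j) \<beta>)) =
      (\<lambda>n \<beta>. fact (n + Suc j) / fact n * C (n + Suc j) \<beta>)"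
    by (simp add: divide_simps del: of_nat_Suc)
  then show ?case
    using power_series_at_derivative(2)[OF Suc b] by simp
qed

text \<open>\<open>root 3\<close> has no power series at 0, so
  \<open>power_series_at_substitute\<close> does not apply here. Instead the vanishing derivatives
  remove the exponents not divisible by 3, and the coefficients \<open>C (3 * n)\<close> that remain
  are those of the new series.\<close>

lemma power_series_at_cubic:
  fixes f :: "'a::euclidean_space \<Rightarrow> real"
  assumes f: "power_series_at b f p r C" and b: "b \<in> Basis" and p: "p \<bullet> b = 0"
    and 3: "\<And>v n. norm v < r \<Longrightarrow> v \<bullet> b = 0 \<Longrightarrow> n mod 3 \<noteq> 0 \<Longrightarrow>
      ((\<lambda>f q. deriv (\<lambda>s. f (q + s *\<^sub>R b)) 0) ^^ n) f (p + v) = 0"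
  shows "\<exists>r' C'. power_series_at b (\<lambda>q. f (q + (root 3 (q \<bullet> b) - q \<bullet> b) *\<^sub>R b)) p r' C'"
proof -
  have r: "0 < r" using f by (simp add: power_series_at_def)
  \<comment> \<open>The second bound makes the cube root of the new coordinate smaller than r/2, as
    \<open>power_series_at_slice\<close> requires.\<close>
  define r' where "r' = min (r / 2) ((r / 2) ^ 3)"
  have "power_series_at b (\<lambda>q. f (q + (root 3 (q \<bullet> b) - q \<bullet> b) *\<^sub>R b)) p r' (\<lambda>n. C (3 * n))"
    unfolding power_series_at_def
  proof (intro conjI ballI)
    show "0 < r'" using r by (simp add: r'_def)
    fix v :: 'a assume "v \<in> ball 0 r'"
    then have v: "norm v < r / 2" "norm v < (r / 2) ^ 3" by (auto simp: r'_def)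
    define v0 where "v0 = v - (v \<bullet> b) *\<^sub>R b"
    have v0: "v0 \<bullet> b = 0" "norm v0 < r"
      using b norm_remove_component_le[OF b, of v] v(1) r by (auto simp: v0_def inner_diff_left)
    define s where "s = root 3 (v \<bullet> b)"
    have s3: "s ^ 3 = v \<bullet> b" by (simp add: s_def odd_real_root_pow)
    have "\<bar>v \<bullet> b\<bar> < (r / 2) ^ 3" using Basis_le_norm[OF b, of v] v(2) by linarith
    then have "root 3 \<bar>v \<bullet> b\<bar> < root 3 ((r / 2) ^ 3)" by (subst real_root_less_iff) auto
    then have s: "\<bar>s\<bar> < r / 2" using r by (simp add: s_def real_root_abs real_root_power_cancel)
    define D where "D n \<beta> = C n \<beta> * other_monomial b \<beta> v" for n \<beta>
    have D: "((\<lambda>(n, \<beta>). D n \<beta> * s ^ n) has_sum f (p + v0 + s *\<^sub>R b)) (UNIV \<times> other_indices b)"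
      if "\<bar>s\<bar> < r / 2" for s
      using power_series_at_slice[OF f b v(1) that] by (simp add: D_def v0_def)
    then have D': "(\<lambda>(n, \<beta>). D n \<beta> * s ^ n) summable_on (UNIV \<times> other_indices b)"
      if "\<bar>s\<bar> < r / 2" for s
      using that has_sum_imp_summable by blast
    have D0: "infsum (D n) (other_indices b) = 0" if n: "n mod 3 \<noteq> 0" for n
    proof -
      let ?g = "\<lambda>(k, \<beta>). fact (k + n) / fact k * C (k + n) \<beta> * other_monomial b \<beta> v0 * (v0 \<bullet> b) ^ k"
      have "v0 \<in> ball 0 r" using v0(2) by simp
      then have "(?g has_sum ((\<lambda>f q. deriv (\<lambda>s. f (q + s *\<^sub>R b)) 0) ^^ n) f (p + v0)) (UNIV \<times> other_indices b)"
        using power_series_at_iterated_derivative[OF f b, of n] unfolding power_series_at_def by blast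
      then have g: "(?g has_sum 0) (UNIV \<times> other_indices b)"
        by (simp only: 3[OF v0(2,1) n])
      \<comment> \<open>\<open>v0\<close> has no component along \<open>b\<close>, so only the term
        k = 0 survives: the n-th derivative is \<open>fact n\<close> times the sum of the
        coefficients of degree n.\<close>
      have "?g x = 0" if "x \<in> UNIV \<times> other_indices b - {0} \<times> other_indices b" for x
        using that v0(1) by (cases x) auto
      then have "(?g has_sum 0) ({0} \<times> other_indices b)"
        by (intro has_sum_cong_neutral[THEN iffD1, OF _ _ _ g]) (blast, blast, rule refl)
      moreover have "bij_betw (Pair 0) (other_indices b) ({0 :: nat} \<times> other_indices b)"
        by (auto simp: bij_betw_def inj_on_def)
      ultimately have "((\<lambda>\<beta>. ?g (0, \<beta>)) has_sum 0) (other_indices b)"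
        using has_sum_reindex_bij_betw[of "Pair 0" "other_indices b" "{0} \<times> other_indices b" ?g 0] by blast
      moreover have "?g (0, \<beta>) = fact n * D n \<beta>" for \<beta>
        using b by (simp add: D_def v0_def)
      ultimately have "((\<lambda>\<beta>. fact n * D n \<beta>) has_sum 0) (other_indices b)"
        by (simp only:)
      then have "infsum (\<lambda>\<beta>. fact n * D n \<beta>) (other_indices b) = 0" by (rule infsumI)
      then show ?thesis by (simp add: infsum_cmult_right')
    qed
    have "((\<lambda>(n, \<beta>). D (3 * n) \<beta> * (s ^ 3) ^ n) has_sum
        (\<Sum>\<^sub>\<infinity>(n, \<beta>)\<in>UNIV \<times> other_indices b. D n \<beta> * s ^ n)) (UNIV \<times> other_indices b)"
      by (rule power_family_cubic[OF _ D' s D0]) (use r in auto)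
    also have "(\<Sum>\<^sub>\<infinity>(n, \<beta>)\<in>UNIV \<times> other_indices b. D n \<beta> * s ^ n) = f (p + v0 + s *\<^sub>R b)"
      using D[OF s] by (rule infsumI)
    also have "p + v0 + s *\<^sub>R b = p + v + (root 3 ((p + v) \<bullet> b) - (p + v) \<bullet> b) *\<^sub>R b"
      using p by (simp add: v0_def s_def inner_add_left algebra_simps)
    finally show "((\<lambda>(n, \<beta>). C (3 * n) \<beta> * other_monomial b \<beta> v * (v \<bullet> b) ^ n) has_sum
        f (p + v + (root 3 ((p + v) \<bullet> b) - (p + v) \<bullet> b) *\<^sub>R b)) (UNIV \<times> other_indices b)"
      by (simp add: D_def s3)
  qed
  then show ?thesis by blast
qed

subsection \<open>Examples of one-variable power series\<close>

lemma has_power_series_mult: "has_power_series (\<lambda>s. c * s) s0"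
  unfolding has_power_series_def
proof (intro exI[of _ "1::real"] exI[of _ "\<lambda>k. if k = 0 then c * s0 else if k = 1 then c else 0"] conjI allI impI)
  fix \<sigma> :: real
  have "(\<lambda>k. (if k = 0 then c * s0 else if k = 1 then c else 0) * \<sigma> ^ k) sums
      (\<Sum>k\<in>{0, 1}. (if k = 0 then c * s0 else if k = 1 then c else 0) * \<sigma> ^ k)"
    by (rule sums_finite) auto
  then show "(\<lambda>k. (if k = 0 then c * s0 else if k = 1 then c else 0) * \<sigma> ^ k) sums (c * (s0 + \<sigma>))"
    by (simp add: algebra_simps)
qed simp

lemma has_power_series_cube: "has_power_series (\<lambda>s. s ^ 3) s0"
  unfolding has_power_series_def
proof (intro exI[of _ "1::real"] conjI allI impI)
  let ?a = "\<lambda>k. if k = 0 then s0 ^ 3 else if k = 1 then 3 * s0\<^sup>2 else if k = 2 then 3 * s0 else if k = 3 then 1 else 0"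
  show "\<exists>a. \<forall>\<sigma>. \<bar>\<sigma>\<bar> < 1 \<longrightarrow> (\<lambda>k. a k * \<sigma> ^ k) sums ((s0 + \<sigma>) ^ 3)"
  proof (intro exI[of _ ?a] allI impI)
    fix \<sigma> :: real
    have "(\<lambda>k. ?a k * \<sigma> ^ k) sums (\<Sum>k\<in>{0, 1, 2, 3}. ?a k * \<sigma> ^ k)"
      by (rule sums_finite) auto
    then show "(\<lambda>k. ?a k * \<sigma> ^ k) sums ((s0 + \<sigma>) ^ 3)"
      by (simp add: power3_eq_cube power2_eq_square algebra_simps)
  qed
qed simp

text \<open>After \<open>root 3 s0\<close> is factored out, the argument 1 + \<sigma>/s0 is positive
  for either sign of \<open>s0\<close>, so the binomial series with exponent 1/3 applies.\<close>

lemma has_power_series_root3: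
  assumes "s0 \<noteq> 0"
  shows "has_power_series (root 3) s0"
  unfolding has_power_series_def
proof (intro exI[of _ "\<bar>s0\<bar>"] exI[of _ "\<lambda>k. root 3 s0 * ((1/3) gchoose k) / s0 ^ k"] conjI allI impI)
  fix \<sigma> :: real assume \<sigma>: "\<bar>\<sigma>\<bar> < \<bar>s0\<bar>"
  then have z: "\<bar>\<sigma> / s0\<bar> < 1" using assms by (simp add: abs_divide)
  have "(\<lambda>k. root 3 s0 * (((1/3) gchoose k) * (\<sigma> / s0) ^ k)) sums (root 3 s0 * (1 + \<sigma> / s0) powr (1/3))"
    by (intro sums_mult gen_binomial_real z)
  also have "(1 + \<sigma> / s0) powr (1/3) = root 3 (1 + \<sigma> / s0)"
  proof -
    have "0 < 1 + \<sigma> / s0" using z by linarith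
    then show ?thesis by (simp add: root_powr_inverse)
  qed
  also have "root 3 s0 * root 3 (1 + \<sigma> / s0) = root 3 (s0 + \<sigma>)"
    using assms by (simp add: real_root_mult[symmetric] algebra_simps)
  finally show "(\<lambda>k. root 3 s0 * ((1/3) gchoose k) / s0 ^ k * \<sigma> ^ k) sums root 3 (s0 + \<sigma>)"
    by (simp add: power_divide mult.assoc)
qed (use assms in simp)

section \<open>Smooth functions\<close>

definition differentiable_along :: "'n \<Rightarrow> (real^'n \<Rightarrow> real) \<Rightarrow> real^'n \<Rightarrow> bool" where
  "differentiable_along a f p \<longleftrightarrow> (\<lambda>s. f (p + s *\<^sub>R axis a 1)) differentiable (at 0)"

lemma has_partial_deriv:
  "differentiable_along a f p \<Longrightarrow> ((\<lambda>s. f (p + s *\<^sub>R axis a 1)) has_real_derivative partial_deriv a f p) (at 0)"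
  by (simp add: differentiable_along_def partial_deriv_def DERIV_deriv_iff_real_differentiable)

lemma partial_derivI:
  "((\<lambda>s. f (p + s *\<^sub>R axis a 1)) has_real_derivative D) (at 0) \<Longrightarrow> partial_deriv a f p = D"
  by (simp add: partial_deriv_def DERIV_imp_deriv)

lemma differentiable_alongI:
  "((\<lambda>s. f (p + s *\<^sub>R axis a 1)) has_real_derivative D) (at 0) \<Longrightarrow> differentiable_along a f p"
  unfolding differentiable_along_def using real_differentiable_def by blast

lemma partial_deriv_const [simp]: "partial_deriv a (\<lambda>_. c) p = 0"
  by (rule partial_derivI) simp

text \<open>Iterated coordinate partials, because these are the derivatives that the curvature
  formulas contain. Continuity at every level yields the symmetry of second derivatives.\<close>

primrec continuous_partials_on :: "nat \<Rightarrow> (real^'n) set \<Rightarrow> (real^'n \<Rightarrow> real) \<Rightarrow> bool" where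
  "continuous_partials_on 0 S f = continuous_on S f"
| "continuous_partials_on (Suc k) S f = (continuous_on S f \<and> (\<forall>a. \<forall>p\<in>S. differentiable_along a f p)
     \<and> (\<forall>a. continuous_partials_on k S (partial_deriv a f)))"

definition smooth_on :: "(real^'n) set \<Rightarrow> (real^'n \<Rightarrow> real) \<Rightarrow> bool" where
  "smooth_on S f \<longleftrightarrow> (\<forall>k. continuous_partials_on k S f)"

lemma continuous_partials_on_Suc_imp: "continuous_partials_on (Suc k) S f \<Longrightarrow> continuous_partials_on k S f"
  by (induction k arbitrary: f) auto

lemma smooth_on_iff:
  "smooth_on S f \<longleftrightarrow> continuous_on S f \<and> (\<forall>a. \<forall>p\<in>S. differentiable_along a f p)
     \<and> (\<forall>a. smooth_on S (partial_deriv a f))" (is "?A \<longleftrightarrow> ?B")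
proof
  assume ?A
  then have "continuous_partials_on (Suc k) S f" for k by (auto simp: smooth_on_def)
  then show ?B by (auto simp: smooth_on_def)
next
  assume ?B
  then have "continuous_partials_on k S f" for k by (cases k) (auto simp: smooth_on_def)
  then show ?A by (simp add: smooth_on_def)
qed

lemma smooth_on_partial_deriv: "smooth_on S f \<Longrightarrow> smooth_on S (partial_deriv a f)"
  using smooth_on_iff by blast

lemma smooth_on_continuous: "smooth_on S f \<Longrightarrow> continuous_on S f"
  using smooth_on_iff by blast

lemma smooth_on_differentiable: "smooth_on S f \<Longrightarrow> p \<in> S \<Longrightarrow> differentiable_along a f p"
  using smooth_on_iff by blast

lemma smooth_on_has_partial_deriv:
  "smooth_on S f \<Longrightarrow> p \<in> S \<Longrightarrow> ((\<lambda>s. f (p + s *\<^sub>R axis a 1)) has_real_derivative partial_deriv a f p) (at 0)"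
  by (intro has_partial_deriv smooth_on_differentiable)

lemma continuous_partials_on_subset:
  "continuous_partials_on k S f \<Longrightarrow> S' \<subseteq> S \<Longrightarrow> continuous_partials_on k S' f"
  by (induction k arbitrary: f) (auto intro: continuous_on_subset)

lemma smooth_on_subset: "smooth_on S f \<Longrightarrow> S' \<subseteq> S \<Longrightarrow> smooth_on S' f"
  unfolding smooth_on_def by (blast intro: continuous_partials_on_subset)

lemma eventually_line_in_open:
  fixes p :: "real^'n"
  assumes "open S" "p \<in> S"
  shows "\<forall>\<^sub>F s in nhds 0. p + s *\<^sub>R v \<in> S"
proof -
  have "open ((\<lambda>s. p + s *\<^sub>R v) -` S)"
    by (rule open_vimage[OF assms(1)]) (auto intro!: continuous_intros)
  then show ?thesis
    using assms(2) eventually_nhds_in_open[of "(\<lambda>s. p + s *\<^sub>R v) -` S" 0] by simp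
qed

lemma partial_deriv_cong:
  assumes "open S" "p \<in> S" "\<And>q. q \<in> S \<Longrightarrow> f q = g q"
  shows "partial_deriv a f p = partial_deriv a g p"
  unfolding partial_deriv_def
proof (rule deriv_cong_ev[OF _ refl])
  show "\<forall>\<^sub>F s in nhds 0. f (p + s *\<^sub>R axis a 1) = g (p + s *\<^sub>R axis a 1)"
    using eventually_line_in_open[OF assms(1,2), of "axis a 1"] by eventually_elim (rule assms(3))
qed

lemma differentiable_along_cong:
  assumes "open S" "p \<in> S" "\<And>q. q \<in> S \<Longrightarrow> f q = g q" "differentiable_along a f p"
  shows "differentiable_along a g p"
proof -
  have "\<forall>\<^sub>F s in nhds 0. f (p + s *\<^sub>R axis a 1) = g (p + s *\<^sub>R axis a 1)"
    using eventually_line_in_open[OF assms(1,2), of "axis a 1"] by eventually_elim (rule assms(3))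
  then have "((\<lambda>s. g (p + s *\<^sub>R axis a 1)) has_real_derivative partial_deriv a f p) (at 0)"
    by (rule DERIV_cong_ev[OF refl _ refl, THEN iffD1]) (rule has_partial_deriv[OF assms(4)])
  then show ?thesis by (rule differentiable_alongI)
qed

lemma continuous_partials_on_cong:
  assumes "open S" "\<And>q. q \<in> S \<Longrightarrow> f q = g q" "continuous_partials_on k S f"
  shows "continuous_partials_on k S g"
  using assms(2,3)
proof (induction k arbitrary: f g)
  case 0
  then show ?case using continuous_on_cong[of S S f g] by simp
next
  case (Suc k)
  have "partial_deriv a f q = partial_deriv a g q" if "q \<in> S" for a q
    using partial_deriv_cong[OF assms(1) that] Suc.prems(1) by blast
  then have "continuous_partials_on k S (partial_deriv a g)" for a
    using Suc.IH[of "partial_deriv a f" "partial_deriv a g"] Suc.prems by auto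
  moreover have "continuous_on S g" using Suc.prems continuous_on_cong[of S S f g] by simp
  moreover have "differentiable_along a g p" if "p \<in> S" for a p
    using differentiable_along_cong[OF assms(1) that, of f g] Suc.prems that by auto
  ultimately show ?case by simp
qed

lemma smooth_on_cong:
  assumes "open S" "\<And>q. q \<in> S \<Longrightarrow> f q = g q" "smooth_on S f"
  shows "smooth_on S g"
  using assms continuous_partials_on_cong unfolding smooth_on_def by blast

lemma continuous_partials_on_SucI:
  assumes "open S" "continuous_on S f"
    "\<And>a p. p \<in> S \<Longrightarrow> ((\<lambda>s. f (p + s *\<^sub>R axis a 1)) has_real_derivative D a p) (at 0)"
    "\<And>a. continuous_partials_on k S (D a)"
  shows "continuous_partials_on (Suc k) S f"
proof -
  have "continuous_partials_on k S (partial_deriv a f)" for a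
    by (rule continuous_partials_on_cong[OF assms(1) _ assms(4)]) (rule partial_derivI[symmetric], rule assms(3))
  then show ?thesis
    using assms(2) differentiable_alongI[OF assms(3)] by auto
qed

lemma continuous_partials_on_const: "continuous_partials_on k S (\<lambda>_. c)"
  by (induction k arbitrary: c) (auto simp: differentiable_along_def partial_deriv_def[abs_def])

lemma smooth_on_const: "smooth_on S (\<lambda>_. c)"
  by (simp add: smooth_on_def continuous_partials_on_const)

lemma continuous_partials_on_add:
  assumes "open S" "continuous_partials_on k S f" "continuous_partials_on k S g"
  shows "continuous_partials_on k S (\<lambda>q. f q + g q)"
  using assms(2,3)
proof (induction k arbitrary: f g)
  case (Suc k)
  show ?case
    by (rule continuous_partials_on_SucI[OF assms(1), where D="\<lambda>a p. partial_deriv a f p + partial_deriv a g p"])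
      (use Suc in \<open>auto intro!: continuous_intros derivative_intros has_partial_deriv\<close>)
qed (auto intro: continuous_intros)

lemma continuous_partials_on_mult:
  assumes "open S" "continuous_partials_on k S f" "continuous_partials_on k S g"
  shows "continuous_partials_on k S (\<lambda>q. f q * g q)"
  using assms(2,3)
proof (induction k arbitrary: f g)
  case (Suc k)
  show ?case
  proof (rule continuous_partials_on_SucI[OF assms(1), where D="\<lambda>a p. partial_deriv a f p * g p + f p * partial_deriv a g p"])
    show "continuous_on S (\<lambda>q. f q * g q)" using Suc.prems by (auto intro!: continuous_intros)
    show "((\<lambda>s. f (p + s *\<^sub>R axis a 1) * g (p + s *\<^sub>R axis a 1)) has_real_derivative
        partial_deriv a f p * g p + f p * partial_deriv a g p) (at 0)" if "p \<in> S" for a p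
      using DERIV_mult[of "\<lambda>s. f (p + s *\<^sub>R axis a 1)" "partial_deriv a f p" 0 UNIV
          "\<lambda>s. g (p + s *\<^sub>R axis a 1)" "partial_deriv a g p"] Suc.prems that
      by (simp add: has_partial_deriv mult.commute)
    show "continuous_partials_on k S (\<lambda>p. partial_deriv a f p * g p + f p * partial_deriv a g p)" for a
      using Suc.prems continuous_partials_on_Suc_imp
      by (intro continuous_partials_on_add[OF assms(1)] Suc.IH) auto
  qed
qed (auto intro: continuous_intros)

lemma continuous_partials_on_inverse:
  assumes "open S" "continuous_partials_on k S f" "\<And>q. q \<in> S \<Longrightarrow> f q \<noteq> 0"
  shows "continuous_partials_on k S (\<lambda>q. inverse (f q))"
  using assms(2)
proof (induction k)
  case (Suc k)
  show ?case
  \<comment> \<open>The derivative -f'/f^2 is written with \<open>inverse\<close> twice, so that the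
    induction hypothesis and the lemma on products cover it.\<close>
  proof (rule continuous_partials_on_SucI[OF assms(1), where D="\<lambda>a p. ((-1) * partial_deriv a f p) * (inverse (f p) * inverse (f p))"])
    show "continuous_on S (\<lambda>q. inverse (f q))" using Suc.prems assms(3) by (auto intro!: continuous_intros)
    show "((\<lambda>s. inverse (f (p + s *\<^sub>R axis a 1))) has_real_derivative
        ((-1) * partial_deriv a f p) * (inverse (f p) * inverse (f p))) (at 0)" if "p \<in> S" for a p
      using DERIV_inverse'[of "\<lambda>s. f (p + s *\<^sub>R axis a 1)" "partial_deriv a f p" 0 UNIV] Suc.prems that assms(3)
      by (simp add: has_partial_deriv mult_ac)
    show "continuous_partials_on k S (\<lambda>p. ((-1) * partial_deriv a f p) * (inverse (f p) * inverse (f p)))" for a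
      using Suc.prems continuous_partials_on_Suc_imp
      by (intro continuous_partials_on_mult[OF assms(1)] Suc.IH continuous_partials_on_const) auto
  qed
qed (use assms(3) in \<open>auto intro: continuous_intros\<close>)

lemma axis_1_in_Basis [simp]: "axis a (1::real) \<in> Basis"
  by (auto simp: Basis_vec_def)

lemma real_analytic_on_differentiable:
  fixes V :: "real \<Rightarrow> real"
  assumes "real_analytic_on V UNIV"
  shows "(V has_real_derivative deriv V y) (at y)" and "real_analytic_on (deriv V) UNIV"
proof -
  have "(\<lambda>s. V (s + y)) differentiable at 0" for y
    using real_analytic_on_line_differentiable[OF assms, of 1 y] by (simp add: add.commute)
  then have "((\<lambda>s. V (s + y)) has_real_derivative deriv (\<lambda>s. V (s + y)) 0) (at 0)" for y
    using DERIV_deriv_iff_real_differentiable by blast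
  then have *: "(V has_real_derivative deriv (\<lambda>s. V (s + y)) 0) (at y)" for y
    using DERIV_shift[of V _ 0 y] by simp
  then have "deriv V = (\<lambda>y. deriv (\<lambda>s. V (y + s *\<^sub>R 1)) 0)"
    by (auto simp: DERIV_imp_deriv add.commute)
  then show "real_analytic_on (deriv V) UNIV"
    using real_analytic_on_deriv[OF assms, of 1] by simp
  show "(V has_real_derivative deriv V y) (at y)"
    using *[of y] DERIV_imp_deriv[OF *[of y]] by simp
qed

lemma continuous_partials_on_compose:
  assumes "open S" "continuous_partials_on k S f" "real_analytic_on V UNIV"
  shows "continuous_partials_on k S (\<lambda>q. V (f q))"
  using assms(2,3)
proof (induction k arbitrary: V)
  case 0
  have "continuous_on UNIV V"
    using 0 real_analytic_on_isCont continuous_on_eq_continuous_at by blast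
  then show ?case using 0 continuous_on_compose2[of UNIV V S f] by auto
next
  case (Suc k)
  note V = real_analytic_on_differentiable[OF Suc.prems(2)]
  have cont: "continuous_on UNIV V"
    using Suc.prems real_analytic_on_isCont continuous_on_eq_continuous_at by blast
  show ?case
  proof (rule continuous_partials_on_SucI[OF assms(1), where D="\<lambda>a p. deriv V (f p) * partial_deriv a f p"])
    show "continuous_on S (\<lambda>q. V (f q))"
      using Suc.prems continuous_on_compose2[OF cont, of S f] by auto
    show "((\<lambda>s. V (f (p + s *\<^sub>R axis a 1))) has_real_derivative deriv V (f p) * partial_deriv a f p) (at 0)"
      if "p \<in> S" for a p
      using DERIV_chain2[where f=V and g="\<lambda>s. f (p + s *\<^sub>R axis a 1)" and x=0, OF V(1) has_partial_deriv] Suc.prems that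
      by auto
    show "continuous_partials_on k S (\<lambda>p. deriv V (f p) * partial_deriv a f p)" for a
    proof (rule continuous_partials_on_mult[OF assms(1)])
      show "continuous_partials_on k S (\<lambda>p. deriv V (f p))"
        by (rule Suc.IH[OF continuous_partials_on_Suc_imp[OF Suc.prems(1)] V(2)])
      show "continuous_partials_on k S (partial_deriv a f)"
        using Suc.prems(1) by simp
    qed
  qed
qed

lemma real_analytic_on_imp_smooth_on:
  fixes f :: "real^'n \<Rightarrow> real"
  assumes "real_analytic_on f S"
  shows "smooth_on S f"
proof -
  have "continuous_partials_on k S f" for k
    using assms
  proof (induction k arbitrary: f)
    case 0
    then show ?case
      using real_analytic_on_isCont by (auto intro!: continuous_at_imp_continuous_on)
  next
    case (Suc k)
    have "real_analytic_on (partial_deriv a f) S" for a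
      using real_analytic_on_deriv[OF Suc.prems, of "axis a 1"] by (simp add: partial_deriv_def[abs_def])
    then show ?case
      using Suc real_analytic_on_isCont
      by (auto intro!: continuous_at_imp_continuous_on real_analytic_on_line_differentiable simp: differentiable_along_def)
  qed
  then show ?thesis by (simp add: smooth_on_def)
qed

section \<open>Closure properties of smooth functions and symmetry of second derivatives\<close>

context
  fixes S :: "(real^'n) set"
  assumes S: "open S"
begin

lemma smooth_on_add: "smooth_on S f \<Longrightarrow> smooth_on S g \<Longrightarrow> smooth_on S (\<lambda>q. f q + g q)"
  using continuous_partials_on_add[OF S] by (auto simp: smooth_on_def)

lemma smooth_on_mult: "smooth_on S f \<Longrightarrow> smooth_on S g \<Longrightarrow> smooth_on S (\<lambda>q. f q * g q)"
  using continuous_partials_on_mult[OF S] by (auto simp: smooth_on_def)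

lemma smooth_on_uminus: "smooth_on S f \<Longrightarrow> smooth_on S (\<lambda>q. - f q)"
  using smooth_on_mult[OF smooth_on_const, of f "-1"] by simp

lemma smooth_on_diff: "smooth_on S f \<Longrightarrow> smooth_on S g \<Longrightarrow> smooth_on S (\<lambda>q. f q - g q)"
  using smooth_on_add[OF _ smooth_on_uminus, of f g] by simp

lemma smooth_on_inverse: "smooth_on S f \<Longrightarrow> (\<And>q. q \<in> S \<Longrightarrow> f q \<noteq> 0) \<Longrightarrow> smooth_on S (\<lambda>q. inverse (f q))"
  using continuous_partials_on_inverse[OF S] by (auto simp: smooth_on_def)

lemma smooth_on_divide:
  "smooth_on S f \<Longrightarrow> smooth_on S g \<Longrightarrow> (\<And>q. q \<in> S \<Longrightarrow> g q \<noteq> 0) \<Longrightarrow> smooth_on S (\<lambda>q. f q / g q)"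
  unfolding divide_inverse by (intro smooth_on_mult smooth_on_inverse)

lemma smooth_on_sum: "(\<And>i. i \<in> I \<Longrightarrow> smooth_on S (f i)) \<Longrightarrow> smooth_on S (\<lambda>q. \<Sum>i\<in>I. f i q)"
  by (induction I rule: infinite_finite_induct) (auto intro: smooth_on_const smooth_on_add)

lemma smooth_on_prod: "(\<And>i. i \<in> I \<Longrightarrow> smooth_on S (f i)) \<Longrightarrow> smooth_on S (\<lambda>q. \<Prod>i\<in>I. f i q)"
  by (induction I rule: infinite_finite_induct) (auto intro: smooth_on_const smooth_on_mult)

lemma smooth_on_power: "smooth_on S f \<Longrightarrow> smooth_on S (\<lambda>q. f q ^ n)"
  by (induction n) (auto intro: smooth_on_const smooth_on_mult)

lemma smooth_on_compose: "smooth_on S f \<Longrightarrow> real_analytic_on V UNIV \<Longrightarrow> smooth_on S (\<lambda>q. V (f q))"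
  using continuous_partials_on_compose[OF S] by (auto simp: smooth_on_def)

lemmas smooth_on_intros = smooth_on_const smooth_on_add smooth_on_mult smooth_on_uminus smooth_on_diff
  smooth_on_sum smooth_on_partial_deriv smooth_on_power

lemma partial_deriv_add:
  "smooth_on S f \<Longrightarrow> smooth_on S g \<Longrightarrow> p \<in> S \<Longrightarrow>
    partial_deriv a (\<lambda>q. f q + g q) p = partial_deriv a f p + partial_deriv a g p"
  by (rule partial_derivI) (auto intro!: derivative_intros smooth_on_has_partial_deriv)

lemma partial_deriv_mult:
  assumes "smooth_on S f" "smooth_on S g" "p \<in> S"
  shows "partial_deriv a (\<lambda>q. f q * g q) p = partial_deriv a f p * g p + f p * partial_deriv a g p"
  by (rule partial_derivI)
    (use DERIV_mult[OF smooth_on_has_partial_deriv[OF assms(1,3)] smooth_on_has_partial_deriv[OF assms(2,3)], of a]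
      in \<open>simp add: mult.commute\<close>)

lemma partial_deriv_cmult:
  "smooth_on S f \<Longrightarrow> p \<in> S \<Longrightarrow> partial_deriv a (\<lambda>q. c * f q) p = c * partial_deriv a f p"
  using partial_deriv_mult[OF smooth_on_const, of f p a c] by simp

lemma partial_deriv_uminus:
  "smooth_on S f \<Longrightarrow> p \<in> S \<Longrightarrow> partial_deriv a (\<lambda>q. - f q) p = - partial_deriv a f p"
  using partial_deriv_cmult[of f p a "-1"] by simp

lemma partial_deriv_diff:
  "smooth_on S f \<Longrightarrow> smooth_on S g \<Longrightarrow> p \<in> S \<Longrightarrow>
    partial_deriv a (\<lambda>q. f q - g q) p = partial_deriv a f p - partial_deriv a g p"
  by (rule partial_derivI) (auto intro!: derivative_intros smooth_on_has_partial_deriv)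

lemma partial_deriv_sum:
  "(\<And>i. i \<in> I \<Longrightarrow> smooth_on S (f i)) \<Longrightarrow> p \<in> S \<Longrightarrow>
    partial_deriv a (\<lambda>q. \<Sum>i\<in>I. f i q) p = (\<Sum>i\<in>I. partial_deriv a (f i) p)"
  by (rule partial_derivI) (auto intro!: DERIV_sum smooth_on_has_partial_deriv)

lemma partial_deriv_compose:
  assumes "smooth_on S f" "real_analytic_on V UNIV" "p \<in> S"
  shows "partial_deriv a (\<lambda>q. V (f q)) p = deriv V (f p) * partial_deriv a f p"
  by (rule partial_derivI)
    (use DERIV_chain2[where f=V and g="\<lambda>s. f (p + s *\<^sub>R axis a 1)" and x=0]
      real_analytic_on_differentiable(1)[OF assms(2)] smooth_on_has_partial_deriv[OF assms(1,3), of a] in auto)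

lemma second_difference_mean_value:
  assumes f: "smooth_on S f" and h: "0 < h"
    and sub: "\<And>s t. 0 \<le> s \<Longrightarrow> s \<le> h \<Longrightarrow> 0 \<le> t \<Longrightarrow> t \<le> h \<Longrightarrow> p + s *\<^sub>R axis a 1 + t *\<^sub>R axis b 1 \<in> S"
  shows "\<exists>\<xi> \<eta>. 0 < \<xi> \<and> \<xi> < h \<and> 0 < \<eta> \<and> \<eta> < h \<and>
    f (p + h *\<^sub>R axis a 1 + h *\<^sub>R axis b 1) - f (p + h *\<^sub>R axis a 1) - f (p + h *\<^sub>R axis b 1) + f p
      = h * h * partial_deriv b (partial_deriv a f) (p + \<xi> *\<^sub>R axis a 1 + \<eta> *\<^sub>R axis b 1)"
proof -
  let ?F = "\<lambda>s t. f (p + s *\<^sub>R axis a 1 + t *\<^sub>R axis b 1)"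
  let ?Fa = "\<lambda>s t. partial_deriv a f (p + s *\<^sub>R axis a 1 + t *\<^sub>R axis b 1)"
  have da: "((\<lambda>s. ?F s t) has_real_derivative ?Fa s t) (at s)"
    if "0 \<le> s" "s \<le> h" "0 \<le> t" "t \<le> h" for s t
    using smooth_on_has_partial_deriv[OF f sub[OF that], of a]
      DERIV_shift[of "\<lambda>s. ?F s t" "?Fa s t" 0 s] by (simp add: algebra_simps)
  have db: "((\<lambda>t. ?Fa s t) has_real_derivative partial_deriv b (partial_deriv a f) (p + s *\<^sub>R axis a 1 + t *\<^sub>R axis b 1)) (at t)"
    if "0 \<le> s" "s \<le> h" "0 \<le> t" "t \<le> h" for s t
    using smooth_on_has_partial_deriv[OF smooth_on_partial_deriv[OF f, of a] sub[OF that], of b]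
      DERIV_shift[of "\<lambda>t. ?Fa s t" _ 0 t] by (simp add: algebra_simps)
  have "\<exists>\<xi>. 0 < \<xi> \<and> \<xi> < h \<and> (?F h h - ?F h 0) - (?F 0 h - ?F 0 0) = (h - 0) * (?Fa \<xi> h - ?Fa \<xi> 0)"
    using h by (intro MVT2[where f="\<lambda>s. ?F s h - ?F s 0" and f'="\<lambda>s. ?Fa s h - ?Fa s 0"] DERIV_diff da) auto
  then obtain \<xi> where \<xi>: "0 < \<xi>" "\<xi> < h" "(?F h h - ?F h 0) - (?F 0 h - ?F 0 0) = h * (?Fa \<xi> h - ?Fa \<xi> 0)"
    by auto
  have "\<exists>\<eta>. 0 < \<eta> \<and> \<eta> < h \<and> ?Fa \<xi> h - ?Fa \<xi> 0 =
      (h - 0) * partial_deriv b (partial_deriv a f) (p + \<xi> *\<^sub>R axis a 1 + \<eta> *\<^sub>R axis b 1)"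
    using h \<xi> by (intro MVT2 db) auto
  then obtain \<eta> where "0 < \<eta>" "\<eta> < h" "?Fa \<xi> h - ?Fa \<xi> 0 =
      h * partial_deriv b (partial_deriv a f) (p + \<xi> *\<^sub>R axis a 1 + \<eta> *\<^sub>R axis b 1)"
    by auto
  then show ?thesis using \<xi> by (intro exI[of _ \<xi>] exI[of _ \<eta>]) (simp add: algebra_simps)
qed

text \<open>By the mean value theorem one and the same second difference over a square of side
  \<open>h\<close> is h^2 times either mixed derivative, each at some point of the square.
  Continuity then compares both with their values at \<open>p\<close>.\<close>

lemma partial_deriv_commute:
  assumes f: "smooth_on S f" and p: "p \<in> S"
  shows "partial_deriv a (partial_deriv b f) p = partial_deriv b (partial_deriv a f) p"
proof (rule ccontr)
  let ?A = "partial_deriv a (partial_deriv b f)" and ?B = "partial_deriv b (partial_deriv a f)"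
  assume ne: "?A p \<noteq> ?B p"
  define e where "e = \<bar>?A p - ?B p\<bar> / 2"
  have e: "e > 0" using ne by (simp add: e_def)
  have "isCont ?A p" "isCont ?B p"
    using f p S smooth_on_continuous[of S] smooth_on_partial_deriv[of S]
    by (auto simp: continuous_on_eq_continuous_at)
  then have "\<exists>d>0. \<forall>q. dist q p < d \<longrightarrow> dist (?A q) (?A p) < e"
    and "\<exists>d>0. \<forall>q. dist q p < d \<longrightarrow> dist (?B q) (?B p) < e"
    using e unfolding continuous_at_eps_delta by auto
  then obtain d1 d2 where d: "d1 > 0" "d2 > 0" "\<And>q. dist q p < d1 \<Longrightarrow> \<bar>?A q - ?A p\<bar> < e"
      "\<And>q. dist q p < d2 \<Longrightarrow> \<bar>?B q - ?B p\<bar> < e"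
    unfolding dist_real_def by blast
  obtain d3 where d3: "d3 > 0" "ball p d3 \<subseteq> S" using S p open_contains_ball by blast
  \<comment> \<open>Points of the square are within 2 h of \<open>p\<close>; the divisor 3 keeps 2 h
    strictly below all three radii.\<close>
  define h where "h = min d1 (min d2 d3) / 3"
  have h: "h > 0" using d d3 by (simp add: h_def)
  have hd: "2 * h < d1" "2 * h < d2" "2 * h < d3" using d d3 by (auto simp: h_def)
  have dist: "dist (p + s *\<^sub>R axis a' 1 + t *\<^sub>R axis b' 1) p \<le> 2 * h"
    if "0 \<le> s" "s \<le> h" "0 \<le> t" "t \<le> h" for s t and a' b' :: 'n
    using norm_triangle_ineq[of "s *\<^sub>R axis a' (1::real)" "t *\<^sub>R axis b' (1::real)"] that
    by (simp add: dist_norm norm_axis_1)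
  have sub: "p + s *\<^sub>R axis a' 1 + t *\<^sub>R axis b' 1 \<in> S"
    if "0 \<le> s" "s \<le> h" "0 \<le> t" "t \<le> h" for s t and a' b' :: 'n
    using dist[OF that, of a' b'] hd d3 by (auto simp: dist_commute)
  obtain \<xi> \<eta> where 1: "0 < \<xi>" "\<xi> < h" "0 < \<eta>" "\<eta> < h"
    "f (p + h *\<^sub>R axis a 1 + h *\<^sub>R axis b 1) - f (p + h *\<^sub>R axis a 1) - f (p + h *\<^sub>R axis b 1) + f p
      = h * h * ?B (p + \<xi> *\<^sub>R axis a 1 + \<eta> *\<^sub>R axis b 1)"
    using second_difference_mean_value[OF f h, of p a b] sub by blast
  obtain \<xi>' \<eta>' where 2: "0 < \<xi>'" "\<xi>' < h" "0 < \<eta>'" "\<eta>' < h"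
    "f (p + h *\<^sub>R axis b 1 + h *\<^sub>R axis a 1) - f (p + h *\<^sub>R axis b 1) - f (p + h *\<^sub>R axis a 1) + f p
      = h * h * ?A (p + \<xi>' *\<^sub>R axis b 1 + \<eta>' *\<^sub>R axis a 1)"
    using second_difference_mean_value[OF f h, of p b a] sub by blast
  have "h * h * ?B (p + \<xi> *\<^sub>R axis a 1 + \<eta> *\<^sub>R axis b 1) = h * h * ?A (p + \<xi>' *\<^sub>R axis b 1 + \<eta>' *\<^sub>R axis a 1)"
    unfolding 1(5)[symmetric] 2(5)[symmetric] by (simp add: algebra_simps)
  then have "?B (p + \<xi> *\<^sub>R axis a 1 + \<eta> *\<^sub>R axis b 1) = ?A (p + \<xi>' *\<^sub>R axis b 1 + \<eta>' *\<^sub>R axis a 1)"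
    using h by simp
  moreover have "\<bar>?B (p + \<xi> *\<^sub>R axis a 1 + \<eta> *\<^sub>R axis b 1) - ?B p\<bar> < e"
    using dist[of \<xi> \<eta> a b] 1 hd by (intro d(4)) auto
  moreover have "\<bar>?A (p + \<xi>' *\<^sub>R axis b 1 + \<eta>' *\<^sub>R axis a 1) - ?A p\<bar> < e"
    using dist[of \<xi>' \<eta>' b a] 2 hd by (intro d(3)) auto
  ultimately have "\<bar>?A p - ?B p\<bar> < e + e" by linarith
  then show False unfolding e_def by simp
qed

end

section \<open>Spacetime coordinates\<close>

lemma UNIV_option: "(UNIV :: 'a option set) = insert None (range Some)"
  by (simp add: UNIV_option_conv)

lemma sum_option: "(\<Sum>a\<in>(UNIV :: 'a::finite option set). f a) = f None + (\<Sum>i\<in>UNIV. f (Some i))"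
  unfolding UNIV_option by (subst sum.insert) (auto simp: sum.reindex)

lemma all_option: "(\<forall>a. P a) \<longleftrightarrow> P None \<and> (\<forall>i. P (Some i))"
  by (metis option.exhaust)

lemma event_nth [simp]: "event t x $ None = t" "event t x $ Some i = x $ i"
  by (simp_all add: event_def)

lemma time_event [simp]: "time (event t x) = t" and space_part_event [simp]: "space_part (event t x) = x"
  by (simp_all add: time_def space_part_def vec_eq_iff)

lemma event_time_space_part [simp]: "event (time p) (space_part p) = p"
  by (simp add: vec_eq_iff all_option time_def space_part_def)

lemma axis_nth_option [simp]:
  "axis None c $ None = c" "axis None c $ Some i = 0" "axis (Some i) c $ None = 0" "axis (Some i) c $ Some j = axis i c $ j"
  by (simp_all add: axis_def)

lemma event_add_time: "event t x + s *\<^sub>R axis None 1 = event (t + s) x"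
  by (simp add: vec_eq_iff all_option)

lemma event_add_space: "event t x + s *\<^sub>R axis (Some i) 1 = event t (x + s *\<^sub>R axis i 1)"
  by (simp add: vec_eq_iff all_option)

lemma time_add [simp]: "time (p + q) = time p + time q"
  and time_scaleR [simp]: "time (s *\<^sub>R p) = s * time p"
  and time_axis [simp]: "time (axis None c) = c" "time (axis (Some i) c) = 0"
  by (simp_all add: time_def)

lemma space_part_add [simp]: "space_part (p + q) = space_part p + space_part q"
  and space_part_scaleR [simp]: "space_part (s *\<^sub>R p) = s *\<^sub>R space_part p"
  and space_part_axis [simp]: "space_part (axis None c) = 0" "space_part (axis (Some i) c) = axis i c"
  by (simp_all add: space_part_def vec_eq_iff)

lemma inner_axis_None: "p \<bullet> axis None 1 = time p"
  by (simp add: time_def inner_axis)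

lemma mem_slab_iff: "p \<in> slab r U \<longleftrightarrow> \<bar>time p\<bar> < r \<and> space_part p \<in> U"
  unfolding slab_def
proof safe
  assume "\<bar>time p\<bar> < r" "space_part p \<in> U"
  then show "\<exists>t x. p = event t x \<and> - r < t \<and> t < r \<and> x \<in> U"
    by (intro exI[of _ "time p"] exI[of _ "space_part p"]) auto
qed auto

lemma continuous_on_time [continuous_intros]: "continuous_on S time"
  unfolding time_def[abs_def] by (intro continuous_intros)

lemma continuous_on_space_part [continuous_intros]: "continuous_on S space_part"
  unfolding space_part_def[abs_def] by (intro continuous_intros)

lemma open_slab: "open U \<Longrightarrow> open (slab r U)"
proof -
  assume U: "open U"
  have "slab r U = time -` {-r<..<r} \<inter> space_part -` U"
    by (auto simp: mem_slab_iff)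
  then show ?thesis
    using U by (auto intro!: open_Int open_vimage continuous_intros)
qed

lemma open_time_nonzero: "open S \<Longrightarrow> open {p \<in> S. time p \<noteq> 0}"
proof -
  assume S: "open S"
  have "{p \<in> S. time p \<noteq> 0} = S \<inter> time -` (- {0})"
    by auto
  then show ?thesis
    using S by (auto intro!: open_Int open_vimage continuous_intros)
qed

lemma partial_deriv_of_time:
  assumes "(u has_real_derivative D) (at (time p))"
  shows "partial_deriv None (\<lambda>q. u (time q)) p = D"
    and "partial_deriv (Some i) (\<lambda>q. u (time q)) p = 0"
proof -
  have "((\<lambda>s. u (time p + s)) has_real_derivative D) (at 0)"
    using assms DERIV_shift[of u D 0 "time p"] by (simp add: add.commute)
  then show "partial_deriv None (\<lambda>q. u (time q)) p = D"
    by (intro partial_derivI) simp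
  show "partial_deriv (Some i) (\<lambda>q. u (time q)) p = 0"
    by (intro partial_derivI) simp
qed

lemma partial_deriv_time [simp]: "partial_deriv None time p = 1" "partial_deriv (Some i) time p = 0"
  using partial_deriv_of_time[of "\<lambda>t. t" 1 p] by auto

lemma smooth_on_time: "open S \<Longrightarrow> smooth_on S time"
proof -
  assume S: "open S"
  have "((\<lambda>s. time (p + s *\<^sub>R axis a 1)) has_real_derivative time (axis a 1)) (at 0)" for a p
    by (auto intro!: derivative_eq_intros)
  then have "continuous_partials_on k S time" for k
    using S by (cases k) (auto intro!: continuous_intros continuous_partials_on_const continuous_partials_on_SucI[where D="\<lambda>a p. time (axis a 1)"]
      simp del: continuous_partials_on.simps(2))
  then show ?thesis by (simp add: smooth_on_def)
qed


section \<open>Functions whose Taylor expansion in time is graded modulo 3\<close>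

text \<open>At the points \<open>(0, x)\<close> with \<open>x \<in> X\<close>, the time derivatives of order less than \<open>k\<close> vanish unless
  the order is congruent to \<open>r\<close> modulo 3. A time derivative lowers the degree, hence \<open>r + 2\<close>.\<close>

primrec graded :: "(real^3) set \<Rightarrow> nat \<Rightarrow> nat \<Rightarrow> (spacetime \<Rightarrow> real) \<Rightarrow> bool" where
  "graded X 0 r f = True"
| "graded X (Suc k) r f = ((r mod 3 \<noteq> 0 \<longrightarrow> (\<forall>x\<in>X. f (event 0 x) = 0)) \<and> graded X k (r + 2) (partial_deriv None f))"

lemma graded_mod_cong: "r mod 3 = r' mod 3 \<Longrightarrow> graded X k r f \<Longrightarrow> graded X k r' f"
proof (induction k arbitrary: f r r')
  case (Suc k)
  have "(r + 2) mod 3 = (r' + 2) mod 3" using Suc.prems(1) by (rule mod_add_cong) simp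
  then have "graded X k (r' + 2) (partial_deriv None f)"
    by (rule Suc.IH) (use Suc.prems(2) in simp)
  then show ?case using Suc.prems by simp
qed simp

lemma graded_Suc_imp: "graded X (Suc k) r f \<Longrightarrow> graded X k r f"
  by (induction k arbitrary: f r) auto

lemma graded_Un: "graded X k r f \<Longrightarrow> graded Y k r f \<Longrightarrow> graded (X \<union> Y) k r f"
  by (induction k arbitrary: f r) auto

lemma graded_flat:
  "(\<And>j x. x \<in> X \<Longrightarrow> (partial_deriv None ^^ j) f (event 0 x) = 0) \<Longrightarrow> graded X k r f"
proof (induction k arbitrary: f r)
  case (Suc k)
  have "(partial_deriv None ^^ j) (partial_deriv None f) (event 0 x) = 0" if "x \<in> X" for j x
    using Suc.prems[of x "Suc j"] that by (simp add: funpow_swap1)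
  then show ?case using Suc.prems[of _ 0] Suc.IH by auto
qed simp

lemma graded_imp:
  "graded X k r f \<Longrightarrow> j < k \<Longrightarrow> (r + 2 * j) mod 3 \<noteq> 0 \<Longrightarrow> x \<in> X \<Longrightarrow> (partial_deriv None ^^ j) f (event 0 x) = 0"
proof (induction j arbitrary: f k r)
  case 0
  then show ?case by (cases k) auto
next
  case (Suc j)
  then obtain k' where "k = Suc k'" by (cases k) auto
  then show ?case
    using Suc.IH[of k' "r + 2" "partial_deriv None f"] Suc.prems by (simp add: funpow_swap1 add_ac)
qed

context
  fixes S :: "spacetime set" and X :: "(real^3) set"
  assumes S: "open S" and X: "\<And>x. x \<in> X \<Longrightarrow> event 0 x \<in> S"
begin

lemma graded_cong: "(\<And>p. p \<in> S \<Longrightarrow> f p = g p) \<Longrightarrow> graded X k r f \<Longrightarrow> graded X k r g"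
proof (induction k arbitrary: f g r)
  case (Suc k)
  have "partial_deriv None f p = partial_deriv None g p" if "p \<in> S" for p
    using partial_deriv_cong[OF S that] Suc.prems(1) by blast
  then have "graded X k (r + 2) (partial_deriv None g)"
    using Suc.IH[of "partial_deriv None f"] Suc.prems(2) by simp
  moreover have "f (event 0 x) = g (event 0 x)" if "x \<in> X" for x
    using Suc.prems(1) X that by blast
  ultimately show ?case using Suc.prems(2) by auto
qed simp

lemma graded_const: "graded X k 0 (\<lambda>_. c)"
proof -
  have "graded X k r (\<lambda>_. 0)" for r
    by (induction k arbitrary: r) (auto simp: partial_deriv_const[abs_def])
  then show ?thesis by (cases k) (auto simp: partial_deriv_const[abs_def])
qed

lemma graded_add:
  "graded X k r f \<Longrightarrow> graded X k r g \<Longrightarrow> smooth_on S f \<Longrightarrow> smooth_on S g \<Longrightarrow> graded X k r (\<lambda>q. f q + g q)"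
proof (induction k arbitrary: f g r)
  case (Suc k)
  have "graded X k (r + 2) (\<lambda>q. partial_deriv None f q + partial_deriv None g q)"
    using Suc by (intro Suc.IH) (auto intro: smooth_on_partial_deriv)
  then have "graded X k (r + 2) (partial_deriv None (\<lambda>q. f q + g q))"
    by (rule graded_cong[rotated]) (simp add: partial_deriv_add[OF S Suc.prems(3,4)])
  then show ?case using Suc.prems by auto
qed simp

lemma graded_mult:
  "graded X k r f \<Longrightarrow> graded X k r' g \<Longrightarrow> smooth_on S f \<Longrightarrow> smooth_on S g \<Longrightarrow> graded X k (r + r') (\<lambda>q. f q * g q)"
proof (induction k arbitrary: f g r r')
  case (Suc k)
  note sm = smooth_on_partial_deriv[OF Suc.prems(3), of None] smooth_on_partial_deriv[OF Suc.prems(4), of None]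
  have "graded X k (r + 2 + r') (\<lambda>q. partial_deriv None f q * g q)"
    using Suc.prems sm graded_Suc_imp[OF Suc.prems(2)] by (intro Suc.IH) auto
  moreover have "graded X k (r + (r' + 2)) (\<lambda>q. f q * partial_deriv None g q)"
    using Suc.prems sm graded_Suc_imp[OF Suc.prems(1)] by (intro Suc.IH) auto
  ultimately have "graded X k (r + r' + 2) (\<lambda>q. partial_deriv None f q * g q + f q * partial_deriv None g q)"
    using Suc.prems sm by (intro graded_add smooth_on_mult[OF S]) (auto simp: add_ac)
  then have "graded X k (r + r' + 2) (partial_deriv None (\<lambda>q. f q * g q))"
    by (rule graded_cong[rotated]) (simp add: partial_deriv_mult[OF S Suc.prems(3,4)])
  moreover have "r mod 3 \<noteq> 0 \<or> r' mod 3 \<noteq> 0" if "(r + r') mod 3 \<noteq> 0"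
    using that by presburger
  ultimately show ?case using Suc.prems(1,2) by auto
qed simp

lemma graded_cmult: "graded X k r f \<Longrightarrow> smooth_on S f \<Longrightarrow> graded X k r (\<lambda>q. c * f q)"
  using graded_mult[OF graded_const, of k r f c] by (simp add: smooth_on_const)

lemma graded_uminus: "graded X k r f \<Longrightarrow> smooth_on S f \<Longrightarrow> graded X k r (\<lambda>q. - f q)"
  using graded_cmult[of k r f "-1"] by simp

lemma graded_diff:
  "graded X k r f \<Longrightarrow> graded X k r g \<Longrightarrow> smooth_on S f \<Longrightarrow> smooth_on S g \<Longrightarrow> graded X k r (\<lambda>q. f q - g q)"
  using graded_add[OF _ graded_uminus, of k r f g] smooth_on_uminus[OF S] by simp

lemma graded_zero: "graded X k r (\<lambda>_. 0)"
  by (induction k arbitrary: r) (auto simp: partial_deriv_const[abs_def])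

lemma graded_sum:
  "(\<And>i. i \<in> I \<Longrightarrow> graded X k r (f i)) \<Longrightarrow> (\<And>i. i \<in> I \<Longrightarrow> smooth_on S (f i)) \<Longrightarrow> graded X k r (\<lambda>q. \<Sum>i\<in>I. f i q)"
  by (induction I rule: infinite_finite_induct) (auto intro!: graded_zero graded_add smooth_on_sum[OF S])

text \<open>At time 0 the j-th derivative of t f is j times the derivative of f of order j - 1, so
  the factor t gains one order. This gain keeps the recursion in \<open>expansion_step\<close>
  going.\<close>

lemma graded_time_mult:
  "graded X k r f \<Longrightarrow> smooth_on S f \<Longrightarrow> graded X (Suc k) (Suc r) (\<lambda>q. time q * f q)"
proof (induction k arbitrary: f r)
  case (Suc k)
  note sm = smooth_on_partial_deriv[OF Suc.prems(2), of None]
  have "graded X (Suc k) (Suc (r + 2)) (\<lambda>q. time q * partial_deriv None f q)"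
    using Suc.prems sm by (intro Suc.IH) auto
  then have "graded X (Suc k) r (\<lambda>q. time q * partial_deriv None f q)"
    by (rule graded_mod_cong[rotated]) presburger
  then have "graded X (Suc k) r (\<lambda>q. f q + time q * partial_deriv None f q)"
    using Suc.prems sm by (intro graded_add smooth_on_mult[OF S] smooth_on_time[OF S]) auto
  then have "graded X (Suc k) r (partial_deriv None (\<lambda>q. time q * f q))"
    by (rule graded_cong[rotated]) (simp add: partial_deriv_mult[OF S smooth_on_time[OF S] Suc.prems(2)])
  then have "graded X (Suc k) (Suc r + 2) (partial_deriv None (\<lambda>q. time q * f q))"
    by (rule graded_mod_cong[rotated]) presburger
  then show ?case by auto
qed auto

text \<open>Openness of \<open>X\<close> enters because vanishing on \<open>X\<close> at time 0
  passes to spatial derivatives only if the neighbours of \<open>x\<close> belong to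
  \<open>X\<close> too.\<close>

lemma graded_space_deriv:
  assumes "open X"
  shows "graded X k r f \<Longrightarrow> smooth_on S f \<Longrightarrow> graded X k r (partial_deriv (Some i) f)"
proof (induction k arbitrary: f r)
  case (Suc k)
  have "graded X k (r + 2) (partial_deriv (Some i) (partial_deriv None f))"
    using Suc by (intro Suc.IH) (auto intro: smooth_on_partial_deriv)
  then have "graded X k (r + 2) (partial_deriv None (partial_deriv (Some i) f))"
    by (rule graded_cong[rotated]) (simp add: partial_deriv_commute[OF S Suc.prems(2)])
  moreover have "partial_deriv (Some i) f (event 0 x) = 0" if "x \<in> X" "\<forall>x\<in>X. f (event 0 x) = 0" for x
  proof -
    have "\<forall>\<^sub>F s in nhds 0. x + s *\<^sub>R axis i 1 \<in> X"
      by (rule eventually_line_in_open[OF assms that(1)])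
    then have "\<forall>\<^sub>F s in nhds 0. f (event 0 x + s *\<^sub>R axis (Some i) 1) = 0"
      by eventually_elim (use that(2) in \<open>simp add: event_add_space\<close>)
    then have "deriv (\<lambda>s. f (event 0 x + s *\<^sub>R axis (Some i) 1)) 0 = deriv (\<lambda>s. 0) 0"
      by (intro deriv_cong_ev) auto
    then show ?thesis by (simp add: partial_deriv_def)
  qed
  ultimately show ?case using Suc.prems by auto
qed simp

text \<open>Restricted to degree 0, the only degree that all powers, and hence an arbitrary
  \<open>V\<close>, preserve.\<close>

lemma graded_compose:
  "graded X k 0 f \<Longrightarrow> smooth_on S f \<Longrightarrow> real_analytic_on V UNIV \<Longrightarrow> graded X k 0 (\<lambda>q. V (f q))"
proof (induction k arbitrary: V)
  case (Suc k)
  note V = real_analytic_on_differentiable(2)[OF Suc.prems(3)]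
  have "graded X k (0 + 2) (\<lambda>q. deriv V (f q) * partial_deriv None f q)"
  proof (rule graded_mult)
    show "graded X k 0 (\<lambda>q. deriv V (f q))"
      by (rule Suc.IH[OF graded_Suc_imp[OF Suc.prems(1)] Suc.prems(2) V])
    show "graded X k 2 (partial_deriv None f)"
      using Suc.prems(1) by (simp add: numeral_2_eq_2)
  qed (intro smooth_on_compose[OF S Suc.prems(2) V] smooth_on_partial_deriv Suc.prems(2))+
  then have "graded X k (0 + 2) (partial_deriv None (\<lambda>q. V (f q)))"
    by (rule graded_cong[rotated]) (simp add: partial_deriv_compose[OF S Suc.prems(2,3)])
  then show ?case by simp
qed simp

text \<open>A time derivative of the equation replaces \<open>m\<close> by \<open>m + 2\<close>: the indicial factors are \<open>m + 2 j\<close>.\<close>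

lemma graded_fuchsian:
  "graded X k r Q \<Longrightarrow> smooth_on S y \<Longrightarrow> (\<And>j. m + 2 * real j \<noteq> 0) \<Longrightarrow>
    (\<And>p. p \<in> S \<Longrightarrow> 2 * time p * partial_deriv None y p + m * y p = Q p) \<Longrightarrow> graded X k r y"
proof (induction k arbitrary: r Q y m)
  case (Suc k)
  let ?T = "partial_deriv None"
  note sm = smooth_on_partial_deriv[OF Suc.prems(2), of None] Suc.prems(2)
  have eq: "2 * time p * ?T (?T y) p + (m + 2) * ?T y p = ?T Q p" if p: "p \<in> S" for p
  proof -
    have "?T Q p = ?T (\<lambda>p. 2 * (time p * ?T y p) + m * y p) p"
      using Suc.prems(4) by (intro partial_deriv_cong[OF S p]) (simp add: mult.assoc)
    also have "\<dots> = 2 * (?T y p + time p * ?T (?T y) p) + m * ?T y p"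
      using sm p smooth_on_time[OF S]
      by (simp add: partial_deriv_add[OF S] partial_deriv_cmult[OF S] partial_deriv_mult[OF S] smooth_on_intros[OF S])
    finally show ?thesis by (simp add: algebra_simps)
  qed
  have m: "m + 2 + 2 * real j \<noteq> 0" for j
    using Suc.prems(3)[of "Suc j"] by (simp add: algebra_simps)
  have "graded X k (r + 2) (?T y)"
    by (rule Suc.IH[of "r + 2" "?T Q" "?T y" "m + 2"]) (use Suc.prems sm m eq in auto)
  \<comment> \<open>At time 0 the equation reduces to m y = Q, and m is nonzero by the case j =
    0.\<close>
  moreover have "y (event 0 x) = 0" if "x \<in> X" "r mod 3 \<noteq> 0" for x
    using Suc.prems(4)[OF X[OF that(1)]] Suc.prems(1) Suc.prems(3)[of 0] that by auto
  ultimately show ?case by auto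
qed simp

end

section \<open>Behaviour along the time axis near time 0\<close>

lemma has_derivative_event:
  assumes "smooth_on S f" "event t x \<in> S"
  shows "((\<lambda>t. f (event t x)) has_real_derivative partial_deriv None f (event t x)) (at t)"
  using smooth_on_has_partial_deriv[OF assms, of None] DERIV_shift[of "\<lambda>t. f (event t x)" _ 0 t]
  by (simp add: event_add_time add.commute)

lemma eventually_event_in_open:
  assumes "open S" "event 0 x \<in> S"
  obtains d where "d > 0" "\<And>t. \<bar>t\<bar> < d \<Longrightarrow> event t x \<in> S"
proof -
  have "\<forall>\<^sub>F s in nhds 0. event 0 x + s *\<^sub>R axis None 1 \<in> S"
    by (rule eventually_line_in_open[OF assms])
  then show thesis
    using that unfolding eventually_nhds_metric by (auto simp: event_add_time dist_real_def)
qed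

text \<open>Induction on the order of the nonvanishing derivative: if the value at 0 vanishes, the
  mean value theorem writes f(t) as t times a value of f' strictly between 0 and t, which is nonzero
  by the induction hypothesis.\<close>

lemma eventually_nonzero_of_derivative_nonzero:
  assumes S: "open S" and "smooth_on S f" "event 0 x \<in> S" "(partial_deriv None ^^ m) f (event 0 x) \<noteq> 0"
  shows "\<exists>d>0. \<forall>t. t \<noteq> 0 \<longrightarrow> \<bar>t\<bar> < d \<longrightarrow> f (event t x) \<noteq> 0"
  using assms(2-)
proof (induction m arbitrary: f)
  case 0
  have "isCont (\<lambda>t. f (event t x)) 0"
    using has_derivative_event[OF 0(1,2)] DERIV_isCont by blast
  then have "\<forall>\<^sub>F t in nhds 0. f (event t x) \<noteq> 0"
    using 0(3) by (auto simp: continuous_at_imp_continuous_within tendsto_imp_eventually_ne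
      isCont_def eventually_nhds_conv_at)
  then show ?case unfolding eventually_nhds_metric by (auto simp: dist_real_def)
next
  case (Suc m)
  let ?g = "partial_deriv None f"
  have "(partial_deriv None ^^ m) ?g (event 0 x) \<noteq> 0"
    using Suc.prems(3) by (simp add: funpow_swap1)
  from Suc.IH[OF smooth_on_partial_deriv[OF Suc.prems(1)] Suc.prems(2) this]
  obtain d1 where d1: "d1 > 0" "\<And>t. t \<noteq> 0 \<Longrightarrow> \<bar>t\<bar> < d1 \<Longrightarrow> ?g (event t x) \<noteq> 0" by auto
  obtain d2 where d2: "d2 > 0" "\<And>t. \<bar>t\<bar> < d2 \<Longrightarrow> event t x \<in> S"
    using eventually_event_in_open[OF S Suc.prems(2)] by blast
  note der = has_derivative_event[OF Suc.prems(1) d2(2)]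
  show ?case
  proof (cases "f (event 0 x) = 0")
    case False
    have "isCont (\<lambda>t. f (event t x)) 0"
      using der[of 0] d2(1) DERIV_isCont by auto
    then have "\<forall>\<^sub>F t in nhds 0. f (event t x) \<noteq> 0"
      using False by (auto simp: tendsto_imp_eventually_ne isCont_def eventually_nhds_conv_at)
    then show ?thesis unfolding eventually_nhds_metric by (auto simp: dist_real_def)
  next
    case True
    have "f (event t x) \<noteq> 0" if t: "t \<noteq> 0" "\<bar>t\<bar> < min d1 d2" for t
    proof -
      consider "t > 0" | "t < 0" using t by linarith
      then show ?thesis
      proof cases
        case 1
        have "\<exists>z>0. z < t \<and> f (event t x) - f (event 0 x) = (t - 0) * ?g (event z x)"
          using t 1 by (intro MVT2 der) auto
        then show ?thesis using True d1(2) t 1 by auto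
      next
        case 2
        have "\<exists>z>t. z < 0 \<and> f (event 0 x) - f (event t x) = (0 - t) * ?g (event z x)"
          using t 2 by (intro MVT2 der) auto
        then show ?thesis using True d1(2) t 2 by auto
      qed
    qed
    then show ?thesis using d1(1) d2(1) by (intro exI[of _ "min d1 d2"]) auto
  qed
qed

text \<open>Two factors that are not flat would both be nonzero for all small t other than 0. For
  functions that are merely smooth this replaces the absence of zero divisors among power
  series.\<close>

lemma flat_or_flat:
  assumes S: "open S" and u: "smooth_on S u" and w: "smooth_on S w" and x: "event 0 x \<in> S"
    and uw: "\<And>p. p \<in> S \<Longrightarrow> time p \<noteq> 0 \<Longrightarrow> u p * w p = 0"
  shows "(\<forall>j. (partial_deriv None ^^ j) u (event 0 x) = 0) \<or> (\<forall>j. (partial_deriv None ^^ j) w (event 0 x) = 0)"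
proof (rule ccontr)
  assume "\<not> ?thesis"
  then obtain i j where "(partial_deriv None ^^ i) u (event 0 x) \<noteq> 0" "(partial_deriv None ^^ j) w (event 0 x) \<noteq> 0"
    by blast
  then obtain d1 d2 where d: "d1 > 0" "\<And>t. t \<noteq> 0 \<Longrightarrow> \<bar>t\<bar> < d1 \<Longrightarrow> u (event t x) \<noteq> 0"
      "d2 > 0" "\<And>t. t \<noteq> 0 \<Longrightarrow> \<bar>t\<bar> < d2 \<Longrightarrow> w (event t x) \<noteq> 0"
    using eventually_nonzero_of_derivative_nonzero[OF S u x] eventually_nonzero_of_derivative_nonzero[OF S w x] by meson
  obtain d3 where d3: "d3 > 0" "\<And>t. \<bar>t\<bar> < d3 \<Longrightarrow> event t x \<in> S"
    using eventually_event_in_open[OF S x] by blast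
  define t where "t = min d1 (min d2 d3) / 2"
  have "t > 0" "t < d1" "t < d2" "t < d3" using d d3 by (auto simp: t_def)
  then show False using uw[of "event t x"] d(2)[of t] d(4)[of t] d3(2)[of t] by auto
qed

text \<open>Points of time 0 are limits along the time axis of points off it. This carries equations
  across the slice on which the metric degenerates.\<close>

lemma eq_on_by_continuity:
  fixes f g :: "spacetime \<Rightarrow> real"
  assumes S: "open S" and f: "continuous_on S f" and g: "continuous_on S g"
    and eq: "\<And>p. p \<in> S \<Longrightarrow> time p \<noteq> 0 \<Longrightarrow> f p = g p" and p: "p \<in> S"
  shows "f p = g p"
proof (cases "time p = 0")
  case True
  define c where "c s = p + s *\<^sub>R axis None 1" for s :: real
  have c: "(c \<longlongrightarrow> p) (at 0)"
    unfolding c_def by (auto intro!: tendsto_eq_intros)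
  have "\<forall>\<^sub>F s in at 0. c s \<in> S"
    using eventually_line_in_open[OF S p, of "axis None 1"] unfolding c_def eventually_nhds_conv_at by blast
  moreover have "\<forall>\<^sub>F s in at 0. s \<noteq> (0::real)"
    by (simp add: eventually_at_filter)
  ultimately have ev: "\<forall>\<^sub>F s in at 0. f (c s) = g (c s)"
    by eventually_elim (auto intro!: eq simp: c_def True)
  have "isCont f p" "isCont g p"
    using S f g p by (auto simp: continuous_on_eq_continuous_at)
  then have lim: "((\<lambda>s. f (c s)) \<longlongrightarrow> f p) (at 0)" "((\<lambda>s. g (c s)) \<longlongrightarrow> g p) (at 0)"
    using c by (auto intro: isCont_tendsto_compose)
  from lim(1) have "((\<lambda>s. g (c s)) \<longlongrightarrow> f p) (at 0)"
    by (rule tendsto_cong[OF ev, THEN iffD1])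
  then show ?thesis using lim(2) tendsto_unique[of "at (0::real)"] by auto
qed (use eq p in blast)

section \<open>Curvature of a metric in split form\<close>

lemma split_form_nth [simp]:
  "split_form n h $ None $ None = n" "split_form n h $ None $ Some j = 0"
  "split_form n h $ Some i $ None = 0" "split_form n h $ Some i $ Some j = h $ i $ j"
  by (simp_all add: split_form_def)

lemma split_form_matrix_mult: "split_form n h ** split_form n' h' = split_form (n * n') (h ** h')"
  by (simp add: vec_eq_iff all_option matrix_matrix_mult_def sum_option)

lemma split_form_mat_1: "split_form 1 (mat 1) = mat 1"
  by (simp add: vec_eq_iff all_option mat_def)

lemma matrix_inv_mult:
  assumes "invertible A"
  shows "A ** matrix_inv A = mat 1" "matrix_inv A ** A = mat 1"
  using someI_ex[of "\<lambda>B. A ** B = mat 1 \<and> B ** A = mat 1"] assms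
  by (auto simp: invertible_def matrix_inv_def)

lemma matrix_inv_eqI:
  fixes A :: "real^'n^'n"
  assumes "A ** B = mat 1" shows "matrix_inv A = B"
proof -
  have BA: "B ** A = mat 1" using assms by (simp add: matrix_left_right_inverse)
  then have "invertible A" using assms invertible_def by blast
  then have "A ** matrix_inv A = mat 1" by (rule matrix_inv_mult)
  then have "(B ** A) ** matrix_inv A = B" by (simp add: matrix_mul_assoc[symmetric])
  then show ?thesis by (simp add: BA)
qed

lemma matrix_inv_split_form:
  assumes "n \<noteq> 0" "invertible h"
  shows "matrix_inv (split_form n h) = split_form (1 / n) (matrix_inv h)"
  by (rule matrix_inv_eqI) (simp add: split_form_matrix_mult assms matrix_inv_mult split_form_mat_1)

lemma partial_deriv_Some_of_time [simp]: "partial_deriv (Some i) (\<lambda>q. u (time q)) p = 0"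
  by (simp add: partial_deriv_def)

definition space_christoffel :: "(spacetime \<Rightarrow> real^3^3) \<Rightarrow> 3 \<Rightarrow> 3 \<Rightarrow> 3 \<Rightarrow> spacetime \<Rightarrow> real" where
  "space_christoffel h k i j p = (1/2) * (\<Sum>l\<in>UNIV. matrix_inv (h p) $ k $ l *
     (partial_deriv (Some i) (\<lambda>q. h q $ l $ j) p + partial_deriv (Some j) (\<lambda>q. h q $ l $ i) p
       - partial_deriv (Some l) (\<lambda>q. h q $ i $ j) p))"

text \<open>The Weingarten map of the time slices, up to the lapse.\<close>

definition shape :: "(spacetime \<Rightarrow> real^3^3) \<Rightarrow> 3 \<Rightarrow> 3 \<Rightarrow> spacetime \<Rightarrow> real" where
  "shape h i j p = (1/2) * (\<Sum>l\<in>UNIV. matrix_inv (h p) $ i $ l * partial_deriv None (\<lambda>q. h q $ l $ j) p)"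

text \<open>The Christoffel symbols with upper index t and spatial lower indices: the second
  fundamental form of the slices up to normalization.\<close>

definition second_form :: "(real \<Rightarrow> real) \<Rightarrow> (spacetime \<Rightarrow> real^3^3) \<Rightarrow> 3 \<Rightarrow> 3 \<Rightarrow> spacetime \<Rightarrow> real" where
  "second_form n h i j p = - (1/2) * (1 / n (time p)) * partial_deriv None (\<lambda>q. h q $ i $ j) p"

text \<open>The Christoffel symbol with all indices t. It is the logarithmic derivative of the
  lapse, the square root of |n|.\<close>

definition lapse_log_deriv :: "(real \<Rightarrow> real) \<Rightarrow> spacetime \<Rightarrow> real" where
  "lapse_log_deriv n p = (1/2) * (1 / n (time p)) * partial_deriv None (\<lambda>q. n (time q)) p"

definition space_ricci :: "(spacetime \<Rightarrow> real^3^3) \<Rightarrow> 3 \<Rightarrow> 3 \<Rightarrow> spacetime \<Rightarrow> real" where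
  "space_ricci h i j p =
     (\<Sum>k\<in>UNIV. partial_deriv (Some k) (space_christoffel h k i j) p - partial_deriv (Some j) (space_christoffel h k i k) p)
     + (\<Sum>k\<in>UNIV. \<Sum>l\<in>UNIV. space_christoffel h k k l p * space_christoffel h l i j p
          - space_christoffel h k j l p * space_christoffel h l i k p)"

context
  fixes S :: "spacetime set" and g :: "(3 option) tensor2" and n :: "real \<Rightarrow> real" and h :: "spacetime \<Rightarrow> real^3^3"
  assumes S: "open S" and g: "\<And>q. q \<in> S \<Longrightarrow> g q = split_form (n (time q)) (h q)"
    and n: "\<And>q. q \<in> S \<Longrightarrow> n (time q) \<noteq> 0" and h: "\<And>q. q \<in> S \<Longrightarrow> invertible (h q)"
begin

lemma partial_deriv_split_form:
  assumes "p \<in> S"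
  shows "partial_deriv a (\<lambda>q. g q $ Some i $ Some j) p = partial_deriv a (\<lambda>q. h q $ i $ j) p"
    "partial_deriv a (\<lambda>q. g q $ None $ None) p = partial_deriv a (\<lambda>q. n (time q)) p"
    "partial_deriv a (\<lambda>q. g q $ None $ Some j) p = 0"
    "partial_deriv a (\<lambda>q. g q $ Some i $ None) p = 0"
proof -
  have "partial_deriv a (\<lambda>q. g q $ x $ y) p = partial_deriv a (\<lambda>q. split_form (n (time q)) (h q) $ x $ y) p" for x y
    by (rule partial_deriv_cong[OF S assms]) (simp add: g)
  then show "partial_deriv a (\<lambda>q. g q $ Some i $ Some j) p = partial_deriv a (\<lambda>q. h q $ i $ j) p"
    "partial_deriv a (\<lambda>q. g q $ None $ None) p = partial_deriv a (\<lambda>q. n (time q)) p"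
    "partial_deriv a (\<lambda>q. g q $ None $ Some j) p = 0"
    "partial_deriv a (\<lambda>q. g q $ Some i $ None) p = 0"
    by simp_all
qed

lemma christoffel_split_form:
  assumes "p \<in> S"
  shows "christoffel g None None None p = lapse_log_deriv n p"
    "christoffel g None None (Some i) p = 0"
    "christoffel g None (Some i) None p = 0"
    "christoffel g None (Some i) (Some j) p = second_form n h i j p"
    "christoffel g (Some k) None None p = 0"
    "christoffel g (Some k) None (Some j) p = shape h k j p"
    "christoffel g (Some k) (Some j) None p = shape h k j p"
    "christoffel g (Some k) (Some i) (Some j) p = space_christoffel h k i j p"
proof -
  have inv: "matrix_inv (g p) = split_form (1 / n (time p)) (matrix_inv (h p))"
    using assms by (simp add: g n h matrix_inv_split_form)
  note [simp] = partial_deriv_split_form[OF assms] sum_option inv christoffel_def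
    lapse_log_deriv_def second_form_def shape_def space_christoffel_def
  show "christoffel g None None None p = lapse_log_deriv n p"
    "christoffel g None None (Some i) p = 0"
    "christoffel g None (Some i) None p = 0"
    "christoffel g None (Some i) (Some j) p = second_form n h i j p"
    "christoffel g (Some k) None None p = 0"
    "christoffel g (Some k) None (Some j) p = shape h k j p"
    "christoffel g (Some k) (Some j) None p = shape h k j p"
    "christoffel g (Some k) (Some i) (Some j) p = space_christoffel h k i j p"
    by simp_all
qed

lemma partial_deriv_christoffel_split_form:
  assumes "p \<in> S"
  shows "partial_deriv a (christoffel g None None None) p = partial_deriv a (lapse_log_deriv n) p"
    "partial_deriv a (christoffel g None None (Some i)) p = 0"
    "partial_deriv a (christoffel g None (Some i) None) p = 0"
    "partial_deriv a (christoffel g None (Some i) (Some j)) p = partial_deriv a (second_form n h i j) p"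
    "partial_deriv a (christoffel g (Some k) None None) p = 0"
    "partial_deriv a (christoffel g (Some k) None (Some j)) p = partial_deriv a (shape h k j) p"
    "partial_deriv a (christoffel g (Some k) (Some j) None) p = partial_deriv a (shape h k j) p"
    "partial_deriv a (christoffel g (Some k) (Some i) (Some j)) p = partial_deriv a (space_christoffel h k i j) p"
  using partial_deriv_cong[OF S assms christoffel_split_form(1), where a=a]
    partial_deriv_cong[OF S assms christoffel_split_form(2), where a=a]
    partial_deriv_cong[OF S assms christoffel_split_form(3), where a=a]
    partial_deriv_cong[OF S assms christoffel_split_form(4), where a=a]
    partial_deriv_cong[OF S assms christoffel_split_form(5), where a=a]
    partial_deriv_cong[OF S assms christoffel_split_form(6), where a=a]
    partial_deriv_cong[OF S assms christoffel_split_form(7), where a=a]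
    partial_deriv_cong[OF S assms christoffel_split_form(8), where a=a]
  by simp_all

lemma partial_deriv_lapse_log_deriv: "partial_deriv (Some i) (lapse_log_deriv n) p = 0"
proof -
  have "lapse_log_deriv n = (\<lambda>q. (1/2) * (1 / n (time q)) * deriv (\<lambda>s. n (time q + s)) 0)"
    by (simp add: lapse_log_deriv_def[abs_def] partial_deriv_def)
  then show ?thesis
    using partial_deriv_Some_of_time[of i "\<lambda>t. (1/2) * (1 / n t) * deriv (\<lambda>s. n (t + s)) 0" p] by simp
qed

text \<open>The Gauss-Codazzi splitting. Both mixed components are listed because the defining
  formula of \<open>ricci\<close> is not visibly symmetric: one contains the spatial derivative of
  the trace of \<open>shape\<close>, the other the time derivative of the contracted spatial
  Christoffel symbols. The latter fits the variation of the spatial curvature.\<close>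

lemma ricci_split_form:
  assumes "p \<in> S"
  shows "ricci g p $ None $ None = - (\<Sum>i\<in>UNIV. partial_deriv None (shape h i i) p)
      + lapse_log_deriv n p * (\<Sum>i\<in>UNIV. shape h i i p) - (\<Sum>i\<in>UNIV. \<Sum>j\<in>UNIV. shape h i j p * shape h j i p)"
    and "ricci g p $ None $ Some i = (\<Sum>j\<in>UNIV. partial_deriv (Some j) (shape h j i) p - partial_deriv (Some i) (shape h j j) p)
      + (\<Sum>k\<in>UNIV. \<Sum>j\<in>UNIV. space_christoffel h k k j p * shape h j i p - space_christoffel h k i j p * shape h j k p)"
    and "ricci g p $ Some i $ None = (\<Sum>j\<in>UNIV. partial_deriv (Some j) (shape h j i) p - partial_deriv None (space_christoffel h j i j) p)
      + (\<Sum>k\<in>UNIV. \<Sum>j\<in>UNIV. space_christoffel h k k j p * shape h j i p - shape h k j p * space_christoffel h j i k p)"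
    and "ricci g p $ Some i $ Some j = partial_deriv None (second_form n h i j) p
      + (lapse_log_deriv n p + (\<Sum>k\<in>UNIV. shape h k k p)) * second_form n h i j p
      - (\<Sum>k\<in>UNIV. second_form n h j k p * shape h k i p) - (\<Sum>k\<in>UNIV. shape h k j p * second_form n h i k p)
      + space_ricci h i j p"
  by (simp_all add: ricci_def sum_option christoffel_split_form[OF assms] partial_deriv_christoffel_split_form[OF assms]
      partial_deriv_lapse_log_deriv space_ricci_def sum.distrib sum_subtractf sum_negf sum_distrib_right sum_distrib_left algebra_simps)

end

section \<open>Smoothness of the geometric quantities\<close>

text \<open>Cramer's rule, which reduces the smoothness of the inverse to that of
  determinants.\<close>

lemma matrix_inv_nth:
  fixes A :: "real^'n^'n"
  assumes "invertible A"
  shows "matrix_inv A $ i $ j = det (\<chi> k l. if l = i then axis j 1 $ k else A $ k $ l) / det A"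
proof -
  have *: "A *v (matrix_inv A *v axis j 1) = axis j 1"
    using matrix_inv_mult(1)[OF assms] by (simp add: matrix_vector_mul_assoc)
  have "det (\<chi> k l. if l = i then axis j 1 $ k else A $ k $ l) = (matrix_inv A *v axis j 1) $ i * det A"
    using cramer_lemma[where A=A and x="matrix_inv A *v axis j 1" and k=i] unfolding * .
  moreover have "(matrix_inv A *v axis j 1) $ i = matrix_inv A $ i $ j"
    by (simp add: matrix_vector_mult_basis column_def)
  ultimately show ?thesis
    using assms by (simp add: invertible_det_nz)
qed

lemma smooth_on_det:
  fixes A :: "real^'m \<Rightarrow> real^'n^'n"
  assumes "open S" "\<And>i j. smooth_on S (\<lambda>q. A q $ i $ j)"
  shows "smooth_on S (\<lambda>q. det (A q))"
  unfolding det_def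
  by (intro smooth_on_sum smooth_on_mult smooth_on_const smooth_on_prod assms)

lemma smooth_on_matrix_inv:
  fixes A :: "real^'m \<Rightarrow> real^'n^'n"
  assumes S: "open S" and A: "\<And>i j. smooth_on S (\<lambda>q. A q $ i $ j)" and inv: "\<And>q. q \<in> S \<Longrightarrow> invertible (A q)"
  shows "smooth_on S (\<lambda>q. matrix_inv (A q) $ i $ j)"
proof (rule smooth_on_cong[OF S])
  show "det (\<chi> k l. if l = i then axis j 1 $ k else A q $ k $ l) / det (A q) = matrix_inv (A q) $ i $ j"
    if "q \<in> S" for q
    using matrix_inv_nth[OF inv[OF that]] by simp
  have "smooth_on S (\<lambda>q. (\<chi> k l. if l = i then axis j 1 $ k else A q $ k $ l) $ k $ l)" for k l
    by (cases "l = i") (simp_all add: A smooth_on_const)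
  then show "smooth_on S (\<lambda>q. det (\<chi> k l. if l = i then axis j 1 $ k else A q $ k $ l) / det (A q))"
    using inv by (intro smooth_on_divide smooth_on_det S A) (auto simp: invertible_det_nz)
qed

context
  fixes S :: "spacetime set" and h :: "spacetime \<Rightarrow> real^3^3"
  assumes S: "open S" and h: "\<And>i j. smooth_on S (\<lambda>q. h q $ i $ j)" and inv: "\<And>q. q \<in> S \<Longrightarrow> invertible (h q)"
begin

lemma smooth_on_shape: "smooth_on S (shape h i j)"
  unfolding shape_def[abs_def]
  by (intro smooth_on_intros[OF S] smooth_on_matrix_inv[OF S] h inv)

lemma smooth_on_space_christoffel: "smooth_on S (space_christoffel h k i j)"
  unfolding space_christoffel_def[abs_def]
  by (intro smooth_on_intros[OF S] smooth_on_matrix_inv[OF S] h inv)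

lemma smooth_on_space_ricci: "smooth_on S (space_ricci h i j)"
  unfolding space_ricci_def[abs_def]
  by (intro smooth_on_intros[OF S] smooth_on_space_christoffel)

end


section \<open>Reparametrization of time\<close>

definition retime :: "(real \<Rightarrow> real) \<Rightarrow> spacetime \<Rightarrow> spacetime" where
  "retime c q = event (c (time q)) (space_part q)"

lemma time_retime [simp]: "time (retime c q) = c (time q)"
  and space_part_retime [simp]: "space_part (retime c q) = space_part q"
  by (simp_all add: retime_def)

lemma retime_add_space: "retime c (q + s *\<^sub>R axis (Some i) 1) = retime c q + s *\<^sub>R axis (Some i) 1"
  by (simp add: retime_def event_add_space)

lemma partial_deriv_Some_retime: "partial_deriv (Some i) (\<lambda>q. f (retime c q)) q = partial_deriv (Some i) f (retime c q)"
  by (simp add: partial_deriv_def retime_add_space)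

lemma has_derivative_retime:
  assumes f: "differentiable_along None f (retime c q)" and c: "(c has_real_derivative D) (at (time q))"
  shows "((\<lambda>s. f (retime c (q + s *\<^sub>R axis None 1))) has_real_derivative D * partial_deriv None f (retime c q)) (at 0)"
proof -
  have c': "((\<lambda>s. c (time q + s) - c (time q)) has_real_derivative D) (at 0)"
    using c DERIV_shift[of c D 0 "time q"] by (auto simp: add.commute intro!: derivative_eq_intros)
  have "((\<lambda>s. f (retime c q + s *\<^sub>R axis None 1)) has_real_derivative partial_deriv None f (retime c q))
      (at (c (time q + 0) - c (time q)))"
    using has_partial_deriv[OF f] by simp
  from DERIV_chain2[OF this c']
  have "((\<lambda>s. f (retime c q + (c (time q + s) - c (time q)) *\<^sub>R axis None 1)) has_real_derivative
      partial_deriv None f (retime c q) * D) (at 0)" .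
  moreover have "retime c q + (c (time q + s) - c (time q)) *\<^sub>R axis None 1 = retime c (q + s *\<^sub>R axis None 1)" for s
    by (simp add: retime_def event_add_time)
  ultimately show ?thesis
    by (simp add: mult.commute)
qed

lemma partial_deriv_None_retime:
  "differentiable_along None f (retime c q) \<Longrightarrow> (c has_real_derivative D) (at (time q)) \<Longrightarrow>
    partial_deriv None (\<lambda>q. f (retime c q)) q = D * partial_deriv None f (retime c q)"
  by (rule partial_derivI) (rule has_derivative_retime)

text \<open>The new metric is \<open>n' dt\<^sup>2 + h \<circ> c\<close> with \<open>n' = c'\<^sup>2 (n \<circ> c)\<close> locally constant; the last equation on
  \<open>c''\<close> is the derivative of this condition.\<close>

context
  fixes S S' :: "spacetime set" and g g' :: "(3 option) tensor2" and n n' c dc :: "real \<Rightarrow> real" and h :: "spacetime \<Rightarrow> real^3^3"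
  assumes S: "open S" and S': "open S'" and S'S: "\<And>q. q \<in> S' \<Longrightarrow> retime c q \<in> S"
    and g: "\<And>q. q \<in> S \<Longrightarrow> g q = split_form (n (time q)) (h q)"
    and g': "\<And>q. q \<in> S' \<Longrightarrow> g' q = split_form (n' (time q)) (h (retime c q))"
    and n: "\<And>q. q \<in> S \<Longrightarrow> n (time q) \<noteq> 0" and inv: "\<And>q. q \<in> S \<Longrightarrow> invertible (h q)"
    and h: "\<And>i j. smooth_on S (\<lambda>q. h q $ i $ j)"
    and c: "\<And>q. q \<in> S' \<Longrightarrow> (c has_real_derivative dc (time q)) (at (time q))" "\<And>q. q \<in> S' \<Longrightarrow> dc (time q) \<noteq> 0"
    and dc: "\<And>q. q \<in> S' \<Longrightarrow> (dc has_real_derivative - (dc (time q))\<^sup>2 * lapse_log_deriv n (retime c q)) (at (time q))"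
    and n': "\<And>q. q \<in> S' \<Longrightarrow> n' (time q) = (dc (time q))\<^sup>2 * n (c (time q))"
      "\<And>q. q \<in> S' \<Longrightarrow> lapse_log_deriv n' q = 0"
    and second_form: "\<And>i j. smooth_on S (second_form n h i j)"
begin

definition jacobian_factor :: "3 option \<Rightarrow> spacetime \<Rightarrow> real" where
  "jacobian_factor a q = (case a of None \<Rightarrow> dc (time q) | Some _ \<Rightarrow> 1)"

lemma partial_deriv_retime:
  assumes "smooth_on S f" "q \<in> S'"
  shows "partial_deriv a (\<lambda>q. f (retime c q)) q = jacobian_factor a q * partial_deriv a f (retime c q)"
  using partial_deriv_None_retime[OF smooth_on_differentiable[OF assms(1) S'S[OF assms(2)]] c(1)[OF assms(2)]]
  by (cases a) (simp_all add: jacobian_factor_def partial_deriv_Some_retime)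

lemma shape_retime:
  assumes q: "q \<in> S'"
  shows "shape (\<lambda>q. h (retime c q)) i j q = dc (time q) * shape h i j (retime c q)"
  using partial_deriv_retime[OF h q, of None] by (simp add: shape_def jacobian_factor_def sum_distrib_left mult_ac)

lemma space_christoffel_retime:
  "space_christoffel (\<lambda>q. h (retime c q)) k i j q = space_christoffel h k i j (retime c q)"
  by (simp add: space_christoffel_def partial_deriv_Some_retime[of _ "\<lambda>q. h q $ _ $ _"])

lemma second_form_retime:
  assumes q: "q \<in> S'"
  shows "second_form n' (\<lambda>q. h (retime c q)) i j q = inverse (dc (time q)) * second_form n h i j (retime c q)"
  using partial_deriv_retime[OF h q, of None] c(2)[OF q] n(1)[OF S'S[OF q]]
  by (simp add: second_form_def jacobian_factor_def n'[OF q] field_simps power2_eq_square)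

lemma has_derivative_of_time:
  "(u has_real_derivative D) (at (time q)) \<Longrightarrow> ((\<lambda>s. u (time (q + s *\<^sub>R axis None 1))) has_real_derivative D) (at 0)"
  using DERIV_shift[of u D 0 "time q"] by (simp add: add.commute)

lemma partial_deriv_shape_retime:
  assumes q: "q \<in> S'"
  shows "partial_deriv None (shape (\<lambda>q. h (retime c q)) i j) q
      = (dc (time q))\<^sup>2 * (partial_deriv None (shape h i j) (retime c q) - lapse_log_deriv n (retime c q) * shape h i j (retime c q))"
    and "partial_deriv (Some k) (shape (\<lambda>q. h (retime c q)) i j) q = dc (time q) * partial_deriv (Some k) (shape h i j) (retime c q)"
proof -
  note sm = smooth_on_shape[OF S h inv]
  have eq: "partial_deriv a (shape (\<lambda>q. h (retime c q)) i j) q = partial_deriv a (\<lambda>q. dc (time q) * shape h i j (retime c q)) q" for a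
    by (rule partial_deriv_cong[OF S' q]) (rule shape_retime)
  show "partial_deriv None (shape (\<lambda>q. h (retime c q)) i j) q
      = (dc (time q))\<^sup>2 * (partial_deriv None (shape h i j) (retime c q) - lapse_log_deriv n (retime c q) * shape h i j (retime c q))"
    unfolding eq
    by (rule partial_derivI)
      (rule DERIV_cong[OF DERIV_mult[OF has_derivative_of_time[OF dc[OF q]] has_derivative_retime[OF smooth_on_differentiable[OF sm S'S[OF q]] c(1)[OF q]]]],
       simp_all add: power2_eq_square algebra_simps)
  show "partial_deriv (Some k) (shape (\<lambda>q. h (retime c q)) i j) q = dc (time q) * partial_deriv (Some k) (shape h i j) (retime c q)"
    unfolding eq
    by (rule partial_derivI)
      (use DERIV_cmult[OF smooth_on_has_partial_deriv[OF sm S'S[OF q], where a="Some k"]] in \<open>simp add: retime_add_space\<close>)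
qed

lemma partial_deriv_second_form_retime:
  assumes q: "q \<in> S'"
  shows "partial_deriv None (second_form n' (\<lambda>q. h (retime c q)) i j) q
    = partial_deriv None (second_form n h i j) (retime c q) + lapse_log_deriv n (retime c q) * second_form n h i j (retime c q)"
proof -
  have eq: "partial_deriv None (second_form n' (\<lambda>q. h (retime c q)) i j) q
      = partial_deriv None (\<lambda>q. inverse (dc (time q)) * second_form n h i j (retime c q)) q"
    by (rule partial_deriv_cong[OF S' q]) (rule second_form_retime)
  have ne: "dc (time (q + 0 *\<^sub>R axis None 1)) \<noteq> 0" using c(2)[OF q] by simp
  show ?thesis
    unfolding eq
    by (rule partial_derivI)
      (rule DERIV_cong[OF DERIV_mult[OF DERIV_inverse'[OF has_derivative_of_time[OF dc[OF q]] ne] has_derivative_retime[OF smooth_on_differentiable[OF second_form S'S[OF q]] c(1)[OF q]]]],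
       use c(2)[OF q] in \<open>simp add: power2_eq_square field_simps\<close>)
qed

lemma partial_deriv_space_christoffel_retime:
  assumes q: "q \<in> S'"
  shows "partial_deriv a (space_christoffel (\<lambda>q. h (retime c q)) k i j) q
    = jacobian_factor a q * partial_deriv a (space_christoffel h k i j) (retime c q)"
  using partial_deriv_retime[OF smooth_on_space_christoffel[OF S h inv] q]
  by (simp add: space_christoffel_retime[abs_def])

lemma invertible_retime: "q \<in> S' \<Longrightarrow> invertible (h (retime c q))"
  using S'S inv by blast

lemma n'_nonzero: "q \<in> S' \<Longrightarrow> n' (time q) \<noteq> 0"
  using n'(1) c(2) n[OF S'S] by simp

text \<open>Checked component by component: \<open>shape\<close> scales by c',
  \<open>second_form\<close> by 1/c', spatial quantities not at all. The terms with c'' account for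
  \<open>lapse_log_deriv n\<close>, whose counterpart for \<open>n'\<close> is 0.\<close>

lemma ricci_retime:
  assumes q: "q \<in> S'"
  shows "ricci g' q $ a $ b = jacobian_factor a q * jacobian_factor b q * ricci g (retime c q) $ a $ b"
proof -
  note q' = S'S[OF q]
  note R = ricci_split_form[where S=S and n=n and h=h, OF S g n inv q']
  note R' = ricci_split_form[where S=S' and n=n' and h="\<lambda>q. h (retime c q)", OF S' g' n'_nonzero invertible_retime q]
  have ric: "space_ricci (\<lambda>q. h (retime c q)) i j q = space_ricci h i j (retime c q)" for i j
    by (simp add: space_ricci_def partial_deriv_space_christoffel_retime[OF q] space_christoffel_retime jacobian_factor_def)
  note [simp] = shape_retime[OF q] space_christoffel_retime second_form_retime[OF q] partial_deriv_shape_retime[OF q]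
    partial_deriv_second_form_retime[OF q] partial_deriv_space_christoffel_retime[OF q] n'(2)[OF q] ric
  note ne = c(2)[OF q]
  consider "a = None" "b = None" | i where "a = None" "b = Some i" | i where "a = Some i" "b = None"
    | i j where "a = Some i" "b = Some j" by (cases a; cases b) auto
  then show ?thesis
  proof cases
    case 1
    then show ?thesis
      by (simp add: R R' jacobian_factor_def sum_distrib_left sum_subtractf power2_eq_square algebra_simps)
  next
    case 2
    then show ?thesis
      by (simp add: R R' jacobian_factor_def sum_distrib_left sum_subtractf power2_eq_square algebra_simps)
  next
    case 3
    then show ?thesis
      by (simp add: R R' jacobian_factor_def sum_distrib_left sum_subtractf power2_eq_square algebra_simps)
  next
    case 4
    have cancel: "dc (time q) * (inverse (dc (time q)) * x) = x" for x
      using ne by simp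
    show ?thesis
      using 4 by (simp add: cancel R R' jacobian_factor_def sum_distrib_left[symmetric] algebra_simps)
  qed
qed

lemma matrix_inv_retime:
  assumes q: "q \<in> S'"
  shows "matrix_inv (g' q) $ a $ b = matrix_inv (g (retime c q)) $ a $ b / (jacobian_factor a q * jacobian_factor b q)"
proof -
  note q' = S'S[OF q]
  have "matrix_inv (g' q) = split_form (1 / n' (time q)) (matrix_inv (h (retime c q)))"
    using q by (simp add: g' matrix_inv_split_form n'_nonzero invertible_retime)
  moreover have "matrix_inv (g (retime c q)) = split_form (1 / n (c (time q))) (matrix_inv (h (retime c q)))"
    using q' n[OF q'] inv[OF q'] by (simp add: g matrix_inv_split_form)
  ultimately show ?thesis
    using c(2)[OF q] by (cases a; cases b) (simp_all add: jacobian_factor_def n'(1)[OF q] power2_eq_square)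
qed

lemma metric_retime:
  assumes q: "q \<in> S'"
  shows "g' q $ a $ b = jacobian_factor a q * jacobian_factor b q * g (retime c q) $ a $ b"
  using S'S[OF q] q by (cases a; cases b) (simp_all add: g g' jacobian_factor_def n'(1) power2_eq_square)

lemma jacobian_factor_nonzero: "q \<in> S' \<Longrightarrow> jacobian_factor a q \<noteq> 0"
  using c(2) by (simp add: jacobian_factor_def split: option.split)

lemma scalar_curvature_retime:
  assumes q: "q \<in> S'"
  shows "scalar_curvature g' q = scalar_curvature g (retime c q)"
  unfolding scalar_curvature_def
  by (intro sum.cong refl) (simp add: matrix_inv_retime[OF q] ricci_retime[OF q] jacobian_factor_nonzero[OF q])

lemma energy_momentum_retime:
  assumes q: "q \<in> S'" and \<phi>: "smooth_on S \<phi>"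
  shows "energy_momentum V g' (\<lambda>q. \<phi> (retime c q)) q $ a $ b
    = jacobian_factor a q * jacobian_factor b q * energy_momentum V g \<phi> (retime c q) $ a $ b"
proof -
  let ?J = "\<lambda>a. jacobian_factor a q"
  have d: "partial_deriv a (\<lambda>q. \<phi> (retime c q)) q = ?J a * partial_deriv a \<phi> (retime c q)" for a
    by (rule partial_deriv_retime[OF \<phi> q])
  have gr: "grad g' (\<lambda>q. \<phi> (retime c q)) q $ a = grad g \<phi> (retime c q) $ a / ?J a" for a
    unfolding grad_def matrix_vector_mult_def
    by (simp add: matrix_inv_retime[OF q] d jacobian_factor_nonzero[OF q] sum_divide_distrib)
  have "grad g' (\<lambda>q. \<phi> (retime c q)) q \<bullet> (g' q *v grad g' (\<lambda>q. \<phi> (retime c q)) q)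
      = grad g \<phi> (retime c q) \<bullet> (g (retime c q) *v grad g \<phi> (retime c q))"
    unfolding inner_vec_def matrix_vector_mult_def
    by (intro sum.cong refl) (simp add: gr metric_retime[OF q] jacobian_factor_nonzero[OF q] sum_distrib_left)
  then show ?thesis
    by (simp add: energy_momentum_def d metric_retime[OF q] algebra_simps)
qed

lemma einstein_retime:
  assumes q: "q \<in> S'" and \<phi>: "smooth_on S \<phi>"
  shows "ricci g' q - (scalar_curvature g' q / 2) *\<^sub>R g' q = \<kappa> *\<^sub>R energy_momentum V g' (\<lambda>q. \<phi> (retime c q)) q \<longleftrightarrow>
    ricci g (retime c q) - (scalar_curvature g (retime c q) / 2) *\<^sub>R g (retime c q) = \<kappa> *\<^sub>R energy_momentum V g \<phi> (retime c q)"
proof -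
  have "(ricci g' q - (scalar_curvature g' q / 2) *\<^sub>R g' q - \<kappa> *\<^sub>R energy_momentum V g' (\<lambda>q. \<phi> (retime c q)) q) $ a $ b
    = jacobian_factor a q * jacobian_factor b q *
      (ricci g (retime c q) - (scalar_curvature g (retime c q) / 2) *\<^sub>R g (retime c q) - \<kappa> *\<^sub>R energy_momentum V g \<phi> (retime c q)) $ a $ b" for a b
    by (simp add: ricci_retime[OF q] scalar_curvature_retime[OF q] energy_momentum_retime[OF q \<phi>] metric_retime[OF q] algebra_simps)
  then have "ricci g' q - (scalar_curvature g' q / 2) *\<^sub>R g' q - \<kappa> *\<^sub>R energy_momentum V g' (\<lambda>q. \<phi> (retime c q)) q = 0 \<longleftrightarrow>
    ricci g (retime c q) - (scalar_curvature g (retime c q) / 2) *\<^sub>R g (retime c q) - \<kappa> *\<^sub>R energy_momentum V g \<phi> (retime c q) = 0"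
    by (simp add: vec_eq_iff jacobian_factor_nonzero[OF q] del: vector_minus_component)
  then show ?thesis by simp
qed

end

section \<open>From Einstein's equations to the Ricci tensor\<close>

text \<open>The trace in dimension 4 gives the scalar curvature as \<kappa> (N + 2 V), with
  \<open>N\<close> the squared gradient of \<phi>. Reinserting it eliminates both the scalar
  curvature and \<open>N\<close>, and with \<open>N\<close> the inverse metric, which has a pole at
  time 0.\<close>

lemma einstein_imp_ricci:
  fixes g :: "(3 option) tensor2"
  assumes sym: "transpose (g p) = g p" and inv: "invertible (g p)"
    and E: "ricci g p - (scalar_curvature g p / 2) *\<^sub>R g p = \<kappa> *\<^sub>R energy_momentum V g \<phi> p"
  shows "ricci g p $ a $ b = \<kappa> * (partial_deriv a \<phi> p * partial_deriv b \<phi> p + (1/2) * V (\<phi> p) * g p $ a $ b)"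
proof -
  define A where "A = matrix_inv (g p)"
  define d where "d = (\<chi> b. partial_deriv b \<phi> p)"
  define N where "N = grad g \<phi> p \<bullet> (g p *v grad g \<phi> p)"
  have gA: "g p ** A = mat 1" "A ** g p = mat 1" unfolding A_def by (rule matrix_inv_mult[OF inv])+
  have gs: "g p $ a $ b = g p $ b $ a" for a b
    by (subst (1) sym[symmetric]) (simp add: transpose_def)
  have grad: "grad g \<phi> p = A *v d" by (simp add: grad_def d_def A_def)
  then have "g p *v grad g \<phi> p = d"
    by (simp add: matrix_vector_mul_assoc gA)
  then have "N = (A *v d) \<bullet> d" by (simp add: N_def grad)
  then have N: "N = (\<Sum>a\<in>UNIV. \<Sum>b\<in>UNIV. A $ a $ b * (d $ a * d $ b))"
    by (simp add: inner_vec_def matrix_vector_mult_def sum_distrib_left sum_distrib_right mult_ac)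
  have "(A ** g p) $ a $ a = 1" for a by (simp add: gA mat_def)
  then have "(\<Sum>b\<in>UNIV. A $ a $ b * g p $ a $ b) = 1" for a
    unfolding matrix_matrix_mult_def by (simp add: gs[of a])
  \<comment> \<open>The dimension of spacetime, as the trace of the identity.\<close>
  then have tr: "(\<Sum>a\<in>UNIV. \<Sum>b\<in>UNIV. A $ a $ b * g p $ a $ b) = 4"
    by (simp add: card_UNIV_option)
  have T: "energy_momentum V g \<phi> p $ a $ b = d $ a * d $ b - (1/2) * (N + V (\<phi> p)) * g p $ a $ b" for a b
    by (simp add: energy_momentum_def N_def d_def)
  have E': "ricci g p $ a $ b = scalar_curvature g p / 2 * g p $ a $ b
      + \<kappa> * (d $ a * d $ b - (1/2) * (N + V (\<phi> p)) * g p $ a $ b)" for a b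
  proof -
    have "(ricci g p - (scalar_curvature g p / 2) *\<^sub>R g p) $ a $ b = (\<kappa> *\<^sub>R energy_momentum V g \<phi> p) $ a $ b"
      by (simp only: E)
    then show ?thesis by (simp add: T algebra_simps)
  qed
  define s where "s = scalar_curvature g p"
  have "s = (\<Sum>a\<in>UNIV. \<Sum>b\<in>UNIV. A $ a $ b * (s / 2 * g p $ a $ b
      + \<kappa> * (d $ a * d $ b - (1/2) * (N + V (\<phi> p)) * g p $ a $ b)))"
    by (subst (1) s_def, subst scalar_curvature_def) (simp add: E' A_def s_def)
  also have "\<dots> = (\<Sum>a\<in>UNIV. \<Sum>b\<in>UNIV. (s / 2 - \<kappa> * (1/2) * (N + V (\<phi> p))) * (A $ a $ b * g p $ a $ b)
      + \<kappa> * (A $ a $ b * (d $ a * d $ b)))"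
    by (intro sum.cong refl) (simp add: algebra_simps)
  also have "\<dots> = (s / 2 - \<kappa> * (1/2) * (N + V (\<phi> p))) * 4 + \<kappa> * N"
    by (simp only: sum.distrib sum_distrib_left[symmetric] tr N[symmetric])
  finally have "s = \<kappa> * (N + 2 * V (\<phi> p))" by (simp add: algebra_simps)
  then show ?thesis
    unfolding E' s_def[symmetric] by (simp add: d_def algebra_simps)
qed


section \<open>Evolution of the geometry of the time slices\<close>

abbreviation "dt \<equiv> partial_deriv (None :: 3 option)"
abbreviation "dx k \<equiv> partial_deriv (Some (k :: 3))"

text \<open>The slices are regular at all times of \<open>S\<close>, including 0: the degeneracy of
  the spacetime metric sits in the lapse alone.\<close>

locale slice_geometry =
  fixes S :: "spacetime set" and h :: "spacetime \<Rightarrow> real^3^3"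
  assumes S: "open S"
    and h_smooth: "\<And>i j. smooth_on S (\<lambda>q. h q $ i $ j)"
    and h_symmetric: "\<And>q. q \<in> S \<Longrightarrow> transpose (h q) = h q"
    and h_invertible: "\<And>q. q \<in> S \<Longrightarrow> invertible (h q)"
begin

abbreviation "H i j q \<equiv> matrix_inv (h q) $ i $ j"
abbreviation "L \<equiv> shape h"
abbreviation "G \<equiv> space_christoffel h"
abbreviation "R \<equiv> space_ricci h"

lemma H_smooth: "smooth_on S (\<lambda>q. H i j q)"
  by (rule smooth_on_matrix_inv[OF S h_smooth h_invertible])

lemma L_smooth: "smooth_on S (L i j)"
  by (rule smooth_on_shape[OF S h_smooth h_invertible])

lemma G_smooth: "smooth_on S (G k i j)"
  by (rule smooth_on_space_christoffel[OF S h_smooth h_invertible])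

lemma R_smooth: "smooth_on S (R i j)"
  by (rule smooth_on_space_ricci[OF S h_smooth h_invertible])

lemma h_sym: "q \<in> S \<Longrightarrow> h q $ i $ j = h q $ j $ i"
  by (subst (1) h_symmetric[symmetric]) (simp_all add: transpose_def)

lemma H_sym: assumes "q \<in> S" shows "H i j q = H j i q"
proof -
  have "h q ** matrix_inv (h q) = mat 1" by (rule matrix_inv_mult[OF h_invertible[OF assms]])
  then have "transpose (matrix_inv (h q)) ** h q = mat 1"
    using h_symmetric[OF assms] by (metis matrix_transpose_mul transpose_mat)
  then have "h q ** transpose (matrix_inv (h q)) = mat 1"
    by (simp add: matrix_left_right_inverse)
  then have "matrix_inv (h q) = transpose (matrix_inv (h q))" by (rule matrix_inv_eqI)
  then have "matrix_inv (h q) $ i $ j = transpose (matrix_inv (h q)) $ i $ j" by (rule arg_cong)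
  then show ?thesis by (simp add: transpose_def)
qed

lemma H_h: assumes "q \<in> S" shows "(\<Sum>k\<in>UNIV. H i k q * h q $ k $ j) = (if i = j then 1 else 0)"
proof -
  have "(matrix_inv (h q) ** h q) $ i $ j = mat 1 $ i $ j"
    by (simp only: matrix_inv_mult[OF h_invertible[OF assms]])
  then show ?thesis by (simp add: matrix_matrix_mult_def mat_def)
qed

lemma h_H: assumes "q \<in> S" shows "(\<Sum>k\<in>UNIV. h q $ i $ k * H k j q) = (if i = j then 1 else 0)"
proof -
  have "(h q ** matrix_inv (h q)) $ i $ j = mat 1 $ i $ j"
    by (simp only: matrix_inv_mult[OF h_invertible[OF assms]])
  then show ?thesis by (simp add: matrix_matrix_mult_def mat_def)
qed

lemma contract_delta:
  fixes x :: "3 \<Rightarrow> real"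
  assumes "\<And>j. (\<Sum>k\<in>UNIV. A k * B k j) = (if i = j then 1 else 0)"
  shows "(\<Sum>k\<in>UNIV. A k * (\<Sum>l\<in>UNIV. B k l * x l)) = x i"
proof -
  have "(\<Sum>k\<in>UNIV. A k * (\<Sum>l\<in>UNIV. B k l * x l)) = (\<Sum>l\<in>UNIV. (\<Sum>k\<in>UNIV. A k * B k l) * x l)"
    unfolding sum_distrib_left sum_distrib_right by (subst sum.swap) (simp add: mult.assoc)
  also have "\<dots> = x i" by (simp add: assms if_distrib if_distribR cong: if_cong)
  finally show ?thesis .
qed

lemmas contract_hH = contract_delta[OF h_H]
lemmas contract_Hh = contract_delta[OF H_h]

lemma dh_sym: "q \<in> S \<Longrightarrow> partial_deriv a (\<lambda>q. h q $ i $ j) q = partial_deriv a (\<lambda>q. h q $ j $ i) q"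
  by (rule partial_deriv_cong[OF S]) (auto simp: h_sym)

lemma dH_sym: "q \<in> S \<Longrightarrow> partial_deriv a (\<lambda>q. H i j q) q = partial_deriv a (\<lambda>q. H j i q) q"
  by (rule partial_deriv_cong[OF S]) (auto simp: H_sym)

lemma G_sym: "q \<in> S \<Longrightarrow> G k i j q = G k j i q"
  by (simp add: space_christoffel_def dh_sym add_ac)

lemma dG_sym: "q \<in> S \<Longrightarrow> partial_deriv a (G k i j) q = partial_deriv a (G k j i) q"
  by (rule partial_deriv_cong[OF S]) (auto simp: G_sym)

lemma dt_h: "q \<in> S \<Longrightarrow> dt (\<lambda>q. h q $ i $ j) q = 2 * (\<Sum>k\<in>UNIV. h q $ i $ k * L k j q)"
  using contract_hH[of q i "\<lambda>l. dt (\<lambda>q. h q $ l $ j) q"]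
  by (simp add: shape_def sum_distrib_left mult_ac)

lemma dH:
  assumes q: "q \<in> S"
  shows "partial_deriv a (\<lambda>q. H i m q) q = - (\<Sum>j\<in>UNIV. (\<Sum>k\<in>UNIV. H i k q * partial_deriv a (\<lambda>q. h q $ k $ j) q) * H j m q)"
proof -
  have "partial_deriv a (\<lambda>q. \<Sum>k\<in>UNIV. H i k q * h q $ k $ j) q = 0" for j
  proof -
    have "partial_deriv a (\<lambda>q. \<Sum>k\<in>UNIV. H i k q * h q $ k $ j) q = partial_deriv a (\<lambda>_. if i = j then 1 else 0) q"
      by (rule partial_deriv_cong[OF S q]) (rule H_h)
    then show ?thesis by simp
  qed
  then have *: "(\<Sum>k\<in>UNIV. partial_deriv a (\<lambda>q. H i k q) q * h q $ k $ j)
      = - (\<Sum>k\<in>UNIV. H i k q * partial_deriv a (\<lambda>q. h q $ k $ j) q)" for j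
    using q by (simp add: partial_deriv_sum[OF S] partial_deriv_mult[OF S] smooth_on_mult[OF S] H_smooth h_smooth
        sum.distrib eq_neg_iff_add_eq_0)
  have "(\<Sum>j\<in>UNIV. (\<Sum>k\<in>UNIV. partial_deriv a (\<lambda>q. H i k q) q * h q $ k $ j) * H j m q)
      = (\<Sum>k\<in>UNIV. partial_deriv a (\<lambda>q. H i k q) q * (\<Sum>j\<in>UNIV. h q $ k $ j * H j m q))"
    unfolding sum_distrib_left sum_distrib_right by (subst sum.swap) (simp add: mult.assoc)
  also have "\<dots> = partial_deriv a (\<lambda>q. H i m q) q"
    by (simp add: h_H[OF q] if_distrib cong: if_cong)
  finally show ?thesis by (simp add: * sum_negf)
qed

lemma dt_H: "q \<in> S \<Longrightarrow> dt (\<lambda>q. H i m q) q = - 2 * (\<Sum>j\<in>UNIV. L i j q * H j m q)"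
proof -
  assume q: "q \<in> S"
  have "(\<Sum>k\<in>UNIV. H i k q * dt (\<lambda>q. h q $ k $ j) q) = 2 * L i j q" for j
    by (simp add: shape_def)
  then show ?thesis by (simp add: dH[OF q] sum_distrib_left mult.assoc sum_negf)
qed

text \<open>The product is -1/2 times the time derivative of the symmetric matrix
  \<open>H\<close>.\<close>

lemma LH_sym: "q \<in> S \<Longrightarrow> (\<Sum>j\<in>UNIV. L i j q * H j m q) = (\<Sum>j\<in>UNIV. L m j q * H j i q)"
  using dt_H[of q i m] dt_H[of q m i] dH_sym[of q None i m] by simp

text \<open>Metric compatibility of the Levi-Civita connection of the slices; \<open>dx_H\<close> is
  its counterpart for the inverse metric.\<close>

lemma dx_h:
  assumes q: "q \<in> S"
  shows "dx k (\<lambda>q. h q $ i $ j) q = (\<Sum>l\<in>UNIV. h q $ i $ l * G l k j q) + (\<Sum>l\<in>UNIV. h q $ j $ l * G l k i q)"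
proof -
  have *: "(\<Sum>l\<in>UNIV. h q $ i $ l * G l k j q) = (1/2) * (dx k (\<lambda>q. h q $ i $ j) q + dx j (\<lambda>q. h q $ i $ k) q - dx i (\<lambda>q. h q $ k $ j) q)"
    for i j
    unfolding space_christoffel_def mult.left_commute[of _ "1/2"] sum_distrib_left[of "1/2", symmetric]
    by (rule arg_cong[OF contract_hH[OF q]])
  show ?thesis
    unfolding * using dh_sym[OF q, of "Some k" i j] dh_sym[OF q, of "Some j" i k] dh_sym[OF q, of "Some i" k j]
    by (simp add: field_simps)
qed

lemma dx_H:
  assumes q: "q \<in> S"
  shows "dx k (\<lambda>q. H i m q) q = - (\<Sum>l\<in>UNIV. G i k l q * H l m q) - (\<Sum>l\<in>UNIV. H i l q * G m k l q)"
proof -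
  have "(\<Sum>j\<in>UNIV. (\<Sum>n\<in>UNIV. H i n q * (\<Sum>l\<in>UNIV. h q $ n $ l * G l k j q)) * H j m q) = (\<Sum>j\<in>UNIV. G i k j q * H j m q)"
    by (simp add: contract_Hh[OF q])
  moreover have "(\<Sum>j\<in>UNIV. (\<Sum>n\<in>UNIV. H i n q * (\<Sum>l\<in>UNIV. h q $ j $ l * G l k n q)) * H j m q) = (\<Sum>n\<in>UNIV. H i n q * G m k n q)"
  proof -
    have "(\<Sum>j\<in>UNIV. (\<Sum>n\<in>UNIV. A n * X n j) * B j) = (\<Sum>n\<in>UNIV. A n * (\<Sum>j\<in>UNIV. B j * X n j))"
      for A B :: "3 \<Rightarrow> real" and X
      unfolding sum_distrib_left sum_distrib_right by (subst sum.swap) (simp add: mult_ac)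
    from this[of "\<lambda>n. H i n q" "\<lambda>n j. \<Sum>l\<in>UNIV. h q $ j $ l * G l k n q" "\<lambda>j. H j m q"]
    have "(\<Sum>j\<in>UNIV. (\<Sum>n\<in>UNIV. H i n q * (\<Sum>l\<in>UNIV. h q $ j $ l * G l k n q)) * H j m q)
        = (\<Sum>n\<in>UNIV. H i n q * (\<Sum>j\<in>UNIV. H m j q * (\<Sum>l\<in>UNIV. h q $ j $ l * G l k n q)))"
      by (simp only: H_sym[OF q, of m])
    then show ?thesis by (simp add: contract_Hh[OF q])
  qed
  ultimately show ?thesis
    unfolding dH[OF q] dx_h[OF q] by (simp add: distrib_left distrib_right sum.distrib)
qed

end

section \<open>Time derivative of the spatial Ricci tensor\<close>

context slice_geometry
begin

lemma dt_R:
  assumes q: "q \<in> S"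
  shows "dt (R i j) q = (\<Sum>k\<in>UNIV. dx k (dt (G k i j)) q - dx j (dt (G k i k)) q)
    + (\<Sum>k\<in>UNIV. \<Sum>l\<in>UNIV. (dt (G k k l) q * G l i j q + G k k l q * dt (G l i j) q)
        - (dt (G k j l) q * G l i k q + G k j l q * dt (G l i k) q))"
  unfolding space_ricci_def[abs_def]
  by (simp add: partial_deriv_add[OF S] partial_deriv_diff[OF S] partial_deriv_sum[OF S] partial_deriv_mult[OF S]
      smooth_on_intros[OF S] G_smooth q partial_deriv_commute[OF S G_smooth q, of None])

text \<open>The trace \<open>h\<^sup>i\<^sup>j \<partial>\<^sub>t R\<^sub>i\<^sub>j\<close> is the divergence of this vector field.\<close>

definition ricci_flux :: "3 \<Rightarrow> spacetime \<Rightarrow> real" where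
  "ricci_flux k q = (\<Sum>i\<in>UNIV. \<Sum>j\<in>UNIV. H i j q * dt (G k i j) q) - (\<Sum>i\<in>UNIV. H k i q * (\<Sum>j\<in>UNIV. dt (G j i j) q))"

lemma dx_ricci_flux:
  assumes q: "q \<in> S"
  shows "dx k (ricci_flux k) q = (\<Sum>i\<in>UNIV. \<Sum>j\<in>UNIV. dx k (\<lambda>q. H i j q) q * dt (G k i j) q + H i j q * dx k (dt (G k i j)) q)
    - (\<Sum>i\<in>UNIV. dx k (\<lambda>q. H k i q) q * (\<Sum>j\<in>UNIV. dt (G j i j) q) + H k i q * (\<Sum>j\<in>UNIV. dx k (dt (G j i j)) q))"
  unfolding ricci_flux_def[abs_def]
  by (simp add: partial_deriv_diff[OF S] partial_deriv_sum[OF S] partial_deriv_mult[OF S]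
      smooth_on_intros[OF S] G_smooth H_smooth q)

text \<open>The Palatini identity: the variation of the Ricci tensor is built from covariant
  derivatives of the varied Christoffel symbols, and the parallel tensor \<open>H\<close> may be
  moved inside them. The sum with \<open>G l l k\<close> completes the coordinate divergence to the
  covariant one.\<close>

lemma trace_dt_R:
  assumes q: "q \<in> S"
  shows "(\<Sum>i\<in>UNIV. \<Sum>j\<in>UNIV. H i j q * dt (R i j) q)
    = (\<Sum>k\<in>UNIV. dx k (ricci_flux k) q) + (\<Sum>k\<in>UNIV. (\<Sum>l\<in>UNIV. G l l k q) * ricci_flux k q)"
proof -
  define C where "C k i j = dt (G k i j) q" for k i j
  define D where "D m k i j = dx m (dt (G k i j)) q" for m k i j
  define A where "A i j = H i j q" for i j
  define \<Gamma> where "\<Gamma> k i j = G k i j q" for k i j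
  have C: "C k i j = C k j i" for k i j unfolding C_def by (rule dG_sym[OF q])
  have \<Gamma>: "\<Gamma> k i j = \<Gamma> k j i" for k i j unfolding \<Gamma>_def by (rule G_sym[OF q])
  have A: "A i j = A j i" for i j unfolding A_def by (rule H_sym[OF q])
  have D: "D m k i j = D m k j i" for m k i j
    unfolding D_def by (rule partial_deriv_cong[OF S q]) (rule dG_sym)
  have dA: "dx k (\<lambda>q. H i m q) q = - (\<Sum>l\<in>UNIV. \<Gamma> i k l * A l m) - (\<Sum>l\<in>UNIV. A i l * \<Gamma> m k l)" for k i m
    unfolding \<Gamma>_def A_def by (rule dx_H[OF q])
  \<comment> \<open>With symmetric index pairs in a fixed order and the sums over three indices
    expanded, the claim becomes a polynomial identity in independent unknowns.\<close>
  have A': "A 2 1 = A 1 2" "A 3 1 = A 1 3" "A 3 2 = A 2 3" by (rule A)+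
  have C': "C k 2 1 = C k 1 2" "C k 3 1 = C k 1 3" "C k 3 2 = C k 2 3" for k by (rule C)+
  have \<Gamma>': "\<Gamma> k 2 1 = \<Gamma> k 1 2" "\<Gamma> k 3 1 = \<Gamma> k 1 3" "\<Gamma> k 3 2 = \<Gamma> k 2 3" for k by (rule \<Gamma>)+
  have D': "D m k 2 1 = D m k 1 2" "D m k 3 1 = D m k 1 3" "D m k 3 2 = D m k 2 3" for m k by (rule D)+
  show ?thesis
    unfolding dt_R[OF q] dx_ricci_flux[OF q] ricci_flux_def dA
    unfolding C_def[symmetric] D_def[symmetric] A_def[symmetric] \<Gamma>_def[symmetric]
    unfolding sum_3 A' C' \<Gamma>' D'
    by algebra
qed

text \<open>The component \<open>Some i\<close>, \<open>None\<close> of the Ricci tensor as it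
  stands in \<open>ricci_split_form\<close>, so that the field equations prescribe its
  value.\<close>

definition momentum :: "3 \<Rightarrow> spacetime \<Rightarrow> real" where
  "momentum i q = (\<Sum>j\<in>UNIV. dx j (L j i) q - dt (G j i j) q)
    + (\<Sum>k\<in>UNIV. \<Sum>j\<in>UNIV. G k k j q * L j i q - L k j q * G j i k q)"

text \<open>The flux contains a full trace of the time derivatives of the Christoffel symbols,
  \<open>momentum\<close> spatial derivatives of \<open>L\<close>. The bridge is the contracted
  Christoffel symbol: it is expressible through spatial derivatives of \<open>H\<close>, and the
  time derivative of \<open>H\<close> through \<open>L\<close>.\<close>

lemma ricci_flux_eq:
  assumes q: "q \<in> S"
  shows "ricci_flux k q = 2 * (\<Sum>i\<in>UNIV. H k i q * momentum i q)"
proof -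
  define C where "C k i j = dt (G k i j) q" for k i j
  define A where "A i j = H i j q" for i j
  define \<Gamma> where "\<Gamma> k i j = G k i j q" for k i j
  define l where "l i j = L i j q" for i j
  define dl where "dl k i j = dx k (L i j) q" for i j k
  have C: "C k i j = C k j i" for k i j unfolding C_def by (rule dG_sym[OF q])
  have \<Gamma>: "\<Gamma> k i j = \<Gamma> k j i" for k i j unfolding \<Gamma>_def by (rule G_sym[OF q])
  have A: "A i j = A j i" for i j unfolding A_def by (rule H_sym[OF q])
  have dA: "dx k (\<lambda>q. H i m q) q = - (\<Sum>l\<in>UNIV. \<Gamma> i k l * A l m) - (\<Sum>l\<in>UNIV. A i l * \<Gamma> m k l)" for k i m
    unfolding \<Gamma>_def A_def by (rule dx_H[OF q])
  have dtA: "dt (\<lambda>q. H i m q) q = - 2 * (\<Sum>j\<in>UNIV. l i j * A j m)" for i m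
    unfolding l_def A_def by (rule dt_H[OF q])
  have ddA: "dt (dx k (\<lambda>q. H i m q)) q = - 2 * (\<Sum>j\<in>UNIV. dl k i j * A j m + l i j * dx k (\<lambda>q. H j m q) q)" for k i m
  proof -
    have "dt (dx k (\<lambda>q. H i m q)) q = dx k (dt (\<lambda>q. H i m q)) q"
      by (rule partial_deriv_commute[OF S H_smooth q])
    also have "\<dots> = dx k (\<lambda>q. - 2 * (\<Sum>j\<in>UNIV. L i j q * H j m q)) q"
      by (rule partial_deriv_cong[OF S q]) (rule dt_H)
    also have "\<dots> = - 2 * (\<Sum>j\<in>UNIV. dl k i j * A j m + l i j * dx k (\<lambda>q. H j m q) q)"
      unfolding dl_def l_def A_def
      by (simp only: partial_deriv_cmult[OF S] partial_deriv_sum[OF S] partial_deriv_mult[OF S]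
        smooth_on_intros[OF S] L_smooth H_smooth q)
    finally show ?thesis .
  qed
  \<comment> \<open>A contraction of \<open>dx_H\<close>. It is proved at all points of
    \<open>S\<close>, since it is differentiated in time next.\<close>
  have "(\<Sum>i\<in>UNIV. \<Sum>j\<in>UNIV. H i j q * G k i j q)
      = - (\<Sum>j\<in>UNIV. dx j (\<lambda>q. H j k q) q) - (\<Sum>l\<in>UNIV. (\<Sum>m\<in>UNIV. G m m l q) * H l k q)" if "q \<in> S" for q
  proof -
    have G': "G k 2 1 q = G k 1 2 q" "G k 3 1 q = G k 1 3 q" "G k 3 2 q = G k 2 3 q" for k by (rule G_sym[OF that])+
    have H': "H 2 1 q = H 1 2 q" "H 3 1 q = H 1 3 q" "H 3 2 q = H 2 3 q" by (rule H_sym[OF that])+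
    show ?thesis unfolding dx_H[OF that] sum_3 G' H' by algebra
  qed
  then have "dt (\<lambda>q. \<Sum>i\<in>UNIV. \<Sum>j\<in>UNIV. H i j q * G k i j q) q
      = dt (\<lambda>q. - (\<Sum>j\<in>UNIV. dx j (\<lambda>q. H j k q) q) - (\<Sum>l\<in>UNIV. (\<Sum>m\<in>UNIV. G m m l q) * H l k q)) q"
    by (intro partial_deriv_cong[OF S q]) auto
  then have "(\<Sum>i\<in>UNIV. \<Sum>j\<in>UNIV. dt (\<lambda>q. H i j q) q * \<Gamma> k i j + A i j * C k i j)
    = - (\<Sum>j\<in>UNIV. dt (dx j (\<lambda>q. H j k q)) q)
      - (\<Sum>l\<in>UNIV. (\<Sum>m\<in>UNIV. C m m l) * A l k + (\<Sum>m\<in>UNIV. \<Gamma> m m l) * dt (\<lambda>q. H l k q) q)"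
    unfolding C_def A_def \<Gamma>_def
    by (simp only: partial_deriv_uminus[OF S] partial_deriv_diff[OF S] partial_deriv_sum[OF S] partial_deriv_mult[OF S]
        smooth_on_intros[OF S] L_smooth H_smooth G_smooth q)
  then have main: "(\<Sum>i\<in>UNIV. \<Sum>j\<in>UNIV. A i j * C k i j)
    = - (\<Sum>j\<in>UNIV. dt (dx j (\<lambda>q. H j k q)) q)
      - (\<Sum>l\<in>UNIV. (\<Sum>m\<in>UNIV. C m m l) * A l k + (\<Sum>m\<in>UNIV. \<Gamma> m m l) * dt (\<lambda>q. H l k q) q)
      - (\<Sum>i\<in>UNIV. \<Sum>j\<in>UNIV. dt (\<lambda>q. H i j q) q * \<Gamma> k i j)"
    by (simp add: sum.distrib)
  have A': "A 2 1 = A 1 2" "A 3 1 = A 1 3" "A 3 2 = A 2 3" by (rule A)+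
  have C': "C k 2 1 = C k 1 2" "C k 3 1 = C k 1 3" "C k 3 2 = C k 2 3" for k by (rule C)+
  have \<Gamma>': "\<Gamma> k 2 1 = \<Gamma> k 1 2" "\<Gamma> k 3 1 = \<Gamma> k 1 3" "\<Gamma> k 3 2 = \<Gamma> k 2 3" for k by (rule \<Gamma>)+
  have Ak: "A k i = A i k" for i by (rule A)
  show ?thesis
    unfolding ricci_flux_def momentum_def C_def[symmetric] A_def[symmetric] \<Gamma>_def[symmetric] l_def[symmetric] dl_def[symmetric]
    unfolding main ddA dA dtA
    unfolding sum_3 Ak A' C' \<Gamma>'
    by algebra
qed

lemma second_form_eq: "q \<in> S \<Longrightarrow> second_form (\<lambda>t. - t) h i j q = inverse (time q) * (\<Sum>k\<in>UNIV. h q $ i $ k * L k j q)"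
  by (simp add: second_form_def dt_h inverse_eq_divide)

lemma second_form_smooth: "smooth_on {q \<in> S. time q \<noteq> 0} (second_form (\<lambda>t. - t) h i j)"
proof (rule smooth_on_cong[OF open_time_nonzero[OF S]])
  show "inverse (time q) * (\<Sum>k\<in>UNIV. h q $ i $ k * L k j q) = second_form (\<lambda>t. - t) h i j q"
    if "q \<in> {q \<in> S. time q \<noteq> 0}" for q
    using that by (simp add: second_form_eq)
  have "smooth_on {q \<in> S. time q \<noteq> 0} (\<lambda>q. \<Sum>k\<in>UNIV. h q $ i $ k * L k j q)"
    by (rule smooth_on_subset[of S]) (intro smooth_on_intros[OF S] h_smooth L_smooth, auto)
  then show "smooth_on {q \<in> S. time q \<noteq> 0} (\<lambda>q. inverse (time q) * (\<Sum>k\<in>UNIV. h q $ i $ k * L k j q))"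
    by (intro smooth_on_mult smooth_on_inverse smooth_on_time open_time_nonzero S) auto
qed

end


section \<open>Solutions of the Einstein--scalar field equations\<close>

lemma lapse_log_deriv_uminus: "time p \<noteq> 0 \<Longrightarrow> lapse_log_deriv (\<lambda>t. - t) p = 1 / (2 * time p)"
proof -
  have "partial_deriv None (\<lambda>q. - time q) p = -1"
    by (rule partial_deriv_of_time) (auto intro!: derivative_eq_intros)
  then show "lapse_log_deriv (\<lambda>t. - t) p = 1 / (2 * time p)"
    by (simp add: lapse_log_deriv_def)
qed

locale type_changing_solution = slice_geometry +
  fixes g :: "(3 option) tensor2" and \<phi> :: "spacetime \<Rightarrow> real" and V :: "real \<Rightarrow> real" and \<kappa> :: real
  assumes g: "\<And>q. q \<in> S \<Longrightarrow> g q = split_form (- time q) (h q)"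
    and \<phi>_smooth: "smooth_on S \<phi>" and V_analytic: "real_analytic_on V UNIV" and \<kappa>: "\<kappa> \<noteq> 0"
    and einstein: "\<And>q. q \<in> S \<Longrightarrow> time q \<noteq> 0 \<Longrightarrow>
      ricci g q - (scalar_curvature g q / 2) *\<^sub>R g q = \<kappa> *\<^sub>R energy_momentum V g \<phi> q"
begin

abbreviation "S' \<equiv> {q \<in> S. time q \<noteq> 0}"

lemmas S' = open_time_nonzero[OF S]

definition "P i q = (\<Sum>j\<in>UNIV. H i j q * dx j \<phi> q)"
definition "trL q = (\<Sum>i\<in>UNIV. L i i q)"
definition "trL2 q = (\<Sum>i\<in>UNIV. \<Sum>j\<in>UNIV. L i j q * L j i q)"
definition "Rup i j q = (\<Sum>k\<in>UNIV. H i k q * R k j q)"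
definition "scalR q = (\<Sum>i\<in>UNIV. \<Sum>j\<in>UNIV. H i j q * R i j q)"
definition "grad2 q = (\<Sum>i\<in>UNIV. \<Sum>j\<in>UNIV. H i j q * (dx i \<phi> q * dx j \<phi> q))"
text \<open>The Laplacian of \<phi> in the slice, as the covariant divergence of the gradient
  \<open>P\<close>.\<close>

definition "Lap q = (\<Sum>k\<in>UNIV. dx k (P k) q) + (\<Sum>k\<in>UNIV. (\<Sum>l\<in>UNIV. G l l k q) * P k q)"

lemmas smooth_rules = smooth_on_intros[OF S] smooth_on_time[OF S] H_smooth L_smooth G_smooth R_smooth h_smooth \<phi>_smooth
  smooth_on_compose[OF S \<phi>_smooth V_analytic]
  smooth_on_compose[OF S \<phi>_smooth real_analytic_on_differentiable(2)[OF V_analytic]]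

lemma P_smooth: "smooth_on S (P i)" unfolding P_def[abs_def] by (intro smooth_rules)
lemma trL_smooth: "smooth_on S trL" unfolding trL_def[abs_def] by (intro smooth_rules)
lemma trL2_smooth: "smooth_on S trL2" unfolding trL2_def[abs_def] by (intro smooth_rules)
lemma Rup_smooth: "smooth_on S (Rup i j)" unfolding Rup_def[abs_def] by (intro smooth_rules)
lemma scalR_smooth: "smooth_on S scalR" unfolding scalR_def[abs_def] by (intro smooth_rules)
lemma grad2_smooth: "smooth_on S grad2" unfolding grad2_def[abs_def] by (intro smooth_rules)
lemma Lap_smooth: "smooth_on S Lap" unfolding Lap_def[abs_def] by (intro smooth_rules P_smooth)

lemma ricci_eq:
  assumes "q \<in> S" "time q \<noteq> 0"
  shows "ricci g q $ a $ b = \<kappa> * (partial_deriv a \<phi> q * partial_deriv b \<phi> q + (1/2) * V (\<phi> q) * g q $ a $ b)"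
proof (rule einstein_imp_ricci[OF _ _ einstein[OF assms]])
  show "transpose (g q) = g q"
    using h_sym[OF assms(1)] by (simp add: g[OF assms(1)] vec_eq_iff transpose_def all_option)
  have "g q ** split_form (1 / - time q) (matrix_inv (h q)) = mat 1"
    using assms by (simp add: g split_form_matrix_mult matrix_inv_mult h_invertible split_form_mat_1)
  then show "invertible (g q)" using invertible_right_inverse by blast
qed

lemma ricci_formulas:
  assumes "q \<in> S" "time q \<noteq> 0"
  shows "- (\<Sum>i\<in>UNIV. dt (L i i) q) + 1 / (2 * time q) * trL q - trL2 q
      = \<kappa> * (dt \<phi> q * dt \<phi> q - (1/2) * V (\<phi> q) * time q)"
    and "momentum i q = \<kappa> * (dx i \<phi> q * dt \<phi> q)"
    and "dt (second_form (\<lambda>t. - t) h i j) q + (1 / (2 * time q) + trL q) * second_form (\<lambda>t. - t) h i j q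
      - (\<Sum>k\<in>UNIV. second_form (\<lambda>t. - t) h j k q * L k i q) - (\<Sum>k\<in>UNIV. L k j q * second_form (\<lambda>t. - t) h i k q)
      + R i j q = \<kappa> * (dx i \<phi> q * dx j \<phi> q + (1/2) * V (\<phi> q) * h q $ i $ j)"
proof -
  have q: "q \<in> S'" using assms by simp
  have gS: "g q = split_form (- time q) (h q)" and nS: "- time q \<noteq> 0" and hS: "invertible (h q)" if "q \<in> S'" for q
    using that by (auto simp: g h_invertible)
  note F = ricci_split_form[where S=S' and n="\<lambda>t. - t" and h=h and g=g, OF S' gS nS hS q]
  show "- (\<Sum>i\<in>UNIV. dt (L i i) q) + 1 / (2 * time q) * trL q - trL2 q
      = \<kappa> * (dt \<phi> q * dt \<phi> q - (1/2) * V (\<phi> q) * time q)"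
    using ricci_eq[OF assms, of None None] F(1) unfolding trL_def trL2_def
    by (simp add: lapse_log_deriv_uminus assms g)
  show "momentum i q = \<kappa> * (dx i \<phi> q * dt \<phi> q)"
    using ricci_eq[OF assms, of "Some i" None] F(3)[of i] unfolding momentum_def
    by (simp add: lapse_log_deriv_uminus assms g)
  show "dt (second_form (\<lambda>t. - t) h i j) q + (1 / (2 * time q) + trL q) * second_form (\<lambda>t. - t) h i j q
      - (\<Sum>k\<in>UNIV. second_form (\<lambda>t. - t) h j k q * L k i q) - (\<Sum>k\<in>UNIV. L k j q * second_form (\<lambda>t. - t) h i k q)
      + R i j q = \<kappa> * (dx i \<phi> q * dx j \<phi> q + (1/2) * V (\<phi> q) * h q $ i $ j)"
    using ricci_eq[OF assms, of "Some i" "Some j"] F(4)[of i j] unfolding trL_def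
    by (simp add: lapse_log_deriv_uminus assms g)
qed

text \<open>Obtained by differentiating t B = h L, with B the second form, instead of a
  quotient.\<close>

lemma dt_second_form:
  assumes q: "q \<in> S" "time q \<noteq> 0"
  shows "dt (second_form (\<lambda>t. - t) h i j) q
    = inverse (time q) * ((\<Sum>k\<in>UNIV. dt (\<lambda>q. h q $ i $ k) q * L k j q + h q $ i $ k * dt (L k j) q)
        - second_form (\<lambda>t. - t) h i j q)"
proof -
  let ?X = "\<lambda>q. \<Sum>k\<in>UNIV. h q $ i $ k * L k j q"
  have q': "q \<in> S'" using q by simp
  have sX: "smooth_on S ?X" by (intro smooth_rules)
  have sB: "smooth_on S' (second_form (\<lambda>t. - t) h i j)" by (rule second_form_smooth)
  have "dt ?X q = dt (\<lambda>q. time q * second_form (\<lambda>t. - t) h i j q) q"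
    by (rule partial_deriv_cong[OF S' q']) (simp add: second_form_eq)
  also have "\<dots> = second_form (\<lambda>t. - t) h i j q + time q * dt (second_form (\<lambda>t. - t) h i j) q"
    using partial_deriv_mult[OF S' smooth_on_time[OF S'] sB q'] by simp
  finally have "dt (second_form (\<lambda>t. - t) h i j) q = inverse (time q) * (dt ?X q - second_form (\<lambda>t. - t) h i j q)"
    using q by (simp add: field_simps)
  moreover have "dt ?X q = (\<Sum>k\<in>UNIV. dt (\<lambda>q. h q $ i $ k) q * L k j q + h q $ i $ k * dt (L k j) q)"
    by (simp only: partial_deriv_sum[OF S] partial_deriv_mult[OF S] smooth_rules q)
  ultimately show ?thesis by simp
qed

text \<open>The third formula of \<open>ricci_formulas\<close> with an index raised. The quadratic
  terms from the derivative of \<open>h\<close> cancel both products of \<open>second_form\<close>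
  with \<open>L\<close>, which leaves only trL L. The poles -1/t from \<open>second_form\<close> and
  1/(2t) from the lapse add up to -1/(2t), which is the origin of the coefficient -1 in
  \<open>shape_equation\<close>.\<close>

lemma shape_evolution:
  assumes q: "q \<in> S" "time q \<noteq> 0"
  shows "dt (L m j) q = 1 / (2 * time q) * L m j q - trL q * L m j q - time q * Rup m j q
    + time q * \<kappa> * (P m q * dx j \<phi> q + (1/2) * V (\<phi> q) * (if m = j then 1 else 0))"
proof -
  let ?B = "\<lambda>i j. second_form (\<lambda>t. - t) h i j q"
  let ?X = "\<lambda>i j. \<Sum>k\<in>UNIV. h q $ i $ k * L k j q"
  define \<tau> where "\<tau> = inverse (time q)"
  have \<tau>: "1 / (2 * time q) = \<tau> / 2" "\<tau> * time q = 1" "time q * \<tau> = 1" using q by (auto simp: \<tau>_def field_simps)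
  have B: "?B i j = \<tau> * ?X i j" for i j using q by (simp add: second_form_eq \<tau>_def)
  have Bsym: "?B i j = ?B j i" for i j by (simp add: second_form_def dh_sym[OF q(1), of None i])
  have HB: "(\<Sum>i\<in>UNIV. H m i q * ?B i j) = \<tau> * L m j q" for m j
    unfolding B mult.left_commute[of _ \<tau>] sum_distrib_left[symmetric, of \<tau>] by (simp only: contract_Hh[OF q(1)])
  have HD: "(\<Sum>i\<in>UNIV. H m i q * dt (\<lambda>q. h q $ i $ k) q) = 2 * L m k q" for k
    by (simp add: shape_def)
  have LL: "(\<Sum>i\<in>UNIV. H m i q * (\<Sum>k\<in>UNIV. a k * B' i k)) = (\<Sum>k\<in>UNIV. a k * (\<Sum>i\<in>UNIV. H m i q * B' i k))"
    for a :: "3 \<Rightarrow> real" and B'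
    unfolding sum_distrib_left by (subst sum.swap) (simp add: mult_ac)
  have 1: "(\<Sum>i\<in>UNIV. H m i q * dt (second_form (\<lambda>t. - t) h i j) q)
      = \<tau> * (2 * (\<Sum>k\<in>UNIV. L k j q * L m k q) + dt (L m j) q - \<tau> * L m j q)"
  proof -
    have "(\<Sum>i\<in>UNIV. H m i q * dt (second_form (\<lambda>t. - t) h i j) q)
      = \<tau> * ((\<Sum>i\<in>UNIV. H m i q * (\<Sum>k\<in>UNIV. L k j q * dt (\<lambda>q. h q $ i $ k) q))
        + (\<Sum>i\<in>UNIV. H m i q * (\<Sum>k\<in>UNIV. h q $ i $ k * dt (L k j) q)) - (\<Sum>i\<in>UNIV. H m i q * ?B i j))"
      by (simp add: dt_second_form[OF q] \<tau>_def sum.distrib distrib_left right_diff_distrib sum_subtractf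
          sum_distrib_left mult_ac)
    also have "\<dots> = \<tau> * ((\<Sum>k\<in>UNIV. L k j q * (2 * L m k q)) + dt (L m j) q - \<tau> * L m j q)"
      by (simp only: LL HD HB contract_Hh[OF q(1)])
    finally show ?thesis by (simp add: sum_distrib_left mult_ac)
  qed
  have 2: "(\<Sum>i\<in>UNIV. H m i q * (\<Sum>k\<in>UNIV. ?B j k * L k i q)) = \<tau> * (\<Sum>k\<in>UNIV. L k j q * L m k q)"
  proof -
    have "(\<Sum>i\<in>UNIV. H m i q * (\<Sum>k\<in>UNIV. ?B j k * L k i q)) = (\<Sum>k\<in>UNIV. ?B j k * (\<Sum>i\<in>UNIV. H m i q * L k i q))"
      by (rule LL)
    also have "\<dots> = (\<Sum>k\<in>UNIV. ?B j k * (\<Sum>i\<in>UNIV. L k i q * H i m q))"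
      by (simp add: H_sym[OF q(1), of m] mult.commute)
    also have "\<dots> = (\<Sum>k\<in>UNIV. ?B j k * (\<Sum>i\<in>UNIV. L m i q * H i k q))"
      by (simp only: LH_sym[OF q(1), of _ m])
    also have "\<dots> = (\<Sum>i\<in>UNIV. L m i q * (\<Sum>k\<in>UNIV. H i k q * ?B k j))"
      unfolding sum_distrib_left by (subst sum.swap) (simp add: mult_ac Bsym[of j])
    also have "\<dots> = (\<Sum>i\<in>UNIV. L m i q * (\<tau> * L i j q))" by (simp only: HB)
    finally show ?thesis by (simp add: sum_distrib_left mult_ac)
  qed
  have 3: "(\<Sum>i\<in>UNIV. H m i q * (\<Sum>k\<in>UNIV. L k j q * ?B i k)) = \<tau> * (\<Sum>k\<in>UNIV. L k j q * L m k q)"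
    unfolding LL HB by (simp add: sum_distrib_left mult_ac)
  have "(\<Sum>i\<in>UNIV. H m i q * (dt (second_form (\<lambda>t. - t) h i j) q + (\<tau> / 2 + trL q) * ?B i j
      - (\<Sum>k\<in>UNIV. ?B j k * L k i q) - (\<Sum>k\<in>UNIV. L k j q * ?B i k) + R i j q))
    = (\<Sum>i\<in>UNIV. H m i q * (\<kappa> * (dx i \<phi> q * dx j \<phi> q + (1/2) * V (\<phi> q) * h q $ i $ j)))"
    by (simp only: ricci_formulas(3)[OF q] \<tau>(1)[symmetric])
  moreover have "(\<Sum>i\<in>UNIV. H m i q * (dt (second_form (\<lambda>t. - t) h i j) q + (\<tau> / 2 + trL q) * ?B i j
      - (\<Sum>k\<in>UNIV. ?B j k * L k i q) - (\<Sum>k\<in>UNIV. L k j q * ?B i k) + R i j q))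
    = (\<Sum>i\<in>UNIV. H m i q * dt (second_form (\<lambda>t. - t) h i j) q) + (\<tau> / 2 + trL q) * (\<Sum>i\<in>UNIV. H m i q * ?B i j)
      - (\<Sum>i\<in>UNIV. H m i q * (\<Sum>k\<in>UNIV. ?B j k * L k i q)) - (\<Sum>i\<in>UNIV. H m i q * (\<Sum>k\<in>UNIV. L k j q * ?B i k))
      + Rup m j q"
    unfolding sum_distrib_left[of "\<tau> / 2 + trL q"] Rup_def
    by (simp only: sum.distrib[symmetric] sum_subtractf[symmetric]) (intro sum.cong refl, simp add: algebra_simps)
  moreover have "(\<Sum>i\<in>UNIV. H m i q * (\<kappa> * (dx i \<phi> q * dx j \<phi> q + (1/2) * V (\<phi> q) * h q $ i $ j)))
    = \<kappa> * (P m q * dx j \<phi> q + (1/2) * V (\<phi> q) * (\<Sum>i\<in>UNIV. H m i q * h q $ i $ j))"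
    unfolding P_def by (simp add: sum_distrib_left sum_distrib_right sum.distrib algebra_simps)
  ultimately have "\<tau> * (2 * (\<Sum>k\<in>UNIV. L k j q * L m k q) + dt (L m j) q - \<tau> * L m j q) + (\<tau> / 2 + trL q) * (\<tau> * L m j q)
      - \<tau> * (\<Sum>k\<in>UNIV. L k j q * L m k q) - \<tau> * (\<Sum>k\<in>UNIV. L k j q * L m k q) + Rup m j q
      = \<kappa> * (P m q * dx j \<phi> q + (1/2) * V (\<phi> q) * (if m = j then 1 else 0))"
    by (simp only: 1 2 3 HB H_h[OF q(1)])
  then have "time q * (\<tau> * (dt (L m j) q - \<tau> / 2 * L m j q + trL q * L m j q) + Rup m j q)
      = time q * (\<kappa> * (P m q * dx j \<phi> q + (1/2) * V (\<phi> q) * (if m = j then 1 else 0)))"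
    by (intro arg_cong[of _ _ "\<lambda>x. time q * x"]) (simp add: algebra_simps)
  then have "dt (L m j) q - \<tau> / 2 * L m j q + trL q * L m j q + time q * Rup m j q
      = time q * (\<kappa> * (P m q * dx j \<phi> q + (1/2) * V (\<phi> q) * (if m = j then 1 else 0)))"
    by (simp only: distrib_left mult.assoc[symmetric] \<tau> mult_1)
  then show ?thesis unfolding \<tau>(1) by (simp only: mult.assoc)
qed

end

section \<open>The Hamiltonian constraint and the wave equation\<close>

context type_changing_solution
begin

lemma sum_Rup:
  assumes "q \<in> S"
  shows "(\<Sum>i\<in>UNIV. Rup i i q) = scalR q"
proof -
  have H': "H 2 1 q = H 1 2 q" "H 3 1 q = H 1 3 q" "H 3 2 q = H 2 3 q" by (rule H_sym[OF assms])+
  show ?thesis unfolding Rup_def scalR_def sum_3 H' by algebra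
qed

text \<open>The traced evolution equation eliminates the time derivative of \<open>L\<close> from
  the first formula of \<open>ricci_formulas\<close>, and the poles cancel.\<close>

lemma hamiltonian_constraint:
  assumes q: "q \<in> S" "time q \<noteq> 0"
  shows "trL q * trL q - trL2 q + time q * scalR q
    = \<kappa> * (dt \<phi> q * dt \<phi> q + time q * grad2 q + time q * V (\<phi> q))"
    and "(\<Sum>i\<in>UNIV. dt (L i i) q) = 1 / (2 * time q) * trL q - trL q * trL q - time q * scalR q
      + time q * \<kappa> * (grad2 q + (3/2) * V (\<phi> q))"
proof -
  have g: "(\<Sum>i\<in>UNIV. P i q * dx i \<phi> q) = grad2 q"
    by (simp add: P_def grad2_def sum_distrib_left sum_distrib_right mult_ac)
  have "(\<Sum>i\<in>UNIV. dt (L i i) q) = (\<Sum>i\<in>UNIV. 1 / (2 * time q) * L i i q - trL q * L i i q - time q * Rup i i q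
    + time q * \<kappa> * (P i q * dx i \<phi> q + (1/2) * V (\<phi> q)))"
    by (intro sum.cong refl) (subst shape_evolution[OF q], simp)
  also have "\<dots> = 1 / (2 * time q) * trL q - trL q * trL q - time q * (\<Sum>i\<in>UNIV. Rup i i q)
    + time q * \<kappa> * ((\<Sum>i\<in>UNIV. P i q * dx i \<phi> q) + (3/2) * V (\<phi> q))"
    unfolding trL_def sum_3 by algebra
  finally show tr: "(\<Sum>i\<in>UNIV. dt (L i i) q) = 1 / (2 * time q) * trL q - trL q * trL q - time q * scalR q
      + time q * \<kappa> * (grad2 q + (3/2) * V (\<phi> q))"
    by (simp only: g sum_Rup[OF q(1)])
  show "trL q * trL q - trL2 q + time q * scalR q
    = \<kappa> * (dt \<phi> q * dt \<phi> q + time q * grad2 q + time q * V (\<phi> q))"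
    using ricci_formulas(1)[OF q] unfolding tr by algebra
qed

text \<open>The momentum constraint turns the flux into 2 \<kappa> \<phi>' P, with \<phi>' the time
  derivative; its divergence brings in the Laplacian of \<phi>.\<close>

lemma trace_dt_R_matter:
  assumes q: "q \<in> S" "time q \<noteq> 0"
  shows "(\<Sum>i\<in>UNIV. \<Sum>j\<in>UNIV. H i j q * dt (R i j) q)
    = 2 * \<kappa> * ((\<Sum>k\<in>UNIV. dx k (dt \<phi>) q * P k q) + dt \<phi> q * Lap q)"
proof -
  have q': "q \<in> S'" using q by simp
  have flux: "ricci_flux k q = 2 * \<kappa> * (dt \<phi> q * P k q)" if "q \<in> S'" for k q
  proof -
    have "ricci_flux k q = 2 * (\<Sum>i\<in>UNIV. H k i q * (\<kappa> * (dx i \<phi> q * dt \<phi> q)))"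
      using that by (simp add: ricci_flux_eq ricci_formulas(2))
    then show ?thesis by (simp add: P_def sum_distrib_left mult_ac)
  qed
  have "dx k (ricci_flux k) q = 2 * \<kappa> * (dx k (dt \<phi>) q * P k q + dt \<phi> q * dx k (P k) q)" for k
  proof -
    have "dx k (ricci_flux k) q = dx k (\<lambda>q. 2 * \<kappa> * (dt \<phi> q * P k q)) q"
      by (rule partial_deriv_cong[OF S' q']) (rule flux)
    then show ?thesis
      by (simp only: partial_deriv_cmult[OF S] partial_deriv_mult[OF S] smooth_rules P_smooth q)
  qed
  then show ?thesis
    unfolding trace_dt_R[OF q(1)] Lap_def by (simp add: flux[OF q'] sum.distrib sum_distrib_left algebra_simps)
qed

text \<open>The contracted Bianchi identity enters here: the wave equation follows from the time derivative of
  the Hamiltonian constraint, but only after multiplication by the time derivative of \<open>\<phi>\<close>.\<close>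

definition wave :: "spacetime \<Rightarrow> real" where
  "wave q = 2 * time q * dt (dt \<phi>) q - dt \<phi> q + 2 * (time q * (trL q * dt \<phi> q))
    - 2 * (time q * (time q * Lap q)) + time q * (time q * deriv V (\<phi> q))"

lemma wave_smooth: "smooth_on S wave"
  unfolding wave_def[abs_def] by (intro smooth_rules trL_smooth Lap_smooth)

lemma wave_equation:
  assumes q: "q \<in> S" "time q \<noteq> 0"
  shows "dt \<phi> q * wave q = 0"
proof -
  have q': "q \<in> S'" using q by simp
  define t where "t = time q"
  \<comment> \<open>The pole becomes an unknown subject to 2 t u = 1, so that the final computation
    is polynomial.\<close>
  define u where "u = 1 / (2 * time q)"
  have tu: "2 * t * u = 1" using q by (simp add: t_def u_def)
  \<comment> \<open>The contractions \<open>LR\<close>, \<open>LN\<close> and \<open>PX\<close>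
    cancel in the differentiated constraint. The constraint itself then removes the other terms
    without a factor \<phi>'.\<close>
  define LR where "LR = (\<Sum>i\<in>UNIV. \<Sum>j\<in>UNIV. Rup i j q * L j i q)"
  define LN where "LN = (\<Sum>i\<in>UNIV. \<Sum>j\<in>UNIV. P i q * dx j \<phi> q * L j i q)"
  define PX where "PX = (\<Sum>k\<in>UNIV. dx k (dt \<phi>) q * P k q)"
  note sms = smooth_rules trL_smooth trL2_smooth scalR_smooth grad2_smooth
  note pd = partial_deriv_cmult[OF S] partial_deriv_add[OF S] partial_deriv_diff[OF S] partial_deriv_sum[OF S]
    partial_deriv_mult[OF S]
  have dtrL: "dt trL q = u * trL q - trL q * trL q - t * scalR q + t * \<kappa> * (grad2 q + (3/2) * V (\<phi> q))"
  proof -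
    have "dt trL q = (\<Sum>i\<in>UNIV. dt (L i i) q)"
      unfolding trL_def[abs_def] by (simp only: pd sms q)
    then show ?thesis unfolding hamiltonian_constraint(2)[OF q] t_def u_def .
  qed
  have ev: "dt (L m j) q = u * L m j q - trL q * L m j q - t * Rup m j q
    + t * \<kappa> * (P m q * dx j \<phi> q + (1/2) * V (\<phi> q) * (if m = j then 1 else 0))" for m j
    unfolding t_def u_def by (rule shape_evolution[OF q])
  have dtrL2: "dt trL2 q = 2 * u * trL2 q - 2 * trL q * trL2 q - 2 * t * LR + 2 * t * \<kappa> * LN + t * \<kappa> * V (\<phi> q) * trL q"
  proof -
    have "dt trL2 q = (\<Sum>i\<in>UNIV. \<Sum>j\<in>UNIV. dt (L i j) q * L j i q + L i j q * dt (L j i) q)"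
      unfolding trL2_def[abs_def] by (simp only: pd sms q)
    also have "\<dots> = 2 * u * trL2 q - 2 * trL q * trL2 q - 2 * t * LR + 2 * t * \<kappa> * LN + t * \<kappa> * V (\<phi> q) * (\<Sum>i\<in>UNIV. L i i q)"
      unfolding ev trL2_def LR_def LN_def sum_3 by simp algebra
    finally show ?thesis unfolding trL_def .
  qed
  have dtH: "dt (\<lambda>q. H i j q) q = - 2 * (\<Sum>l\<in>UNIV. L j l q * H l i q)" for i j
    unfolding dH_sym[OF q(1), of None i j] by (rule dt_H[OF q(1)])
  have dR: "dt scalR q = - 2 * LR + 2 * \<kappa> * (PX + dt \<phi> q * Lap q)"
  proof -
    have "dt scalR q = (\<Sum>i\<in>UNIV. \<Sum>j\<in>UNIV. dt (\<lambda>q. H i j q) q * R i j q + H i j q * dt (R i j) q)"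
      unfolding scalR_def[abs_def] by (simp only: pd sms q)
    also have "\<dots> = (\<Sum>i\<in>UNIV. \<Sum>j\<in>UNIV. dt (\<lambda>q. H i j q) q * R i j q) + (\<Sum>i\<in>UNIV. \<Sum>j\<in>UNIV. H i j q * dt (R i j) q)"
      by (simp only: sum.distrib)
    also have "(\<Sum>i\<in>UNIV. \<Sum>j\<in>UNIV. dt (\<lambda>q. H i j q) q * R i j q) = - 2 * LR"
      unfolding dtH LR_def Rup_def sum_3 by algebra
    finally show ?thesis unfolding trace_dt_R_matter[OF q] PX_def .
  qed
  have dN: "dt grad2 q = - 2 * LN + 2 * PX"
  proof -
    have "dt grad2 q = (\<Sum>i\<in>UNIV. \<Sum>j\<in>UNIV. dt (\<lambda>q. H i j q) q * (dx i \<phi> q * dx j \<phi> q)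
        + H i j q * (dt (dx i \<phi>) q * dx j \<phi> q + dx i \<phi> q * dt (dx j \<phi>) q))"
      unfolding grad2_def[abs_def] by (simp only: pd sms q)
    also have "\<dots> = - 2 * LN + 2 * PX"
    proof -
      have c: "dt (dx i \<phi>) q = dx i (dt \<phi>) q" for i by (rule partial_deriv_commute[OF S \<phi>_smooth q(1)])
      have H': "H 2 1 q = H 1 2 q" "H 3 1 q = H 1 3 q" "H 3 2 q = H 2 3 q" by (rule H_sym[OF q(1)])+
      show ?thesis unfolding dtH c LN_def PX_def P_def sum_3 H' by algebra
    qed
    finally show ?thesis .
  qed
  have "dt (\<lambda>q. trL q * trL q - trL2 q + time q * scalR q) q
      = dt (\<lambda>q. \<kappa> * (dt \<phi> q * dt \<phi> q + time q * grad2 q + time q * V (\<phi> q))) q"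
    by (rule partial_deriv_cong[OF S' q']) (use hamiltonian_constraint(1) in auto)
  then have "dt trL q * trL q + trL q * dt trL q - dt trL2 q + (scalR q + t * dt scalR q)
      = \<kappa> * (dt (dt \<phi>) q * dt \<phi> q + dt \<phi> q * dt (dt \<phi>) q + (grad2 q + t * dt grad2 q)
        + (V (\<phi> q) + t * (deriv V (\<phi> q) * dt \<phi> q)))"
    by (simp only: pd sms q partial_deriv_compose[OF S \<phi>_smooth V_analytic] partial_deriv_time t_def mult_1)
  moreover have "trL q * trL q - trL2 q + t * scalR q = \<kappa> * (dt \<phi> q * dt \<phi> q + t * grad2 q + t * V (\<phi> q))"
    unfolding t_def by (rule hamiltonian_constraint(1)[OF q])
  ultimately have "\<kappa> * (dt \<phi> q * wave q) = 0"
    unfolding dtrL dtrL2 dR dN wave_def t_def[symmetric] using tu by algebra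
  then show ?thesis using \<kappa> by simp
qed

end

section \<open>The Taylor expansion in time\<close>

lemma indicial_nonzero: "-1 + 2 * real j \<noteq> 0"
proof -
  have "real (2 * j) \<noteq> real 1" by (subst of_nat_eq_iff) presburger
  then show ?thesis by simp
qed

lemma graded_subset: "graded X k r f \<Longrightarrow> Y \<subseteq> X \<Longrightarrow> graded Y k r f"
  by (induction k arbitrary: f r) auto

context type_changing_solution
begin

text \<open>The factor 2 t clears the pole of \<open>shape_evolution\<close>, so both sides are
  continuous and the equation extends to time 0.\<close>

lemma shape_equation:
  assumes "q \<in> S"
  shows "2 * time q * dt (L i j) q + (-1) * L i j q
    = - 2 * (time q * (trL q * L i j q)) + time q * (time q * (- 2 * Rup i j q
      + 2 * \<kappa> * (P i q * dx j \<phi> q + (1/2) * (if i = j then 1 else 0) * V (\<phi> q))))"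
proof (rule eq_on_by_continuity[OF S _ _ _ assms])
  show "continuous_on S (\<lambda>q. 2 * time q * dt (L i j) q + (-1) * L i j q)"
    by (rule smooth_on_continuous) (intro smooth_rules)
  show "continuous_on S (\<lambda>q. - 2 * (time q * (trL q * L i j q)) + time q * (time q * (- 2 * Rup i j q
      + 2 * \<kappa> * (P i q * dx j \<phi> q + (1/2) * (if i = j then 1 else 0) * V (\<phi> q)))))"
    by (rule smooth_on_continuous) (intro smooth_rules trL_smooth Rup_smooth P_smooth)
  show "2 * time q * dt (L i j) q + (-1) * L i j q
    = - 2 * (time q * (trL q * L i j q)) + time q * (time q * (- 2 * Rup i j q
      + 2 * \<kappa> * (P i q * dx j \<phi> q + (1/2) * (if i = j then 1 else 0) * V (\<phi> q))))"
    if "q \<in> S" "time q \<noteq> 0" for q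
    unfolding shape_evolution[OF that] using that(2) by (simp add: field_simps)
qed

context
  fixes U :: "(real^3) set"
  assumes U: "open U" and event_in_S: "\<And>x. x \<in> U \<Longrightarrow> event 0 x \<in> S"
begin

definition "smooth_graded k r f \<longleftrightarrow> graded U k r f \<and> smooth_on S f"

lemma smooth_graded_add: "smooth_graded k r f \<Longrightarrow> smooth_graded k r w \<Longrightarrow> smooth_graded k r (\<lambda>q. f q + w q)"
  unfolding smooth_graded_def using graded_add[OF S event_in_S] smooth_on_add[OF S] by blast

lemma smooth_graded_diff: "smooth_graded k r f \<Longrightarrow> smooth_graded k r w \<Longrightarrow> smooth_graded k r (\<lambda>q. f q - w q)"
  unfolding smooth_graded_def using graded_diff[OF S event_in_S] smooth_on_diff[OF S] by blast

lemma smooth_graded_cmult: "smooth_graded k r f \<Longrightarrow> smooth_graded k r (\<lambda>q. c * f q)"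
  unfolding smooth_graded_def using graded_cmult[OF S event_in_S] smooth_on_mult[OF S smooth_on_const] by blast

lemma smooth_graded_mult: "smooth_graded k r f \<Longrightarrow> smooth_graded k r' w \<Longrightarrow> smooth_graded k (r + r') (\<lambda>q. f q * w q)"
  unfolding smooth_graded_def using graded_mult[OF S event_in_S] smooth_on_mult[OF S] by blast

lemma smooth_graded_mult0:
  "smooth_graded k 0 f \<Longrightarrow> smooth_graded k r w \<Longrightarrow> smooth_graded k r (\<lambda>q. f q * w q)"
  using smooth_graded_mult[of k 0 f r w] by simp

lemma smooth_graded_sum: "(\<And>i. smooth_graded k r (f i)) \<Longrightarrow> smooth_graded k r (\<lambda>q. \<Sum>i\<in>UNIV. f i q)"
  unfolding smooth_graded_def by (intro conjI graded_sum[OF S event_in_S] smooth_on_sum[OF S]) simp_all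

lemma smooth_graded_dx: "smooth_graded k r f \<Longrightarrow> smooth_graded k r (dx i f)"
  unfolding smooth_graded_def using graded_space_deriv[OF S event_in_S U] smooth_on_partial_deriv by blast

lemma smooth_graded_dt: "smooth_graded (Suc k) r f \<Longrightarrow> smooth_graded k (r + 2) (dt f)"
  unfolding smooth_graded_def using smooth_on_partial_deriv by auto

lemma smooth_graded_time_mult: "smooth_graded k r f \<Longrightarrow> smooth_graded (Suc k) (Suc r) (\<lambda>q. time q * f q)"
  unfolding smooth_graded_def using graded_time_mult[OF S event_in_S] smooth_on_mult[OF S smooth_on_time[OF S]] by blast

lemma smooth_graded_compose: "smooth_graded k 0 f \<Longrightarrow> real_analytic_on F UNIV \<Longrightarrow> smooth_graded k 0 (\<lambda>q. F (f q))"
  unfolding smooth_graded_def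
  using graded_compose[OF S event_in_S, where V=F and f=f and k=k] smooth_on_compose[OF S, where V=F and f=f] by simp

lemma smooth_graded_mod_cong: "r mod 3 = r' mod 3 \<Longrightarrow> smooth_graded k r f \<Longrightarrow> smooth_graded k r' f"
  unfolding smooth_graded_def using graded_mod_cong by blast

lemma smooth_graded_Suc_imp: "smooth_graded (Suc k) r f \<Longrightarrow> smooth_graded k r f"
  unfolding smooth_graded_def using graded_Suc_imp by blast

lemma smooth_graded_time_mult2: "smooth_graded k 0 f \<Longrightarrow> smooth_graded k 2 (\<lambda>q. time q * (time q * f q))"
  using smooth_graded_time_mult[OF smooth_graded_time_mult, of k 0 f] smooth_graded_Suc_imp
  by (simp add: numeral_2_eq_2)

text \<open>The degree is 1 + 2 + 2, which is 2 modulo 3, and the factor t makes up for the missing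
  order of \<open>f\<close> and \<open>w\<close>.\<close>

lemma smooth_graded_time_mult_products:
  "smooth_graded k 2 f \<Longrightarrow> smooth_graded k 2 w \<Longrightarrow> smooth_graded (Suc k) 2 (\<lambda>q. time q * (f q * w q))"
  by (rule smooth_graded_mod_cong[OF _ smooth_graded_time_mult[OF smooth_graded_mult]]) auto

text \<open>Degree 2 is degree -1 modulo 3, that of the derivative of a function of degree 0. Degree
  0 puts no condition on the value at time 0, so the constant of integration is free.\<close>

lemma smooth_graded_antiderivative:
  assumes "graded U k 2 w" "\<And>q. q \<in> S \<Longrightarrow> dt f q = w q" "smooth_on S f"
  shows "smooth_graded (Suc k) 0 f"
proof -
  have "graded U k 2 (dt f)"
    by (rule graded_cong[OF S event_in_S _ assms(1)]) (simp_all add: assms(2))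
  then have "graded U k (0 + 2) (dt f)" by (simp only: add_0)
  then show ?thesis using assms(3) by (simp add: smooth_graded_def)
qed

lemmas smooth_graded_intros = smooth_graded_add smooth_graded_diff smooth_graded_cmult smooth_graded_sum smooth_graded_dx

lemma smooth_graded_0: "smooth_on S f \<Longrightarrow> smooth_graded (Suc 0) 0 f"
  by (simp add: smooth_graded_def)

text \<open>Order k + 1 for \<open>h\<close>, \<open>H\<close> and \<phi> gives order k + 1 for the
  curvature of the slices, which contains only spatial derivatives, but only order k for
  \<open>L\<close> and \<phi>'. On the right-hand sides these occur only with the factors t and trL,
  so the right-hand sides still have order k + 1. The Fuchsian equations transfer this order to
  \<open>L\<close> and \<phi>', and integration gives order k + 2.\<close>

lemma expansion_step:
  assumes h: "\<And>i j. smooth_graded (Suc k) 0 (\<lambda>q. h q $ i $ j)" and H: "\<And>i j. smooth_graded (Suc k) 0 (\<lambda>q. H i j q)"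
    and \<phi>: "smooth_graded (Suc k) 0 \<phi>"
  shows "(\<forall>i j. smooth_graded (Suc (Suc k)) 0 (\<lambda>q. h q $ i $ j)) \<and>
    (\<forall>i j. smooth_graded (Suc (Suc k)) 0 (\<lambda>q. H i j q)) \<and> smooth_graded (Suc (Suc k)) 0 \<phi>"
proof -
  have dh: "smooth_graded k 2 (dt (\<lambda>q. h q $ i $ j))" for i j
    using smooth_graded_dt[OF h, of i j] by (simp only: add_0)
  have Lk: "smooth_graded k 2 (L i j)" for i j
    unfolding shape_def[abs_def]
    by (intro smooth_graded_intros smooth_graded_mult0 dh smooth_graded_Suc_imp[OF H])
  have trLk: "smooth_graded k 2 trL"
    unfolding trL_def[abs_def] by (intro smooth_graded_intros Lk)
  have G: "smooth_graded (Suc k) 0 (G m i j)" for m i j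
    unfolding space_christoffel_def[abs_def]
    by (intro smooth_graded_intros smooth_graded_mult0 H h)
  have R: "smooth_graded (Suc k) 0 (R i j)" for i j
    unfolding space_ricci_def[abs_def]
    by (intro smooth_graded_intros smooth_graded_mult0 G)
  have Rup: "smooth_graded (Suc k) 0 (Rup i j)" for i j
    unfolding Rup_def[abs_def] by (intro smooth_graded_intros smooth_graded_mult0 H R)
  have P: "smooth_graded (Suc k) 0 (P i)" for i
    unfolding P_def[abs_def] by (intro smooth_graded_intros smooth_graded_mult0 H \<phi>)
  have V: "smooth_graded (Suc k) 0 (\<lambda>q. V (\<phi> q))"
    by (rule smooth_graded_compose[OF \<phi> V_analytic])
  have V': "smooth_graded (Suc k) 0 (\<lambda>q. deriv V (\<phi> q))"
    by (rule smooth_graded_compose[OF \<phi> real_analytic_on_differentiable(2)[OF V_analytic]])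
  have Lap: "smooth_graded (Suc k) 0 Lap"
    unfolding Lap_def[abs_def] by (intro smooth_graded_intros smooth_graded_mult0 P G)
  have L: "smooth_graded (Suc k) 2 (L i j)" for i j
  proof -
    have "smooth_graded (Suc k) 2 (\<lambda>q. - 2 * (time q * (trL q * L i j q)) + time q * (time q * (- 2 * Rup i j q
      + 2 * \<kappa> * (P i q * dx j \<phi> q + (1/2) * (if i = j then 1 else 0) * V (\<phi> q)))))"
      by (intro smooth_graded_intros smooth_graded_time_mult_products smooth_graded_time_mult2 Lk trLk Rup
          smooth_graded_mult0[of "Suc k" "P i"] P \<phi> V)
    then have "graded U (Suc k) 2 (L i j)"
      unfolding smooth_graded_def
    proof (elim conjE, intro graded_fuchsian[OF S event_in_S _ L_smooth _ shape_equation])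
      show "-1 + 2 * real j \<noteq> 0" for j by (rule indicial_nonzero)
    qed
    then show ?thesis by (simp add: smooth_graded_def L_smooth)
  qed
  have "smooth_graded (Suc k) 2 (\<lambda>q. 2 * (\<Sum>m\<in>UNIV. h q $ i $ m * L m j q))" for i j
    by (intro smooth_graded_intros smooth_graded_mult0 h L)
  then have h': "smooth_graded (Suc (Suc k)) 0 (\<lambda>q. h q $ i $ j)" for i j
    by (intro smooth_graded_antiderivative[OF _ dt_h h_smooth]) (simp_all add: smooth_graded_def)
  have "smooth_graded (Suc k) 2 (\<lambda>q. - 2 * (\<Sum>m\<in>UNIV. L i m q * H m j q))" for i j
    by (intro smooth_graded_intros) (rule smooth_graded_mult[OF L H, unfolded add_0_right])
  then have H': "smooth_graded (Suc (Suc k)) 0 (\<lambda>q. H i j q)" for i j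
    by (intro smooth_graded_antiderivative[OF _ dt_H H_smooth]) (simp_all add: smooth_graded_def)
  let ?y = "dt \<phi>"
  let ?flat = "\<lambda>f x. \<forall>m. (partial_deriv None ^^ m) f (event 0 x) = 0"
  \<comment> \<open>\<open>Z\<close> need not be open. All spatial derivatives have been taken over
    \<open>U\<close> by now, so for the rest it suffices that gradings restrict to subsets.\<close>
  define Z where "Z = {x \<in> U. ?flat wave x}"
  have y: "smooth_graded k 2 ?y" using smooth_graded_dt[OF \<phi>] by (simp only: add_0)
  have y_smooth: "smooth_on S ?y" using \<phi>_smooth smooth_on_partial_deriv by blast
  have "smooth_graded (Suc k) 2 (\<lambda>q. 2 * (time q * (time q * Lap q)) - 2 * (time q * (trL q * ?y q)) - time q * (time q * deriv V (\<phi> q)))"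
    by (intro smooth_graded_intros smooth_graded_time_mult_products smooth_graded_time_mult2 y trLk Lap V')
  then have Q: "graded Z (Suc k) 2 (\<lambda>q. 2 * (time q * (time q * Lap q)) - 2 * (time q * (trL q * ?y q)) - time q * (time q * deriv V (\<phi> q)))"
    and Qs: "smooth_on S (\<lambda>q. 2 * (time q * (time q * Lap q)) - 2 * (time q * (trL q * ?y q)) - time q * (time q * deriv V (\<phi> q)))"
    unfolding smooth_graded_def by (auto intro: graded_subset simp: Z_def)
  have Z: "event 0 x \<in> S" if "x \<in> Z" for x using that event_in_S by (simp add: Z_def)
  \<comment> \<open>A flat function is graded in every degree. On \<open>Z\<close> it may therefore
    join the right-hand side, where it turns the definition of \<open>wave\<close> into a Fuchsian
    equation for \<open>?y\<close> that holds identically.\<close>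
  have "graded Z (Suc k) 2 wave" by (rule graded_flat) (simp add: Z_def)
  from graded_add[where X=Z, OF S Z this Q wave_smooth Qs]
  have "graded Z (Suc k) 2 (\<lambda>q. wave q + (2 * (time q * (time q * Lap q)) - 2 * (time q * (trL q * ?y q)) - time q * (time q * deriv V (\<phi> q))))"
    by simp
  from graded_fuchsian[where X=Z and m="-1", OF S Z this y_smooth indicial_nonzero]
  have 1: "graded Z (Suc k) 2 ?y" by (simp add: wave_def)
  have "?flat ?y x \<or> ?flat wave x" if "x \<in> U" for x
    \<comment> \<open>The product of \<open>?y\<close> and \<open>wave\<close> vanishes off time 0,
      so at points of \<open>U\<close> outside \<open>Z\<close> it is \<open>?y\<close> that is
      flat.\<close>
    by (rule flat_or_flat[OF S y_smooth wave_smooth event_in_S[OF that]]) (rule wave_equation)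
  then have "graded (U - Z) (Suc k) 2 ?y"
    by (intro graded_flat) (auto simp: Z_def)
  from graded_Un[OF 1 this] have "graded U (Suc k) 2 ?y"
    by (rule graded_subset) auto
  then have "smooth_graded (Suc (Suc k)) 0 \<phi>"
    by (rule smooth_graded_antiderivative) (simp_all add: \<phi>_smooth)
  with h' H' show ?thesis by blast
qed

lemma expansion:
  "(\<forall>i j. smooth_graded (Suc k) 0 (\<lambda>q. h q $ i $ j)) \<and>
    (\<forall>i j. smooth_graded (Suc k) 0 (\<lambda>q. H i j q)) \<and> smooth_graded (Suc k) 0 \<phi>"
proof (induction k)
  case 0
  then show ?case by (intro conjI allI smooth_graded_0 h_smooth H_smooth \<phi>_smooth)
next
  case (Suc k)
  then show ?case by (intro expansion_step) auto
qed

theorem time_derivatives_vanish: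
  assumes "x \<in> U" "m mod 3 \<noteq> 0"
  shows "(partial_deriv None ^^ m) (\<lambda>q. h q $ i $ j) (event 0 x) = 0" "(partial_deriv None ^^ m) \<phi> (event 0 x) = 0"
proof -
  have "(0 + 2 * m) mod 3 \<noteq> 0" using assms(2) by presburger
  then show "(partial_deriv None ^^ m) (\<lambda>q. h q $ i $ j) (event 0 x) = 0" "(partial_deriv None ^^ m) \<phi> (event 0 x) = 0"
    using expansion[of m] graded_imp[OF _ _ _ assms(1), of "Suc m" 0] unfolding smooth_graded_def by blast+
qed

end

end

section \<open>Analytic dependence on powers of the time coordinate\<close>

lemma real_analytic_on_cong:
  assumes S: "open S" and eq: "\<And>q. q \<in> S \<Longrightarrow> f q = g q" and f: "real_analytic_on f S"
  shows "real_analytic_on g S"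
  unfolding real_analytic_on_def
proof
  fix p assume p: "p \<in> S"
  obtain r c where r: "r > 0" and c: "\<And>q. q \<in> ball p r \<Longrightarrow>
        ((\<lambda>\<alpha>. c \<alpha> * (\<Prod>b\<in>Basis. ((q - p) \<bullet> b) ^ \<alpha> b)) has_sum f q) (Basis \<rightarrow>\<^sub>E (UNIV :: nat set))"
    using f p unfolding real_analytic_on_def by blast
  obtain r' where r': "r' > 0" "ball p r' \<subseteq> S" using S p open_contains_ball by blast
  have "((\<lambda>\<alpha>. c \<alpha> * (\<Prod>b\<in>Basis. ((q - p) \<bullet> b) ^ \<alpha> b)) has_sum g q) (Basis \<rightarrow>\<^sub>E (UNIV :: nat set))"
    if "q \<in> ball p (min r r')" for q
    using c[of q] that r' eq[of q] by auto
  then show "\<exists>r>0. \<exists>c. \<forall>q\<in>ball p r. ((\<lambda>\<alpha>. c \<alpha> * (\<Prod>b\<in>Basis. ((q - p) \<bullet> b) ^ \<alpha> b)) has_sum g q)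
          (Basis \<rightarrow>\<^sub>E (UNIV :: nat set))"
    using r r' by (intro exI[of _ "min r r'"] conjI exI[of _ c] ballI) auto
qed

lemma real_analytic_on_of_coordinate:
  fixes u :: "real \<Rightarrow> real" and b :: "'a::euclidean_space"
  assumes b: "b \<in> Basis" and u: "\<And>q. q \<in> S \<Longrightarrow> has_power_series u (q \<bullet> b)"
  shows "real_analytic_on (\<lambda>q. u (q \<bullet> b)) S"
  unfolding real_analytic_on_iff_power_series_at[OF b]
proof
  fix p assume "p \<in> S"
  then obtain \<rho> a where \<rho>: "\<rho> > 0" and a: "\<And>\<sigma>. \<bar>\<sigma>\<bar> < \<rho> \<Longrightarrow> (\<lambda>k. a k * \<sigma> ^ k) sums u (p \<bullet> b + \<sigma>)"
    using u unfolding has_power_series_def by blast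
  define \<beta>0 where "\<beta>0 = (\<lambda>b'\<in>Basis - {b}. 0 :: nat)"
  have "power_series_at b (\<lambda>q. u (q \<bullet> b)) p \<rho> (\<lambda>n \<beta>. if \<beta> = \<beta>0 then a n else 0)"
    unfolding power_series_at_def
  proof (intro conjI ballI \<rho>)
    fix v :: 'a assume "v \<in> ball 0 \<rho>"
    then have v: "\<bar>v \<bullet> b\<bar> < \<rho>" using Basis_le_norm[OF b, of v] by simp
    \<comment> \<open>A point strictly between |v \<bullet> b| and \<rho>: convergence at
      \<open>K\<close> gives absolute convergence at v \<bullet> b.\<close>
    define K where "K = (\<bar>v \<bullet> b\<bar> + \<rho>) / 2"
    have K: "\<bar>v \<bullet> b\<bar> < K" "\<bar>K\<bar> < \<rho>" using v by (auto simp: K_def)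
    have "summable (\<lambda>n. norm (a n * (v \<bullet> b) ^ n))"
      by (rule powser_insidea[OF sums_summable[OF a[OF K(2)]]]) (use K in auto)
    then have "((\<lambda>n. a n * (v \<bullet> b) ^ n) has_sum u (p \<bullet> b + v \<bullet> b)) UNIV"
      by (rule norm_summable_imp_has_sum) (rule a[OF v])
    moreover have "other_monomial b \<beta>0 v = 1"
      by (simp add: other_monomial_def \<beta>0_def)
    moreover have "bij_betw (\<lambda>n. (n, \<beta>0)) UNIV (UNIV \<times> {\<beta>0})"
      by (auto simp: bij_betw_def inj_on_def)
    ultimately have *: "((\<lambda>(n, \<beta>). (if \<beta> = \<beta>0 then a n else 0) * other_monomial b \<beta> v * (v \<bullet> b) ^ n)
        has_sum u (p \<bullet> b + v \<bullet> b)) (UNIV \<times> {\<beta>0})"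
      by (subst has_sum_reindex_bij_betw[symmetric, where A=UNIV and g="\<lambda>n. (n, \<beta>0)"]) auto
    let ?F = "\<lambda>(n, \<beta>). (if \<beta> = \<beta>0 then a n else 0) * other_monomial b \<beta> v * (v \<bullet> b) ^ n"
    have "\<beta>0 \<in> other_indices b" by (simp add: \<beta>0_def)
    then have sub: "UNIV \<times> {\<beta>0} \<subseteq> UNIV \<times> other_indices b" by blast
    have "?F x = 0" if "x \<in> UNIV \<times> other_indices b - UNIV \<times> {\<beta>0}" for x
      using that by (cases x) simp
    then have "(?F has_sum u (p \<bullet> b + v \<bullet> b)) (UNIV \<times> other_indices b)"
      using sub by (intro has_sum_cong_neutral[THEN iffD1, OF _ _ _ *]) (blast, blast, rule refl)
    then show "((\<lambda>(n, \<beta>). (if \<beta> = \<beta>0 then a n else 0) * other_monomial b \<beta> v * (v \<bullet> b) ^ n)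
        has_sum u ((p + v) \<bullet> b)) (UNIV \<times> other_indices b)"
      by (simp add: inner_add_left)
  qed
  then show "\<exists>r C. power_series_at b (\<lambda>q. u (q \<bullet> b)) p r C" by blast
qed

lemma has_power_series_const: "has_power_series (\<lambda>_. c) s0"
  unfolding has_power_series_def
proof (intro exI[of _ "1::real"] exI[of _ "\<lambda>k. if k = 0 then c else 0"] conjI allI impI)
  fix \<sigma> :: real
  have "(\<lambda>k. (if k = 0 then c else 0) * \<sigma> ^ k) sums (\<Sum>k\<in>{0}. (if k = 0 then c else 0) * \<sigma> ^ k)"
    by (rule sums_finite) auto
  then show "(\<lambda>k. (if k = 0 then c else 0) * \<sigma> ^ k) sums c" by simp
qed simp

lemma real_analytic_on_const: "real_analytic_on (\<lambda>_ :: spacetime. c) S"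
  using real_analytic_on_of_coordinate[of "axis None 1" S "\<lambda>_. c"] has_power_series_const by simp

lemma real_analytic_on_uminus_time: "real_analytic_on (\<lambda>q. - time q) S"
  using real_analytic_on_of_coordinate[of "axis None 1" S "\<lambda>t. (-1) * t"] has_power_series_mult[of "-1"]
  by (simp add: inner_axis_None)

lemma retime_eq_substitute: "q + (u (q \<bullet> axis None 1) - q \<bullet> axis None 1) *\<^sub>R axis None 1 = retime u q"
  by (simp add: vec_eq_iff all_option retime_def inner_axis_None space_part_def, simp add: time_def)

lemma real_analytic_on_retime:
  assumes "real_analytic_on f S'" "\<And>q. q \<in> S \<Longrightarrow> has_power_series u (time q)" "\<And>q. q \<in> S \<Longrightarrow> retime u q \<in> S'"
  shows "real_analytic_on (\<lambda>q. f (retime u q)) S"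
  using real_analytic_on_substitute[OF assms(1), of "axis None 1" S u] assms(2,3)
  unfolding retime_eq_substitute by (simp add: inner_axis_None)

lemma power_series_at_mono: "power_series_at b f p r C \<Longrightarrow> 0 < r' \<Longrightarrow> r' \<le> r \<Longrightarrow> power_series_at b f p r' C"
  unfolding power_series_at_def by auto

lemma cube_time_eq_retime: "cube_time p = retime (\<lambda>t. t ^ 3) p"
  by (simp add: cube_time_def retime_def)

lemma root_cube_time [simp]: "retime (root 3) (cube_time p) = p"
  by (simp add: cube_time_def retime_def real_root_power_cancel odd_real_root_power_cancel)

text \<open>Away from time 0 the cube root is analytic and can be substituted; at time 0
  \<open>power_series_at_cubic\<close> takes over.\<close>

lemma real_analytic_on_root_time:
  assumes U: "open U" and f: "real_analytic_on f (slab r U)"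
    and 3: "\<And>x n. x \<in> U \<Longrightarrow> n mod 3 \<noteq> 0 \<Longrightarrow> (partial_deriv None ^^ n) f (event 0 x) = 0"
  shows "real_analytic_on (\<lambda>q. f (retime (root 3) q)) (cube_time ` slab r U)"
proof -
  let ?b = "axis None 1 :: spacetime"
  have "\<exists>r' C. power_series_at ?b (\<lambda>q. f (retime (root 3) q)) (cube_time p) r' C" if p: "p \<in> slab r U" for p
  proof (cases "time p = 0")
    case False
    have "real_analytic_on (\<lambda>q. f (retime (root 3) q)) {cube_time p}"
    proof (rule real_analytic_on_retime[OF f])
      show "has_power_series (root 3) (time q)" if "q \<in> {cube_time p}" for q
        using that False by (intro has_power_series_root3) (simp add: cube_time_def)
    qed (use p in auto)
    then show ?thesis
      unfolding real_analytic_on_iff_power_series_at[OF axis_1_in_Basis[of None]] by simp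
  next
    case True
    then have cp: "cube_time p = p"
      by (simp add: cube_time_def) (metis True event_time_space_part)
    obtain \<rho> C where C: "power_series_at ?b f p \<rho> C"
      using f p real_analytic_on_iff_power_series_at[OF axis_1_in_Basis] by blast
    obtain \<rho>' where \<rho>': "\<rho>' > 0" "ball p \<rho>' \<subseteq> slab r U"
      using open_slab[OF U] p open_contains_ball by blast
    \<comment> \<open>The smaller radius keeps p + v in the slab, hence its spatial part in
      \<open>U\<close>, where the derivatives are known to vanish.\<close>
    have C': "power_series_at ?b f p (min \<rho> \<rho>') C"
      by (rule power_series_at_mono[OF C]) (use C \<rho>' in \<open>auto simp: power_series_at_def\<close>)
    have "((\<lambda>f q. deriv (\<lambda>s. f (q + s *\<^sub>R ?b)) 0) ^^ n) f (p + v) = 0"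
      if v: "norm v < min \<rho> \<rho>'" "v \<bullet> ?b = 0" and n: "n mod 3 \<noteq> 0" for v n
    proof -
      have "p + v \<in> slab r U" using v \<rho>' by (auto simp: dist_norm)
      then have "space_part (p + v) \<in> U" by (simp only: mem_slab_iff)
      moreover have "time (p + v) = 0" using True v(2) by (simp add: inner_axis_None)
      then have "p + v = event 0 (space_part (p + v))" by (metis event_time_space_part)
      ultimately have "(partial_deriv None ^^ n) f (p + v) = 0" using 3[OF _ n] by metis
      then show ?thesis by (simp add: partial_deriv_def[abs_def])
    qed
    from power_series_at_cubic[OF C' axis_1_in_Basis _ this] True show ?thesis
      unfolding cp retime_eq_substitute by (simp add: inner_axis_None)
  qed
  then show ?thesis
    unfolding real_analytic_on_iff_power_series_at[OF axis_1_in_Basis[of None]] by blast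
qed


section \<open>The change of the time coordinate\<close>

text \<open>The integral of sqrt |t| from 0, so that -t dt^2 becomes -sgn(s) ds^2 in the new time
  s.\<close>

definition proper_time :: "real \<Rightarrow> real" where
  "proper_time t = 2/3 * sgn t * \<bar>t\<bar> powr (3/2)"

definition coordinate_time :: "real \<Rightarrow> real" where
  "coordinate_time s = sgn s * (3/2 * \<bar>s\<bar>) powr (2/3)"

lemma psi_eq_retime: "psi = retime proper_time"
  by (rule ext) (simp add: psi_def retime_def proper_time_def mult_sgn_abs sgn_mult_abs linordered_idom_class.abs_sgn[symmetric] mult.commute[of "sgn _" "time _"])

lemma sgn_proper_time [simp]: "sgn (proper_time t) = sgn t"
  by (cases "t = 0") (auto simp: proper_time_def sgn_mult)

lemma abs_proper_time: "\<bar>proper_time t\<bar> = 2/3 * \<bar>t\<bar> powr (3/2)"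
  by (cases "t = 0") (auto simp: proper_time_def abs_mult abs_sgn_eq)

lemma sgn_coordinate_time [simp]: "sgn (coordinate_time s) = sgn s"
  by (cases "s = 0") (auto simp: coordinate_time_def sgn_mult)

lemma abs_coordinate_time: "\<bar>coordinate_time s\<bar> = (3/2 * \<bar>s\<bar>) powr (2/3)"
  by (cases "s = 0") (auto simp: coordinate_time_def abs_mult abs_sgn_eq)

lemma coordinate_time_proper_time [simp]: "coordinate_time (proper_time t) = t"
  by (simp add: coordinate_time_def[of "proper_time t"] abs_proper_time powr_powr sgn_mult_abs)

lemma proper_time_coordinate_time [simp]: "proper_time (coordinate_time s) = s"
  by (simp add: proper_time_def[of "coordinate_time s"] abs_coordinate_time powr_powr) (simp add: sgn_mult_abs mult_sgn_abs abs_mult_sgn)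

lemma retime_psi [simp]: "retime coordinate_time (psi p) = p"
  by (simp add: psi_eq_retime retime_def)

lemma psi_retime [simp]: "psi (retime coordinate_time q) = q"
  by (simp add: psi_eq_retime retime_def)

lemma proper_time_less_iff: "0 < r \<Longrightarrow> \<bar>proper_time t\<bar> < 2/3 * r powr (3/2) \<longleftrightarrow> \<bar>t\<bar> < r"
  using powr_less_mono2[of "3/2" "\<bar>t\<bar>" r] powr_mono2[of "3/2" r "\<bar>t\<bar>"]
  by (cases "\<bar>t\<bar> < r") (auto simp: abs_proper_time)

lemma psi_in_slab_iff: "0 < r \<Longrightarrow> psi p \<in> slab (2/3 * r powr (3/2)) U \<longleftrightarrow> p \<in> slab r U"
  unfolding mem_slab_iff psi_eq_retime time_retime space_part_retime by (simp only: proper_time_less_iff)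

lemma retime_in_slab_iff: "0 < r \<Longrightarrow> retime coordinate_time q \<in> slab r U \<longleftrightarrow> q \<in> slab (2/3 * r powr (3/2)) U"
  using psi_in_slab_iff[of r "retime coordinate_time q" U] by simp

lemma time_psi_eq_0_iff [simp]: "time (psi p) = 0 \<longleftrightarrow> time p = 0"
  by (metis psi_eq_retime time_retime sgn_proper_time sgn_0_0)

lemma sgn_time_psi [simp]: "sgn (time (psi p)) = sgn (time p)"
  by (simp add: psi_eq_retime)

text \<open>Source of the scaling constants 4/9 and 9/4 below.\<close>

lemma sgn_square_proper_time: "sgn t * (proper_time t)\<^sup>2 = 4/9 * t ^ 3"
proof -
  have "(proper_time t)\<^sup>2 = \<bar>proper_time t\<bar>\<^sup>2" by simp
  also have "\<dots> = 4/9 * (\<bar>t\<bar> powr (3/2)) ^ 2" by (simp add: abs_proper_time power2_eq_square)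
  also have "(\<bar>t\<bar> powr (3/2)) ^ 2 = \<bar>t\<bar> ^ 3"
  proof -
    have "(\<bar>t\<bar> powr (3/2)) ^ 2 = \<bar>t\<bar> powr 3" by (simp add: power2_eq_square powr_add[symmetric])
    then show ?thesis by (cases "t = 0") (simp_all add: powr_numeral)
  qed
  finally show ?thesis by (simp add: power3_eq_cube abs_if sgn_if)
qed

lemma signed_square_time_psi: "signed_square_time (psi p) = retime (\<lambda>t. 4/9 * t) (cube_time p)"
  by (simp add: signed_square_time_def cube_time_def retime_def psi_eq_retime sgn_square_proper_time)

lemma has_real_derivative_transform_eventually:
  "(f has_real_derivative D) (at x) \<Longrightarrow> \<forall>\<^sub>F y in nhds x. f y = g y \<Longrightarrow> (g has_real_derivative D) (at x)"
  using DERIV_cong_ev[of x x f g D D] by simp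

lemma has_derivative_proper_time: "(proper_time has_real_derivative \<bar>t\<bar> powr (1/2)) (at t)"
proof -
  consider "t > 0" | "t < 0" | "t = 0" by linarith
  then show ?thesis
  proof cases
    case 1
    have "((\<lambda>t. 2/3 * t powr (3/2)) has_real_derivative 2/3 * (3/2 * t powr (3/2 - 1))) (at t)"
      using 1 by (intro DERIV_cmult has_real_derivative_powr)
    then have "((\<lambda>t. 2/3 * t powr (3/2)) has_real_derivative \<bar>t\<bar> powr (1/2)) (at t)"
      using 1 by simp
    moreover have "\<forall>\<^sub>F s in nhds t. 2/3 * s powr (3/2) = proper_time s"
      using eventually_nhds_in_open[of "{0<..}" t] 1 by (auto elim!: eventually_mono simp: proper_time_def)
    ultimately show ?thesis by (rule has_real_derivative_transform_eventually)
  next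
    case 2
    have "((\<lambda>t. - (2/3) * (- t) powr (3/2)) has_real_derivative - (2/3) * (3/2 * (- t) powr (3/2 - 1) * (-1))) (at t)"
      using 2 by (intro DERIV_cmult DERIV_chain2[where g="\<lambda>t. - t"] has_real_derivative_powr) (auto intro!: derivative_eq_intros)
    then have "((\<lambda>t. - (2/3) * (- t) powr (3/2)) has_real_derivative \<bar>t\<bar> powr (1/2)) (at t)"
      using 2 by simp
    moreover have "\<forall>\<^sub>F s in nhds t. - (2/3) * (- s) powr (3/2) = proper_time s"
      using eventually_nhds_in_open[of "{..<0}" t] 2 by (auto elim!: eventually_mono simp: proper_time_def)
    ultimately show ?thesis by (rule has_real_derivative_transform_eventually)
  next
    case 3
    \<comment> \<open>At 0 the rule for powers does not apply, but the difference quotient is 2/3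
      |s|^(1/2).\<close>
    have "(\<lambda>s. proper_time s / s) \<midarrow>0\<rightarrow> 0"
    proof (rule Lim_transform_eventually)
      have "isCont (\<lambda>s::real. 2/3 * \<bar>s\<bar> powr (1/2)) 0"
        by (auto intro!: continuous_intros simp: isCont_def intro!: tendsto_eq_intros tendsto_zero_powrI)
      then show "(\<lambda>s::real. 2/3 * \<bar>s\<bar> powr (1/2)) \<midarrow>0\<rightarrow> 0" by (simp add: isCont_def)
      have "2/3 * \<bar>s\<bar> powr (1/2) = proper_time s / s" if "s \<noteq> 0" for s :: real
      proof -
        have "\<bar>s\<bar> powr (3/2) = \<bar>s\<bar> powr (1 + 1/2)" by simp
        also have "\<dots> = \<bar>s\<bar> * \<bar>s\<bar> powr (1/2)" using that by (subst powr_add) simp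
        finally show ?thesis using that by (simp add: proper_time_def abs_if sgn_if)
      qed
      then show "\<forall>\<^sub>F s in at 0. 2/3 * \<bar>s\<bar> powr (1/2) = proper_time s / s"
        by (auto simp: eventually_at_filter)
    qed
    then show ?thesis using 3 by (simp add: DERIV_def proper_time_def)
  qed
qed

definition coordinate_time_deriv :: "real \<Rightarrow> real" where
  "coordinate_time_deriv s = (3/2 * \<bar>s\<bar>) powr (-1/3)"

text \<open>With c for \<open>coordinate_time\<close>, c'^2 c = sgn s is locally constant, and
  differentiating this gives c'' = -c'^2 / (2 c). Here 1/(2 c) is the \<open>lapse_log_deriv\<close>
  of -t at time c, as \<open>einstein_retime\<close> expects.\<close>

lemma has_derivative_coordinate_time:
  assumes "s \<noteq> 0"
  shows "(coordinate_time has_real_derivative coordinate_time_deriv s) (at s)"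
    and "(coordinate_time_deriv has_real_derivative - (coordinate_time_deriv s)\<^sup>2 * (1 / (2 * coordinate_time s))) (at s)"
proof -
  \<comment> \<open>Near \<open>s\<close> the sign is the constant \<open>e\<close> and the absolute
    value is multiplication by \<open>e\<close>, so one computation serves both signs.\<close>
  define e where "e = sgn s"
  have e: "e * e = 1" "\<bar>s\<bar> = e * s" "e \<noteq> 0" using assms by (auto simp: e_def sgn_if)
  have pos: "3/2 * (e * s) > 0" using assms e(2) by (metis zero_less_abs_iff zero_less_mult_iff zero_less_divide_iff zero_less_numeral)
  have ev: "\<forall>\<^sub>F x in nhds s. sgn x = e \<and> \<bar>x\<bar> = e * x"
  proof (cases "s > 0")
    case True
    then show ?thesis using eventually_nhds_in_open[of "{0<..}" s] by (auto elim!: eventually_mono simp: e_def)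
  next
    case False
    then show ?thesis using eventually_nhds_in_open[of "{..<0}" s] assms by (auto elim!: eventually_mono simp: e_def)
  qed
  have d: "((\<lambda>s. (3/2 * (e * s)) powr a) has_real_derivative a * (3/2 * (e * s)) powr (a - 1) * (3/2 * e)) (at s)" for a
  proof -
    have "((\<lambda>s. 3/2 * (e * s)) has_real_derivative 3/2 * e) (at s)" by (auto intro!: derivative_eq_intros)
    from DERIV_chain2[OF has_real_derivative_powr[OF pos] this] show ?thesis .
  qed
  have "((\<lambda>s. e * (3/2 * (e * s)) powr (2/3)) has_real_derivative e * ((2/3) * (3/2 * (e * s)) powr (2/3 - 1) * (3/2 * e))) (at s)"
    by (rule DERIV_cmult) (rule d)
  moreover have "e * ((2/3) * (3/2 * (e * s)) powr (2/3 - 1) * (3/2 * e)) = coordinate_time_deriv s"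
    using e by (simp add: coordinate_time_deriv_def)
  moreover have "\<forall>\<^sub>F x in nhds s. e * (3/2 * (e * x)) powr (2/3) = coordinate_time x"
    using ev by eventually_elim (auto simp: coordinate_time_def)
  ultimately show "(coordinate_time has_real_derivative coordinate_time_deriv s) (at s)"
    using has_real_derivative_transform_eventually by metis
  have X: "(3/2 * (e * s)) powr (-1/3 - 1) = ((3/2 * (e * s)) powr (-1/3))\<^sup>2 / (3/2 * (e * s)) powr (2/3)"
    by (simp add: power2_eq_square powr_add[symmetric] powr_diff[symmetric])
  have "(-1/3) * (3/2 * (e * s)) powr (-1/3 - 1) * (3/2 * e) = - (coordinate_time_deriv s)\<^sup>2 * (1 / (2 * coordinate_time s))"
    unfolding X coordinate_time_deriv_def coordinate_time_def e(2) e_def[symmetric]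
  proof -
    have e': "1 / e = e" using e by (simp add: field_simps)
    have "1 / (2 * (e * B)) = (1 / e) / (2 * B)" for B by simp
    then show "- 1 / 3 * (((3 / 2 * (e * s)) powr (- 1 / 3))\<^sup>2 / (3 / 2 * (e * s)) powr (2 / 3)) * (3 / 2 * e) =
      - ((3 / 2 * (e * s)) powr (- 1 / 3))\<^sup>2 * (1 / (2 * (e * (3 / 2 * (e * s)) powr (2 / 3))))"
      by (simp add: e')
  qed
  moreover have "\<forall>\<^sub>F x in nhds s. (3/2 * (e * x)) powr (-1/3) = coordinate_time_deriv x"
    using ev by eventually_elim (auto simp: coordinate_time_deriv_def)
  ultimately show "(coordinate_time_deriv has_real_derivative - (coordinate_time_deriv s)\<^sup>2 * (1 / (2 * coordinate_time s))) (at s)"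
    using d[of "-1/3"] has_real_derivative_transform_eventually by metis
qed

lemma coordinate_time_deriv_nonzero: "s \<noteq> 0 \<Longrightarrow> coordinate_time_deriv s \<noteq> 0"
  by (simp add: coordinate_time_deriv_def)

lemma proper_lapse: "s \<noteq> 0 \<Longrightarrow> - sgn s = (coordinate_time_deriv s)\<^sup>2 * (- coordinate_time s)"
proof -
  assume s: "s \<noteq> 0"
  have "(coordinate_time_deriv s)\<^sup>2 * (3/2 * \<bar>s\<bar>) powr (2/3) = 1"
    using s by (simp add: coordinate_time_deriv_def power2_eq_square powr_add[symmetric])
  then show ?thesis by (simp add: coordinate_time_def mult.left_commute)
qed

section \<open>Signature and degeneracy of a split form\<close>

lemma positive_definite_imp_invertible:
  fixes A :: "real^'n^'n"
  assumes "positive_definite A"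
  shows "invertible A"
proof -
  have "x = 0" if "A *v x = 0" for x
    using assms that unfolding positive_definite_def by (metis inner_zero_right less_irrefl)
  then show ?thesis
    using matrix_left_invertible_ker[of A] invertible_left_inverse by blast
qed

lemma quadratic_split_form:
  "v \<bullet> (split_form n h *v v) = n * (time v)\<^sup>2 + space_part v \<bullet> (h *v space_part v)"
  by (simp add: inner_vec_def matrix_vector_mult_def sum_option time_def space_part_def power2_eq_square sum_distrib_left)

lemma transpose_split_form: "transpose h = h \<Longrightarrow> transpose (split_form n h) = split_form n h"
  by (simp add: vec_eq_iff transpose_def all_option)

lemma event_eq_0_iff: "v = 0 \<longleftrightarrow> time v = 0 \<and> space_part v = 0"
  by (simp add: vec_eq_iff all_option time_def space_part_def)

lemma positive_definite_split_form:
  assumes "0 < n" "positive_definite h"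
  shows "positive_definite (split_form n h)"
  unfolding positive_definite_def
proof (intro conjI allI impI)
  show "transpose (split_form n h) = split_form n h"
    using assms by (simp add: positive_definite_def transpose_split_form)
  fix v :: spacetime assume "v \<noteq> 0"
  then consider "time v \<noteq> 0" | "space_part v \<noteq> 0" using event_eq_0_iff by blast
  then show "0 < v \<bullet> (split_form n h *v v)"
  proof cases
    case 1
    then have "0 < n * (time v)\<^sup>2" using assms by simp
    moreover have "0 \<le> space_part v \<bullet> (h *v space_part v)"
      using assms(2) unfolding positive_definite_def by (cases "space_part v = 0") (auto intro: less_imp_le)
    ultimately show ?thesis by (simp add: quadratic_split_form)
  next
    case 2
    then have "0 < space_part v \<bullet> (h *v space_part v)"
      using assms(2) unfolding positive_definite_def by blast
    moreover have "0 \<le> n * (time v)\<^sup>2" using assms by simp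
    ultimately show ?thesis by (simp add: quadratic_split_form)
  qed
qed

text \<open>Leaving the factor as \<open>det (split_form 1 h)\<close> avoids block determinants;
  what matters about it is that it is continuous and nonzero.\<close>

lemma det_split_form: "det (split_form n h) = n * det (split_form 1 h)"
proof -
  let ?D = "split_form n (mat 1)"
  have "split_form n h = ?D ** split_form 1 h"
    by (simp add: split_form_matrix_mult)
  moreover have "det ?D = n"
  proof -
    have "det ?D = (\<Prod>i\<in>UNIV. ?D $ i $ i)"
    proof (rule det_diagonal)
      fix i j :: "3 option" assume "i \<noteq> j"
      then show "?D $ i $ j = 0" by (cases i; cases j) (auto simp: mat_def)
    qed
    also have "\<dots> = n"
      unfolding UNIV_option by (subst prod.insert) (auto simp: prod.reindex mat_def)
    finally show ?thesis .
  qed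
  ultimately show ?thesis by (simp add: det_mul)
qed

lemma det_split_form_1: "positive_definite h \<Longrightarrow> det (split_form 1 h) \<noteq> 0"
  using positive_definite_imp_invertible[OF positive_definite_split_form[of 1 h]] by (simp add: invertible_det_nz)

text \<open>The time axis is a negative line. On any negative subspace \<open>time\<close> is
  injective, since the difference of two vectors with equal time is purely spatial and the form is
  nonnegative on it; hence the dimension is at most 1.\<close>

lemma lorentzian_split_form:
  assumes n: "n < 0" and h: "positive_definite h"
  shows "lorentzian (split_form n h)"
  unfolding lorentzian_def
proof (intro conjI)
  show "transpose (split_form n h) = split_form n h"
    using h by (simp add: positive_definite_def transpose_split_form)
  show "det (split_form n h) \<noteq> 0"
    using det_split_form[of n h] det_split_form_1[OF h] n by simp
  let ?neg = "\<lambda>W. subspace W \<and> (\<forall>v\<in>W. v \<noteq> 0 \<longrightarrow> v \<bullet> (split_form n h *v v) < 0)"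
  have le: "dim W \<le> 1" if W: "?neg W" for W
  proof -
    have lin: "linear time" by (rule linearI) simp_all
    have "inj_on time (span W)"
    proof (rule inj_onI)
      fix v w assume vw: "v \<in> span W" "w \<in> span W" "time v = time w"
      then have "v - w \<in> W" using W by (metis span_eq_iff subspace_diff)
      moreover have "time (v - w) = 0" using vw(3) by (simp add: time_def)
      then have "v - w = 0 \<or> \<not> (v - w) \<bullet> (split_form n h *v (v - w)) < 0"
        using h unfolding quadratic_split_form positive_definite_def
        by (cases "space_part (v - w) = 0") (auto simp: not_less less_imp_le)
      ultimately have "v - w = 0" using W by blast
      then show "v = w" by simp
    qed
    then have "dim W = dim (time ` W)" using dim_image_eq[OF lin] by metis
    also have "\<dots> \<le> 1" using dim_subset_UNIV[of "time ` W"] by simp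
    finally show ?thesis .
  qed
  have mem: "?neg (span {axis None 1})"
  proof (intro conjI ballI impI subspace_span)
    fix v :: spacetime assume "v \<in> span {axis None 1}" "v \<noteq> 0"
    then obtain c where "v = c *\<^sub>R axis None 1" "c \<noteq> 0" by (auto simp: span_singleton)
    then show "v \<bullet> (split_form n h *v v) < 0"
      using n by (simp add: quadratic_split_form mult_neg_pos)
  qed
  have dim1: "dim (span {axis None (1::real) :: spacetime}) = 1"
    by (simp add: dim_span dim_singleton)
  show "metric_index (split_form n h) = 1"
    unfolding metric_index_def
  proof (rule Max_eqI)
    show "finite {dim W |W. ?neg W}"
      by (rule finite_subset[of _ "{..1}"]) (use le in auto)
    show "y \<le> 1" if "y \<in> {dim W |W. ?neg W}" for y using that le by auto
    show "1 \<in> {dim W |W. ?neg W}" unfolding mem_Collect_eq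
      by (rule exI[of _ "span {axis None 1}"], rule conjI[OF dim1[symmetric] mem])
  qed
qed

text \<open>The neighbourhood consists of the points where the sum of the absolute components of the
  continuous field \<open>e\<close> stays below its value at \<open>p\<close> plus 1.\<close>

lemma continuous_on_imp_bounded_near_time_zero:
  assumes S: "open S" and e: "\<And>a b. continuous_on S (\<lambda>q. e q $ a $ b)"
    and T: "\<And>q. q \<in> S \<Longrightarrow> time q \<noteq> 0 \<Longrightarrow> T q = e q"
  shows "bounded_near_time_zero S T"
  unfolding bounded_near_time_zero_def
proof (intro ballI impI)
  fix p assume p: "p \<in> S"
  define M where "M q = (\<Sum>a\<in>UNIV. \<Sum>b\<in>UNIV. \<bar>e q $ a $ b\<bar>)" for q
  have le: "\<bar>e q $ a $ b\<bar> \<le> M q" for q a b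
  proof -
    have "\<bar>e q $ a $ b\<bar> \<le> (\<Sum>b\<in>UNIV. \<bar>e q $ a $ b\<bar>)" by (rule member_le_sum) auto
    also have "\<dots> \<le> M q" unfolding M_def by (rule member_le_sum) (auto intro!: sum_nonneg)
    finally show ?thesis .
  qed
  have "continuous_on S M" unfolding M_def[abs_def] by (intro continuous_intros e)
  then have "open (M -` {..<M p + 1} \<inter> S)"
    using S by (simp add: continuous_on_open_vimage)
  moreover have "p \<in> M -` {..<M p + 1} \<inter> S" using p by simp
  moreover have "\<bar>T q $ a $ b\<bar> \<le> M p + 1" if "q \<in> M -` {..<M p + 1} \<inter> S" "time q \<noteq> 0" for q a b
    using that T[of q] le[of q a b] by simp
  ultimately show "\<exists>W B. open W \<and> p \<in> W \<and> W \<subseteq> S \<and> (\<forall>q\<in>W. time q \<noteq> 0 \<longrightarrow> (\<forall>a b. \<bar>T q $ a $ b\<bar> \<le> B))"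
    by (intro exI[of _ "M -` {..<M p + 1} \<inter> S"] exI[of _ "M p + 1"]) auto
qed


section \<open>Pulling back along \<open>psi\<close>\<close>

lemma partial_deriv_psi:
  "partial_deriv None (\<lambda>q. psi q $ None) p = \<bar>time p\<bar> powr (1/2)"
  "partial_deriv (Some i) (\<lambda>q. psi q $ None) p = 0"
  "partial_deriv None (\<lambda>q. psi q $ Some j) p = 0"
  "partial_deriv (Some i) (\<lambda>q. psi q $ Some j) p = (if i = j then 1 else 0)"
proof -
  have N: "(\<lambda>q. psi q $ None) = (\<lambda>q. proper_time (time q))"
    by (simp add: psi_eq_retime retime_def)
  show "partial_deriv None (\<lambda>q. psi q $ None) p = \<bar>time p\<bar> powr (1/2)"
    unfolding N by (rule partial_deriv_of_time(1)[OF has_derivative_proper_time])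
  show "partial_deriv (Some i) (\<lambda>q. psi q $ None) p = 0"
    unfolding N by (rule partial_deriv_Some_of_time)
  have s: "psi q $ Some j = space_part q $ j" for q
    by (simp add: psi_eq_retime retime_def)
  show "partial_deriv None (\<lambda>q. psi q $ Some j) p = 0"
    unfolding s by (rule partial_derivI) simp
  have "axis i (1::real) $ j = (if i = j then 1 else 0)" by (auto simp: axis_def)
  then show "partial_deriv (Some i) (\<lambda>q. psi q $ Some j) p = (if i = j then 1 else 0)"
    unfolding s by (intro partial_derivI) (auto intro!: derivative_eq_intros)
qed

text \<open>The squared derivative |t| of \<open>proper_time\<close> turns -sgn t into -t. At time 0
  both are 0, so no case distinction arises.\<close>

lemma pullback_psi:
  assumes "g' (psi p) = split_form (- sgn (time (psi p))) K"
  shows "pullback psi g' p = split_form (- time p) K"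
proof -
  have "- sgn (time p) * (\<bar>time p\<bar> powr (1/2)) * (\<bar>time p\<bar> powr (1/2)) = - time p"
    by (simp add: powr_add[symmetric] mult.assoc) (simp add: sgn_mult_abs)
  moreover have "(\<Sum>j\<in>UNIV. \<Sum>k\<in>UNIV. A j k * (if i = j then 1 else 0) * (if l = k then 1 else 0)) = A i l"
    for A :: "3 \<Rightarrow> 3 \<Rightarrow> real" and i l
    using exhaust_3[of i] exhaust_3[of l] by (auto simp: sum_3)
  ultimately show ?thesis
    unfolding vec_eq_iff all_option
    by (simp only: pullback_def vec_lambda_beta sum_option partial_deriv_psi assms split_form_nth sgn_time_psi) simp
qed

text \<open>Time 0 is excluded on both sides: there \<open>coordinate_time\<close> is not
  differentiable and the coefficient -sgn jumps.\<close>

lemma einstein_coordinate_time: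
  assumes U: "open U" and \<epsilon>: "0 < \<epsilon>" and geom: "slice_geometry (slab \<epsilon> U) h" and \<phi>: "smooth_on (slab \<epsilon> U) \<phi>"
    and g: "\<And>p. p \<in> slab \<epsilon> U \<Longrightarrow> g p = split_form (- time p) (h p)"
    and g': "\<And>q. q \<in> slab (2/3 * \<epsilon> powr (3/2)) U \<Longrightarrow> g' q = split_form (- sgn (time q)) (h (retime coordinate_time q))"
    and q: "q \<in> slab (2/3 * \<epsilon> powr (3/2)) U" "time q \<noteq> 0"
  shows "ricci g' q - (scalar_curvature g' q / 2) *\<^sub>R g' q
        = \<kappa> *\<^sub>R energy_momentum V g' (\<lambda>q. \<phi> (retime coordinate_time q)) q \<longleftrightarrow>
    ricci g (retime coordinate_time q) - (scalar_curvature g (retime coordinate_time q) / 2) *\<^sub>R g (retime coordinate_time q)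
        = \<kappa> *\<^sub>R energy_momentum V g \<phi> (retime coordinate_time q)"
proof -
  interpret slice_geometry "slab \<epsilon> U" h by (rule geom)
  let ?S = "{p \<in> slab \<epsilon> U. time p \<noteq> 0}" and ?S' = "{q \<in> slab (2/3 * \<epsilon> powr (3/2)) U. time q \<noteq> 0}"
  have ne: "coordinate_time s \<noteq> 0 \<longleftrightarrow> s \<noteq> 0" for s by (metis sgn_coordinate_time sgn_0_0)
  show ?thesis
  proof (rule einstein_retime[where S="?S" and S'="?S'" and c=coordinate_time and dc=coordinate_time_deriv
        and n="\<lambda>t. - t" and n'="\<lambda>t. - sgn t" and h=h])
    show "open ?S" by (rule open_time_nonzero[OF S])
    show "open ?S'" by (rule open_time_nonzero[OF open_slab[OF U]])
    show "retime coordinate_time q \<in> ?S" if "q \<in> ?S'" for q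
      using that \<epsilon> ne by (simp add: retime_in_slab_iff)
    show "g q = split_form (- time q) (h q)" if "q \<in> ?S" for q using that g by simp
    show "g' q = split_form (- sgn (time q)) (h (retime coordinate_time q))" if "q \<in> ?S'" for q using that g' by simp
    show "- time q \<noteq> 0" if "q \<in> ?S" for q using that by simp
    show "invertible (h q)" if "q \<in> ?S" for q using that h_invertible by simp
    show "smooth_on ?S (\<lambda>q. h q $ i $ j)" for i j
      by (rule smooth_on_subset[OF h_smooth]) auto
    show "(coordinate_time has_real_derivative coordinate_time_deriv (time q)) (at (time q))" if "q \<in> ?S'" for q
      using that has_derivative_coordinate_time(1) by simp
    show "coordinate_time_deriv (time q) \<noteq> 0" if "q \<in> ?S'" for q
      using that coordinate_time_deriv_nonzero by simp
    show "(coordinate_time_deriv has_real_derivative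
        - (coordinate_time_deriv (time q))\<^sup>2 * lapse_log_deriv (\<lambda>t. - t) (retime coordinate_time q)) (at (time q))"
      if "q \<in> ?S'" for q
      using that has_derivative_coordinate_time(2)[of "time q"] ne by (simp add: lapse_log_deriv_uminus)
    show "- sgn (time q) = (coordinate_time_deriv (time q))\<^sup>2 * - coordinate_time (time q)" if "q \<in> ?S'" for q
      using that by (intro proper_lapse) simp
    show "lapse_log_deriv (\<lambda>t. - sgn t) q = 0" if "q \<in> ?S'" for q
    proof -
      have "(sgn has_real_derivative 0) (at (time q))"
      proof (rule has_real_derivative_transform_eventually)
        show "((\<lambda>_. sgn (time q)) has_real_derivative 0) (at (time q))" by simp
        show "\<forall>\<^sub>F s in nhds (time q). sgn (time q) = sgn s"
        proof (cases "time q > 0")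
          case True
          then show ?thesis using eventually_nhds_in_open[of "{0<..}" "time q"] by (auto elim!: eventually_mono)
        next
          case False
          then show ?thesis using eventually_nhds_in_open[of "{..<0}" "time q"] that by (auto elim!: eventually_mono)
        qed
      qed
      then have "((\<lambda>t. - sgn t) has_real_derivative - 0) (at (time q))" by (rule DERIV_minus)
      from partial_deriv_of_time(1)[OF this] show ?thesis by (simp add: lapse_log_deriv_def)
    qed
    show "smooth_on ?S (second_form (\<lambda>t. - t) h i j)" for i j by (rule second_form_smooth)
    show "q \<in> ?S'" using q by simp
    show "smooth_on ?S \<phi>" by (rule smooth_on_subset[OF \<phi>]) auto
  qed
qed

section \<open>From proper time to the type changing metric\<close>

lemma real_analytic_on_scale_cube:
  assumes "real_analytic_on F (signed_square_time ` S')" "\<And>p. p \<in> S \<Longrightarrow> psi p \<in> S'"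
  shows "real_analytic_on (\<lambda>q. F (retime (\<lambda>t. 4/9 * t) q)) (cube_time ` S)"
proof (rule real_analytic_on_retime[OF assms(1)])
  show "has_power_series (\<lambda>t. 4/9 * t) (time q)" for q by (rule has_power_series_mult)
  show "retime (\<lambda>t. 4/9 * t) q \<in> signed_square_time ` S'" if q: "q \<in> cube_time ` S" for q
  proof -
    obtain p where p: "p \<in> S" "q = cube_time p" using q by blast
    show ?thesis
      unfolding p(2) signed_square_time_psi[symmetric] using assms(2)[OF p(1)] by blast
  qed
qed

lemma real_analytic_on_cube:
  assumes "real_analytic_on F (cube_time ` S)"
  shows "real_analytic_on (\<lambda>q. F (cube_time q)) S"
  unfolding cube_time_eq_retime
  by (rule real_analytic_on_retime[OF assms]) (auto intro: has_power_series_cube simp flip: cube_time_eq_retime)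

lemma depends_analytically_via_cube_time:
  assumes S: "open S" and f: "\<And>p. p \<in> S \<Longrightarrow> f p = f' (psi p)" and S': "\<And>p. p \<in> S \<Longrightarrow> psi p \<in> S'"
    and f': "depends_analytically_via signed_square_time S' f'"
  shows "depends_analytically_via cube_time S f" "real_analytic_on f S"
proof -
  obtain F where F: "real_analytic_on F (signed_square_time ` S')" "\<And>q. q \<in> S' \<Longrightarrow> f' q = F (signed_square_time q)"
    using f' unfolding depends_analytically_via_def by blast
  let ?F = "\<lambda>q. F (retime (\<lambda>t. 4/9 * t) q)"
  have F': "real_analytic_on ?F (cube_time ` S)"
    by (rule real_analytic_on_scale_cube[OF F(1) S'])
  have eq: "f p = ?F (cube_time p)" if "p \<in> S" for p
    using F(2)[OF S'[OF that]] f[OF that] by (simp add: signed_square_time_psi)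
  show "depends_analytically_via cube_time S f"
    unfolding depends_analytically_via_def by (rule exI[of _ ?F]) (use F' eq in auto)
  show "real_analytic_on f S"
    by (rule real_analytic_on_cong[OF S _ real_analytic_on_cube[OF F']]) (simp add: eq)
qed

lemma type_changing_split_form:
  assumes U: "open U" and g: "\<And>p. p \<in> slab r U \<Longrightarrow> g p = split_form (- time p) (h p)"
    and h: "\<And>p. p \<in> slab r U \<Longrightarrow> positive_definite (h p)"
    and an: "\<And>i j. real_analytic_on (\<lambda>p. h p $ i $ j) (slab r U)"
  shows "analytic_transverse_type_changing (slab r U) g" "transverse_radical (slab r U) g"
proof -
  let ?S = "slab r U"
  have S: "open ?S" by (rule open_slab[OF U])
  have sm: "smooth_on ?S (\<lambda>p. h p $ i $ j)" for i j by (rule real_analytic_on_imp_smooth_on[OF an])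
  have det: "det (g p) = - time p * det (split_form 1 (h p))" if "p \<in> ?S" for p
    using det_split_form[of "- time p" "h p"] g[OF that] by simp
  have deg: "degeneracy_set ?S g = {p \<in> ?S. time p = 0}"
    using det det_split_form_1 h by (auto simp: degeneracy_set_def)
  show "analytic_transverse_type_changing ?S g"
    unfolding analytic_transverse_type_changing_def
  proof (intro conjI allI ballI)
    fix a b
    have "real_analytic_on (\<lambda>p. split_form (- time p) (h p) $ a $ b) ?S"
      by (cases a; cases b) (simp_all add: real_analytic_on_uminus_time real_analytic_on_const an)
    then show "real_analytic_on (\<lambda>p. g p $ a $ b) ?S"
      by (rule real_analytic_on_cong[OF S, rotated]) (simp add: g)
  next
    fix p assume "p \<in> ?S"
    then show "transpose (g p) = g p"
      using h by (simp add: g transpose_split_form positive_definite_def)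
  next
    fix p assume "p \<in> degeneracy_set ?S g"
    then have p: "p \<in> ?S" "time p = 0" by (auto simp: deg)
    let ?D = "\<lambda>q. det (split_form 1 (h q))"
    have "smooth_on ?S (\<lambda>q. split_form 1 (h q) $ a $ b)" for a b
      by (cases a; cases b) (simp_all add: smooth_on_const sm)
    then have "smooth_on ?S ?D" by (rule smooth_on_det[OF S])
    then have "continuous_on ?S ?D" by (rule smooth_on_continuous)
    then have "isCont ?D p" using S p(1) by (simp add: continuous_on_eq_continuous_at)
    then have D: "(?D \<longlongrightarrow> ?D p) (at p)" by (simp add: isCont_def)
    \<comment> \<open>Since \<open>time\<close> vanishes at \<open>p\<close>, continuity of
      \<open>?D\<close> at \<open>p\<close> is enough for the product to be differentiable
      there.\<close>
    have "((\<lambda>q. - time q * ?D q) has_derivative (\<lambda>v. - time v * ?D p)) (at p)"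
      unfolding has_derivative_at
    proof (intro conjI)
      show "bounded_linear (\<lambda>v. - time v * ?D p)"
        unfolding linear_conv_bounded_linear[symmetric] by (rule linearI) (simp_all add: algebra_simps)
      have "((\<lambda>v. \<bar>?D (p + v) - ?D p\<bar>) \<longlongrightarrow> 0) (at 0)"
        using LIM_offset_zero[OF D] by (auto intro!: tendsto_rabs_zero simp: LIM_zero_iff)
      then show "(\<lambda>v. norm (- time (p + v) * ?D (p + v) - - time p * ?D p - - time v * ?D p) / norm v) \<midarrow>0\<rightarrow> 0"
      proof (rule Lim_null_comparison[rotated], intro always_eventually allI)
        fix v :: spacetime
        have "\<bar>time v\<bar> \<le> norm v" by (simp add: time_def component_le_norm_cart)
        then have "\<bar>time v\<bar> * \<bar>?D (p + v) - ?D p\<bar> \<le> norm v * \<bar>?D (p + v) - ?D p\<bar>" by (rule mult_right_mono) simp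
        moreover have "- time (p + v) * ?D (p + v) - - time p * ?D p - - time v * ?D p = - time v * (?D (p + v) - ?D p)"
          using p(2) by (simp add: algebra_simps)
        ultimately show "norm (norm (- time (p + v) * ?D (p + v) - - time p * ?D p - - time v * ?D p) / norm v)
            \<le> \<bar>?D (p + v) - ?D p\<bar>"
          by (cases "v = 0") (simp_all add: abs_mult divide_le_eq mult.commute)
      qed
    qed
    then have "((\<lambda>q. det (g q)) has_derivative (\<lambda>v. - time v * ?D p)) (at p)"
      by (rule has_derivative_transform_within_open[OF _ S p(1)]) (simp add: det)
    moreover have "(\<lambda>v. - time v * ?D p) \<noteq> (\<lambda>_. 0)"
    proof
      assume "(\<lambda>v. - time v * ?D p) = (\<lambda>_. 0)"
      then have "- time (axis None 1) * ?D p = 0" by (rule fun_cong)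
      then show False using det_split_form_1[OF h[OF p(1)]] by simp
    qed
    ultimately show "\<exists>L. ((\<lambda>q. det (g q)) has_derivative L) (at p) \<and> L \<noteq> (\<lambda>_. 0)" by blast
  next
    fix p assume "p \<in> ?S - degeneracy_set ?S g"
    then have p: "p \<in> ?S" "time p \<noteq> 0" by (auto simp: deg)
    then consider "- time p > 0" | "- time p < 0" by linarith
    then show "positive_definite (g p) \<or> lorentzian (g p)"
      using positive_definite_split_form lorentzian_split_form h[OF p(1)] g[OF p(1)] by cases auto
  qed
  show "transverse_radical ?S g"
    unfolding transverse_radical_def
  proof
    fix p assume "p \<in> degeneracy_set ?S g"
    then have p: "p \<in> ?S" "time p = 0" by (auto simp: deg)
    have "\<exists>v w. z = v + w \<and> v \<in> radical (g p) \<and> w \<in> tangent_vectors (degeneracy_set ?S g) p" for z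
    proof (intro exI conjI)
      \<comment> \<open>The time component lies in the radical; the remainder is the velocity of a
        straight line inside the slice of time 0.\<close>
      let ?v = "time z *\<^sub>R axis None (1 :: real) :: spacetime" and ?w = "z - time z *\<^sub>R axis None 1"
      show "z = ?v + ?w" by simp
      show "?v \<in> radical (g p)"
        unfolding radical_def g[OF p(1)] p(2)
        by (simp add: inner_vec_def sum_option matrix_vector_mult_def)
      have tw: "time ?w = 0" by (simp add: time_def)
      have "\<forall>\<^sub>F s in nhds 0. p + s *\<^sub>R ?w \<in> ?S" by (rule eventually_line_in_open[OF S p(1)])
      then have "\<forall>\<^sub>F s in nhds 0. p + s *\<^sub>R ?w \<in> degeneracy_set ?S g"
        by eventually_elim (simp add: deg p(2) tw del: scaleR_diff_right)
      moreover have "((\<lambda>s. p + s *\<^sub>R ?w) has_vector_derivative ?w) (at 0)"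
        by (auto intro!: derivative_eq_intros)
      ultimately show "?w \<in> tangent_vectors (degeneracy_set ?S g) p"
        unfolding tangent_vectors_def by (intro CollectI exI[of _ "\<lambda>s. p + s *\<^sub>R ?w"]) simp
    qed
    then show "{v + w |v w. v \<in> radical (g p) \<and> w \<in> tangent_vectors (degeneracy_set ?S g) p} = UNIV" by blast
  qed
qed

lemma slice_geometryI:
  assumes "open U" "\<And>p. p \<in> slab r U \<Longrightarrow> positive_definite (h p)"
    "\<And>i j. real_analytic_on (\<lambda>p. h p $ i $ j) (slab r U)"
  shows "slice_geometry (slab r U) h"
  by unfold_locales
    (use assms in \<open>auto simp: positive_definite_def open_slab intro: real_analytic_on_imp_smooth_on
      intro!: positive_definite_imp_invertible\<close>)

lemma grad_square:
  assumes "invertible (g p)"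
  shows "grad g \<phi> p \<bullet> (g p *v grad g \<phi> p)
    = (\<Sum>a\<in>UNIV. \<Sum>b\<in>UNIV. matrix_inv (g p) $ a $ b * (partial_deriv a \<phi> p * partial_deriv b \<phi> p))"
proof -
  define d where "d = (\<chi> b. partial_deriv b \<phi> p)"
  have grad: "grad g \<phi> p = matrix_inv (g p) *v d" by (simp add: grad_def d_def)
  then have "g p *v grad g \<phi> p = d"
    by (simp add: matrix_vector_mul_assoc matrix_inv_mult[OF assms])
  then show ?thesis
    unfolding grad by (simp add: d_def inner_vec_def matrix_vector_mult_def sum_distrib_left sum_distrib_right mult_ac)
qed

text \<open>The critical term is -\<phi>'^2 / t in the squared gradient, from the inverse of -t
  dt^2. Since \<phi> = F(t^3, x), the time derivative is 3 t^2 k with \<open>k\<close> continuous,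
  so this term is -9 t^3 k^2; \<open>N\<close> is the resulting continuous extension of the squared
  gradient.\<close>

lemma bounded_energy_momentum:
  assumes U: "open U" and geom: "slice_geometry (slab r U) h"
    and g: "\<And>p. p \<in> slab r U \<Longrightarrow> g p = split_form (- time p) (h p)"
    and \<phi>: "real_analytic_on \<phi> (slab r U)" "depends_analytically_via cube_time (slab r U) \<phi>"
    and V: "real_analytic_on V UNIV"
  shows "bounded_near_time_zero (slab r U) (energy_momentum V g \<phi>)"
proof -
  let ?S = "slab r U"
  interpret slice_geometry ?S h by (rule geom)
  have \<phi>s: "smooth_on ?S \<phi>" by (rule real_analytic_on_imp_smooth_on[OF \<phi>(1)])
  obtain F where F: "real_analytic_on F (cube_time ` ?S)" "\<And>p. p \<in> ?S \<Longrightarrow> \<phi> p = F (cube_time p)"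
    using \<phi>(2) unfolding depends_analytically_via_def by blast
  note Fs = real_analytic_on_imp_smooth_on[OF F(1)]
  define k where "k p = dt F (cube_time p)" for p
  have cube: "continuous_on ?S cube_time"
  proof -
    have "continuous_on ?S (\<lambda>p. case a of None \<Rightarrow> time p ^ 3 | Some i \<Rightarrow> space_part p $ i)" for a
      by (cases a) (auto intro!: continuous_intros)
    then show ?thesis
      unfolding cube_time_def[abs_def] event_def by (rule continuous_on_vec_lambda)
  qed
  have k: "continuous_on ?S k"
    unfolding k_def[abs_def]
    by (rule continuous_on_compose2[OF smooth_on_continuous[OF smooth_on_partial_deriv[OF Fs]] cube]) simp
  have dt\<phi>: "dt \<phi> p = 3 * (time p)\<^sup>2 * k p" if p: "p \<in> ?S" for p
  proof -
    have "dt \<phi> p = dt (\<lambda>q. F (retime (\<lambda>t. t ^ 3) q)) p"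
      by (rule partial_deriv_cong[OF S p]) (simp add: F(2) cube_time_eq_retime)
    also have "\<dots> = (3 * (time p)\<^sup>2) * dt F (retime (\<lambda>t. t ^ 3) p)"
    proof (rule partial_deriv_None_retime)
      show "differentiable_along None F (retime (\<lambda>t. t ^ 3) p)"
        using smooth_on_differentiable[OF Fs] p by (auto simp flip: cube_time_eq_retime)
      show "((\<lambda>t. t ^ 3) has_real_derivative 3 * (time p)\<^sup>2) (at (time p))"
        by (auto intro!: derivative_eq_intros)
    qed
    finally show ?thesis by (simp add: k_def cube_time_eq_retime)
  qed
  define N where "N q = - 9 * time q ^ 3 * (k q)\<^sup>2 + (\<Sum>i\<in>UNIV. \<Sum>j\<in>UNIV. H i j q * (dx i \<phi> q * dx j \<phi> q))" for q
  define e where "e q = (\<chi> a b. partial_deriv a \<phi> q * partial_deriv b \<phi> q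
      - (1/2) * (N q + V (\<phi> q)) * split_form (- time q) (h q) $ a $ b)" for q
  show ?thesis
  proof (rule continuous_on_imp_bounded_near_time_zero[OF S])
    have c1: "continuous_on ?S (\<lambda>q. split_form (- time q) (h q) $ a $ b)" for a b
      by (cases a; cases b) (auto intro!: continuous_intros smooth_on_continuous[OF h_smooth])
    have c2: "continuous_on ?S N"
      unfolding N_def[abs_def]
      by (intro continuous_intros k smooth_on_continuous[OF H_smooth] smooth_on_continuous[OF smooth_on_partial_deriv[OF \<phi>s]])
    have c3: "continuous_on ?S (\<lambda>q. V (\<phi> q))"
      by (rule smooth_on_continuous[OF smooth_on_compose[OF S \<phi>s V]])
    show "continuous_on ?S (\<lambda>q. e q $ a $ b)" for a b
      unfolding e_def vec_lambda_beta
      by (intro continuous_on_diff continuous_on_mult continuous_on_add continuous_on_const c1 c2 c3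
          smooth_on_continuous[OF smooth_on_partial_deriv[OF \<phi>s]])
  next
    fix q assume q: "q \<in> ?S" "time q \<noteq> 0"
    have mi: "matrix_inv (g q) = split_form (1 / - time q) (matrix_inv (h q))"
      using q by (simp add: g matrix_inv_split_form h_invertible)
    have "g q ** matrix_inv (g q) = mat 1"
      unfolding mi using q by (simp add: g split_form_matrix_mult matrix_inv_mult h_invertible split_form_mat_1)
    then have "invertible (g q)" using invertible_right_inverse by blast
    then have "grad g \<phi> q \<bullet> (g q *v grad g \<phi> q) = N q"
      unfolding grad_square mi N_def using q
      by (simp add: grad_square mi sum_option dt\<phi> power2_eq_square power3_eq_cube)
    then show "energy_momentum V g \<phi> q = e q"
      using q(1) by (simp add: energy_momentum_def e_def g)
  qed
qed

lemma pullback_of_signed_square_solution: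
  fixes g' :: "(3 option) tensor2"
  assumes U: "open U" and \<epsilon>: "0 < \<epsilon>" and \<delta>: "\<delta> = 2/3 * \<epsilon> powr (3/2)" and V: "real_analytic_on V UNIV"
    and sol: "signed_square_solution \<kappa> V \<delta> U g' \<phi>'"
  defines "g \<equiv> pullback psi g'" and "\<phi> \<equiv> \<phi>' \<circ> psi"
  shows "(\<exists>h :: spacetime \<Rightarrow> real^3^3. (\<forall>p\<in>slab \<epsilon> U. g p = split_form (- time p) (h p)) \<and>
             (\<forall>i j. depends_analytically_via cube_time (slab \<epsilon> U) (\<lambda>p. h p $ i $ j))) \<and>
          depends_analytically_via cube_time (slab \<epsilon> U) \<phi> \<and>
          analytic_transverse_type_changing (slab \<epsilon> U) g \<and>
          transverse_radical (slab \<epsilon> U) g \<and>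
          solves_einstein_scalar \<kappa> V {p\<in>slab \<epsilon> U. time p \<noteq> 0} g \<phi> \<and>
          bounded_near_time_zero (slab \<epsilon> U) (energy_momentum V g \<phi>)"
proof -
  let ?S = "slab \<epsilon> U" and ?S' = "slab \<delta> U"
  obtain h' where g': "\<And>q. q \<in> ?S' \<Longrightarrow> g' q = split_form (- sgn (time q)) (h' q)"
    and pos': "\<And>q. q \<in> ?S' \<Longrightarrow> positive_definite (h' q)"
    and an': "\<And>i j. depends_analytically_via signed_square_time ?S' (\<lambda>q. h' q $ i $ j)"
    and \<phi>': "depends_analytically_via signed_square_time ?S' \<phi>'"
    and ein: "solves_einstein_scalar \<kappa> V {q \<in> ?S'. time q \<noteq> 0} g' \<phi>'"
    using sol unfolding signed_square_solution_def by blast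
  define h where "h p = h' (psi p)" for p
  have S: "open ?S" by (rule open_slab[OF U])
  have psi: "psi p \<in> ?S'" if "p \<in> ?S" for p using that psi_in_slab_iff[OF \<epsilon>] unfolding \<delta> by blast
  have g: "g p = split_form (- time p) (h p)" if "p \<in> ?S" for p
    unfolding g_def h_def by (rule pullback_psi) (rule g'[OF psi[OF that]])
  have pos: "positive_definite (h p)" if "p \<in> ?S" for p
    unfolding h_def by (rule pos'[OF psi[OF that]])
  have h_dep: "depends_analytically_via cube_time ?S (\<lambda>p. h p $ i $ j)"
    and h_an: "real_analytic_on (\<lambda>p. h p $ i $ j) ?S" for i j
    by (rule depends_analytically_via_cube_time[OF S _ psi an'[of i j]]; simp add: h_def)+
  have \<phi>_dep: "depends_analytically_via cube_time ?S \<phi>" and \<phi>_an: "real_analytic_on \<phi> ?S"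
    by (rule depends_analytically_via_cube_time[OF S _ psi \<phi>']; simp add: \<phi>_def)+
  have geom: "slice_geometry ?S h" by (rule slice_geometryI[OF U pos h_an])
  have "ricci g p - (scalar_curvature g p / 2) *\<^sub>R g p = \<kappa> *\<^sub>R energy_momentum V g \<phi> p"
    if p: "p \<in> ?S" "time p \<noteq> 0" for p
  proof -
    have q: "psi p \<in> slab (2/3 * \<epsilon> powr (3/2)) U" "time (psi p) \<noteq> 0" using psi[OF p(1)] p(2) by (simp_all add: \<delta>)
    have "g' q = split_form (- sgn (time q)) (h (retime coordinate_time q))" if "q \<in> slab (2/3 * \<epsilon> powr (3/2)) U" for q
      using that by (simp add: g' \<delta> h_def)
    from einstein_coordinate_time[OF U \<epsilon> geom real_analytic_on_imp_smooth_on[OF \<phi>_an] g this q, of \<kappa> V]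
    show ?thesis
      using ein q unfolding solves_einstein_scalar_def by (simp add: \<phi>_def \<delta>)
  qed
  then have "solves_einstein_scalar \<kappa> V {p\<in>?S. time p \<noteq> 0} g \<phi>"
    unfolding solves_einstein_scalar_def by blast
  moreover have "\<exists>h :: spacetime \<Rightarrow> real^3^3. (\<forall>p\<in>?S. g p = split_form (- time p) (h p)) \<and>
             (\<forall>i j. depends_analytically_via cube_time ?S (\<lambda>p. h p $ i $ j))"
    using g h_dep by blast
  ultimately show ?thesis
    using \<phi>_dep type_changing_split_form[OF U g pos h_an] bounded_energy_momentum[OF U geom g \<phi>_an \<phi>_dep V] by blast
qed


section \<open>From the type changing metric to proper time\<close>

text \<open>Scaling by 9/4 turns the signed square of the new time into t^3, on which the cube-root
  form of \<open>f\<close> is analytic by \<open>real_analytic_on_root_time\<close>.\<close>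

lemma depends_analytically_via_signed_square_time:
  assumes U: "open U" and \<epsilon>: "0 < \<epsilon>" and f: "real_analytic_on f (slab \<epsilon> U)"
    and 3: "\<And>x n. x \<in> U \<Longrightarrow> n mod 3 \<noteq> 0 \<Longrightarrow> (partial_deriv None ^^ n) f (event 0 x) = 0"
  shows "depends_analytically_via signed_square_time (slab (2/3 * \<epsilon> powr (3/2)) U) (\<lambda>q. f (retime coordinate_time q))"
proof -
  let ?S = "slab \<epsilon> U" and ?S' = "slab (2/3 * \<epsilon> powr (3/2)) U"
  let ?F = "\<lambda>q. f (retime (root 3) (retime (\<lambda>t. 9/4 * t) q))"
  have eq: "retime (\<lambda>t. 9/4 * t) (signed_square_time q) = cube_time (retime coordinate_time q)" for q
  proof -
    have "signed_square_time q = signed_square_time (psi (retime coordinate_time q))" by simp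
    then show ?thesis unfolding signed_square_time_psi by (simp add: retime_def)
  qed
  have "real_analytic_on ?F (signed_square_time ` ?S')"
  proof (rule real_analytic_on_retime[OF real_analytic_on_root_time[OF U f 3]])
    show "has_power_series (\<lambda>t. 9/4 * t) (time q)" for q by (rule has_power_series_mult)
    show "retime (\<lambda>t. 9/4 * t) q \<in> cube_time ` ?S" if q: "q \<in> signed_square_time ` ?S'" for q
    proof -
      obtain p where p: "p \<in> ?S'" "q = signed_square_time p" using q by blast
      show ?thesis
        unfolding p(2) eq using p(1) retime_in_slab_iff[OF \<epsilon>] by blast
    qed
  qed
  moreover have "f (retime coordinate_time q) = ?F (signed_square_time q)" for q
    unfolding eq by simp
  ultimately show ?thesis
    unfolding depends_analytically_via_def by blast
qed

lemma signed_square_solution_of_type_changing: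
  fixes g :: "(3 option) tensor2"
  assumes U: "open U" and \<epsilon>: "0 < \<epsilon>" and \<delta>: "\<delta> = 2/3 * \<epsilon> powr (3/2)" and V: "real_analytic_on V UNIV" and \<kappa>: "\<kappa> > 0"
    and g: "\<And>p. p \<in> slab \<epsilon> U \<Longrightarrow> g p = split_form (- time p) (h p)"
    and pos: "\<And>p. p \<in> slab \<epsilon> U \<Longrightarrow> positive_definite (h p)"
    and h: "\<And>i j. real_analytic_on (\<lambda>p. h p $ i $ j) (slab \<epsilon> U)" and \<phi>: "real_analytic_on \<phi> (slab \<epsilon> U)"
    and ein: "solves_einstein_scalar \<kappa> V {p\<in>slab \<epsilon> U. time p \<noteq> 0} g \<phi>"
  shows "\<exists>(g' :: (3 option) tensor2) (\<phi>' :: spacetime \<Rightarrow> real).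
           signed_square_solution \<kappa> V \<delta> U g' \<phi>' \<and>
           (\<forall>p\<in>slab \<epsilon> U. g p = pullback psi g' p \<and> \<phi> p = \<phi>' (psi p))"
proof -
  let ?S = "slab \<epsilon> U" and ?S' = "slab \<delta> U"
  define h' where "h' q = h (retime coordinate_time q)" for q
  define g' where "g' q = split_form (- sgn (time q)) (h' q)" for q
  define \<phi>' where "\<phi>' q = \<phi> (retime coordinate_time q)" for q
  have geom: "slice_geometry ?S h" by (rule slice_geometryI[OF U pos h])
  note \<phi>s = real_analytic_on_imp_smooth_on[OF \<phi>]
  interpret slice_geometry ?S h by (rule geom)
  interpret type_changing_solution ?S h g \<phi> V \<kappa>
    by unfold_locales (use g \<phi>s V \<kappa> ein in \<open>auto simp: solves_einstein_scalar_def\<close>)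
  have ev: "event 0 x \<in> ?S" if "x \<in> U" for x using that \<epsilon> by (simp add: mem_slab_iff)
  note vanish = time_derivatives_vanish[OF U ev]
  have mem: "retime coordinate_time q \<in> ?S" if "q \<in> ?S'" for q
    using that retime_in_slab_iff[OF \<epsilon>] unfolding \<delta> by blast
  have "depends_analytically_via signed_square_time ?S' (\<lambda>q. h' q $ i $ j)" for i j
    unfolding \<delta> h'_def
    using depends_analytically_via_signed_square_time[OF U \<epsilon> h[of i j]] vanish(1) by blast
  moreover have "depends_analytically_via signed_square_time ?S' \<phi>'"
    unfolding \<delta> \<phi>'_def[abs_def]
    using depends_analytically_via_signed_square_time[OF U \<epsilon> \<phi>] vanish(2) by blast
  moreover have "positive_definite (h' q)" if "q \<in> ?S'" for q
    unfolding h'_def by (rule pos[OF mem[OF that]])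
  moreover have "ricci g' q - (scalar_curvature g' q / 2) *\<^sub>R g' q = \<kappa> *\<^sub>R energy_momentum V g' \<phi>' q"
    if q: "q \<in> ?S'" "time q \<noteq> 0" for q
  proof -
    have "coordinate_time (time q) \<noteq> 0" using q(2) by (metis sgn_coordinate_time sgn_0_0)
    then have "ricci g (retime coordinate_time q) - (scalar_curvature g (retime coordinate_time q) / 2) *\<^sub>R g (retime coordinate_time q)
        = \<kappa> *\<^sub>R energy_momentum V g \<phi> (retime coordinate_time q)"
      using ein mem[OF q(1)] unfolding solves_einstein_scalar_def by simp
    then show ?thesis
      using einstein_coordinate_time[OF U \<epsilon> geom \<phi>s g, of g' q \<kappa> V] q
      by (simp add: g'_def[abs_def] h'_def[abs_def] \<phi>'_def[abs_def] \<delta>)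
  qed
  ultimately have "signed_square_solution \<kappa> V \<delta> U g' \<phi>'"
    unfolding signed_square_solution_def solves_einstein_scalar_def g'_def by blast
  moreover have "g p = pullback psi g' p \<and> \<phi> p = \<phi>' (psi p)" if "p \<in> ?S" for p
    using pullback_psi[of g' p "h p"] g[OF that] by (simp add: g'_def h'_def \<phi>'_def)
  ultimately show ?thesis by blast
qed


theorem mainTheorem3:
  fixes U :: "(real^3) set" and \<epsilon> \<delta> \<kappa> :: real and V :: "real \<Rightarrow> real"
  assumes "open U" and "connected U"
    and "\<epsilon> > 0" and "\<delta> = 2/3 * \<epsilon> powr (3/2)"
    and "\<kappa> > 0" and "real_analytic_on V UNIV"
  shows
    "(\<forall>(g' :: (3 option) tensor2) (\<phi>' :: spacetime \<Rightarrow> real).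
        signed_square_solution \<kappa> V \<delta> U g' \<phi>' \<longrightarrow>
        (let g = pullback psi g'; \<phi> = \<phi>' \<circ> psi in
          (\<exists>h :: spacetime \<Rightarrow> real^3^3.
             (\<forall>p\<in>slab \<epsilon> U. g p = split_form (- time p) (h p)) \<and>
             (\<forall>i j. depends_analytically_via cube_time (slab \<epsilon> U) (\<lambda>p. h p $ i $ j))) \<and>
          depends_analytically_via cube_time (slab \<epsilon> U) \<phi> \<and>
          analytic_transverse_type_changing (slab \<epsilon> U) g \<and>
          transverse_radical (slab \<epsilon> U) g \<and>
          solves_einstein_scalar \<kappa> V {p\<in>slab \<epsilon> U. time p \<noteq> 0} g \<phi> \<and>
          bounded_near_time_zero (slab \<epsilon> U) (energy_momentum V g \<phi>))) \<and>
     (\<forall>(g :: (3 option) tensor2) (\<phi> :: spacetime \<Rightarrow> real) (h :: spacetime \<Rightarrow> real^3^3).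
        (\<forall>p\<in>slab \<epsilon> U. g p = split_form (- time p) (h p) \<and> positive_definite (h p)) \<and>
        (\<forall>i j. real_analytic_on (\<lambda>p. h p $ i $ j) (slab \<epsilon> U)) \<and>
        real_analytic_on \<phi> (slab \<epsilon> U) \<and>
        solves_einstein_scalar \<kappa> V {p\<in>slab \<epsilon> U. time p \<noteq> 0} g \<phi> \<and>
        bounded_near_time_zero (slab \<epsilon> U) (energy_momentum V g \<phi>) \<longrightarrow>
        (\<exists>(g' :: (3 option) tensor2) (\<phi>' :: spacetime \<Rightarrow> real).
           signed_square_solution \<kappa> V \<delta> U g' \<phi>' \<and>
           (\<forall>p\<in>slab \<epsilon> U. g p = pullback psi g' p \<and> \<phi> p = \<phi>' (psi p))))"
proof (rule conjI; intro allI impI)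
  fix g' :: "(3 option) tensor2" and \<phi>' :: "spacetime \<Rightarrow> real"
  assume "signed_square_solution \<kappa> V \<delta> U g' \<phi>'"
  from pullback_of_signed_square_solution[OF assms(1,3,4,6) this]
  show "let g = pullback psi g'; \<phi> = \<phi>' \<circ> psi in
          (\<exists>h :: spacetime \<Rightarrow> real^3^3.
             (\<forall>p\<in>slab \<epsilon> U. g p = split_form (- time p) (h p)) \<and>
             (\<forall>i j. depends_analytically_via cube_time (slab \<epsilon> U) (\<lambda>p. h p $ i $ j))) \<and>
          depends_analytically_via cube_time (slab \<epsilon> U) \<phi> \<and>
          analytic_transverse_type_changing (slab \<epsilon> U) g \<and>
          transverse_radical (slab \<epsilon> U) g \<and>
          solves_einstein_scalar \<kappa> V {p\<in>slab \<epsilon> U. time p \<noteq> 0} g \<phi> \<and>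
          bounded_near_time_zero (slab \<epsilon> U) (energy_momentum V g \<phi>)"
    unfolding Let_def .
next
  fix g :: "(3 option) tensor2" and \<phi> :: "spacetime \<Rightarrow> real" and h :: "spacetime \<Rightarrow> real^3^3"
  assume "(\<forall>p\<in>slab \<epsilon> U. g p = split_form (- time p) (h p) \<and> positive_definite (h p)) \<and>
        (\<forall>i j. real_analytic_on (\<lambda>p. h p $ i $ j) (slab \<epsilon> U)) \<and>
        real_analytic_on \<phi> (slab \<epsilon> U) \<and>
        solves_einstein_scalar \<kappa> V {p\<in>slab \<epsilon> U. time p \<noteq> 0} g \<phi> \<and>
        bounded_near_time_zero (slab \<epsilon> U) (energy_momentum V g \<phi>)"
  then show "\<exists>(g' :: (3 option) tensor2) (\<phi>' :: spacetime \<Rightarrow> real).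
           signed_square_solution \<kappa> V \<delta> U g' \<phi>' \<and>
           (\<forall>p\<in>slab \<epsilon> U. g p = pullback psi g' p \<and> \<phi> p = \<phi>' (psi p))"
    by (intro signed_square_solution_of_type_changing[OF assms(1,3,4,6,5), where h=h]) auto
qed

end
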